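(* Let $0<s<1$ and $1<p<\infty$, and suppose that $u(x,t)\in \big(C^{1,1}_{loc}(\mathbb{R}^n)\cap \mathcal{L}_{2s}\big)\times C^1(\mathbb{R})$ is a positive bounded classical solution of $$\frac{\partial u}{\partial t}(x,t)+(-\Delta)^s u(x,t)=x_1 u^p(x,t),\qquad (x,t)\in\mathbb{R}^n\times\mathbb{R}.$$ Then $u(x,t)$ is monotone increasing along the $x_1$ direction.
   Context: Here $n\ge 1$ is the space dimension, and $x_1$ denotes the first coordinate of $x=(x_1,\dots,x_n)\in\mathbb{R}^n$. For each fixed $t\in\mathbb{R}$, the fractional Laplacian acts on the variable $x$ only: $$(-\Delta)^s u(x,t)=C_{n,s}\lim_{\varepsilon\to0^+}\int_{\mathbb{R}^n\setminus B_\varepsilon(x)}\frac{u(x,t)-u(y,t)}{|x-y|^{n+2s}}\,dy,$$ where $C_{n,s}>0$ is the usual normalization constant and $B_\varepsilon(x)$ is the ball of radius $\varepsilon$ centered at $x$. The space $\mathcal{L}_{2s}$ consists of the functions $v\in L^1_{loc}(\mathbb{R}^n)$ with $\int_{\mathbb{R}^n}\frac{|v(x)|}{1+|x|^{n+2s}}\,dx<+\infty$. The notation $u\in (C^{1,1}_{loc}(\mathbb{R}^n)\cap\mathcal{L}_{2s})\times C^1(\mathbb{R})$ means that $u(\cdot,t)\in C^{1,1}_{loc}(\mathbb{R}^n)\cap\mathcal{L}_{2s}$ for each $t\in\mathbb{R}$ and $u(x,\cdot)\in C^1(\mathbb{R})$ for each $x\in\mathbb{R}^n$. A classical (entire) solution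 is a function in this class satisfying the equation pointwise in $\mathbb{R}^n\times\mathbb{R}$. Positive means $u>0$ everywhere, and bounded means bounded on $\mathbb{R}^n\times\mathbb{R}$. *)

theory Defs
  imports "HOL-Analysis.Analysis"
begin

definition locally_integrable :: "(real ^ 'n \<Rightarrow> real) \<Rightarrow> bool" where
  "locally_integrable v \<longleftrightarrow> (\<forall>K. compact K \<longrightarrow> set_integrable lebesgue K v)"

definition L_2s :: "real \<Rightarrow> (real ^ 'n \<Rightarrow> real) set" where
  "L_2s s = {v. locally_integrable v \<and>
     integrable lebesgue (\<lambda>x. \<bar>v x\<bar> / (1 + norm x powr (real CARD('n) + 2 * s)))}"

text \<open>Differentiable functions whose gradient is Lipschitz on every compact set;
  the gradient is then automatically continuous.\<close>

definition C11_loc :: "(real ^ 'n \<Rightarrow> real) set" where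
  "C11_loc = {v. \<exists>g. (\<forall>x. GDERIV v x :> g x) \<and>
     (\<forall>K. compact K \<longrightarrow> (\<exists>L. L-lipschitz_on K g))}"

text \<open>The constant for which the operator below has Fourier symbol
  \<open>\<bar>\<xi>\<bar>\<close> to the power \<open>2 s\<close>, where \<open>n\<close> is the space dimension and
  \<open>0 < s < 1\<close> (so \<open>Gamma (- s) < 0\<close>).\<close>

definition frac_laplacian_const :: "nat \<Rightarrow> real \<Rightarrow> real" where
  "frac_laplacian_const n s =
     4 powr s * Gamma (real n / 2 + s) / (pi powr (real n / 2) * \<bar>Gamma (- s)\<bar>)"

text \<open>For \<open>0 < s < 1\<close> and \<open>v\<close> in both \<open>C11_loc\<close> and \<open>L_2s s\<close> the integrals are finite and
  the limit exists; otherwise the value may be meaningless.\<close>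

definition frac_laplacian :: "real \<Rightarrow> (real ^ 'n \<Rightarrow> real) \<Rightarrow> real ^ 'n \<Rightarrow> real" where
  "frac_laplacian s v x = frac_laplacian_const CARD('n) s *
     Lim (at_right 0) (\<lambda>\<epsilon>. LINT y:(UNIV - ball x \<epsilon>)|lebesgue.
       (v x - v y) / norm (x - y) powr (real CARD('n) + 2 * s))"

text \<open>The regularity is separate in the two variables: nothing joint in \<open>(x, t)\<close> is required.\<close>

definition solution_class :: "real \<Rightarrow> (real ^ 'n \<Rightarrow> real \<Rightarrow> real) set" where
  "solution_class s = {u. (\<forall>t. (\<lambda>x. u x t) \<in> C11_loc \<inter> L_2s s) \<and>
     (\<forall>x. (\<lambda>t. u x t) C1_differentiable_on UNIV)}"

text \<open>The coordinates of \<open>real ^ 'n\<close> carry no order, so the index \<open>i\<close> names the one that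
  plays the role of the first coordinate.\<close>

definition classical_solution ::
    "real \<Rightarrow> real \<Rightarrow> 'n \<Rightarrow> (real ^ 'n \<Rightarrow> real \<Rightarrow> real) \<Rightarrow> bool" where
  "classical_solution s p i u \<longleftrightarrow> u \<in> solution_class s \<and>
     (\<forall>x t. deriv (\<lambda>\<tau>. u x \<tau>) t + frac_laplacian s (\<lambda>y. u y t) x = x $ i * u x t powr p)"

end

theory Submission
  imports Defs
begin

text \<open>The proof is the method of moving planes. For a plane \<open>{x. x $ i = \<mu>}\<close> let \<open>w \<mu> x t\<close> be the value
of \<open>u\<close> at the mirror image of \<open>x\<close> minus its value at \<open>x\<close>. Monotonicity in direction \<open>i\<close> says that
\<open>w \<mu> \<ge> 0\<close> to the left of every plane. The function \<open>w \<mu>\<close> is antisymmetric and satisfies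
\<open>w_t + (-\<Delta>)^s w = x_i (v^p - u^p) + 2 (\<mu> - x_i) v^p\<close>, where \<open>v\<close> is the reflected solution.

Suppose that the infimum of \<open>w \<mu>\<close> on the left is \<open>-m < 0\<close>, and let \<open>d = \<mu> - x_i\<close>. Near an almost
optimal point the left side of the equation is at most \<open>- const * m * d^(-2s)\<close>
(\<open>antisym_negative_minimum\<close>): the mirror image of a deep valley is a high peak, and it is seen
from distance of order \<open>d\<close>. If \<open>x_i \<le> 0\<close> the right side is nonnegative, since \<open>v < u\<close>; this settles
all planes with \<open>\<mu> \<le> 0\<close>. If \<open>x_i > 0\<close>, then \<open>x_i (u^p - v^p) \<le> \<mu> p u^(p-1) m\<close>, so a contradiction
arises when \<open>u\<close> is small or \<open>d\<close> is small. In the remaining case both are bounded below, and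
then the source term \<open>2 d v^p\<close> beats everything as soon as \<open>u - v\<close> is below some threshold \<open>m0\<close>
that depends only on an upper bound for \<open>\<mu>\<close> (\<open>reflected_above_gap\<close>). Hence a violation, if
there is one, has depth more than \<open>m0\<close> somewhere in the strip \<open>0 < x_i < \<mu>\<close>. Since \<open>u\<close> is
uniformly continuous in direction \<open>i\<close> on strips (\<open>w_modulus\<close>, another application of the same
estimate), such a violation cannot appear suddenly while the plane moves from \<open>0\<close> to the right.
No compactness of solutions and no limiting profiles are involved.

One analytic point needs care: \<open>u\<close> is regular in \<open>x\<close> for each \<open>t\<close> and in \<open>t\<close> for each \<open>x\<close>, but
nothing joint is assumed, so that a minimum over space and time might not be attained. The
argument follows the spatial minimum backwards in time (\<open>backward_minimum\<close>), and this only
needs \<open>u(x, t) \<rightarrow> u(x, a)\<close> as \<open>t\<close> decreases to \<open>a\<close>, uniformly for bounded \<open>x\<close>. That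
property (\<open>right_lipschitz_in_time\<close>) follows from the equation: spatial mollifications of \<open>u\<close> are
jointly continuous, and on time intervals on which they satisfy the mollified equation a barrier
controls their growth. A Baire category argument in the spirit of the Looman-Menchoff
theorem shows that the mollified equation holds at all times.\<close>

section \<open>The singular kernel and its second-difference operator\<close>

definition frac_kernel :: "real \<Rightarrow> real ^ 'n \<Rightarrow> real" where
  "frac_kernel s z = 1 / norm z powr (real CARD('n) + 2 * s)"

text \<open>The weight against which second differences are measured: quadratic near the origin, where
regularity helps, and constant at infinity, where only boundedness is available. With the scale
\<open>r\<close> built in, one integral provides every factor \<open>r powr (- 2 * s)\<close> below.\<close>

definition trunc_quad :: "real \<Rightarrow> real ^ 'n \<Rightarrow> real" where
  "trunc_quad r z = min 1 ((norm z / r)\<^sup>2)"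

lemma frac_kernel_nonneg [simp]: "0 \<le> frac_kernel s z"
  by (simp add: frac_kernel_def)

lemma frac_kernel_minus [simp]: "frac_kernel s (- z) = frac_kernel s z"
  by (simp add: frac_kernel_def)

lemma frac_kernel_measurable [measurable]: "frac_kernel s \<in> borel_measurable borel"
  unfolding frac_kernel_def by measurable

lemma trunc_quad_measurable [measurable]: "trunc_quad r \<in> borel_measurable borel"
  unfolding trunc_quad_def by measurable

lemma trunc_quad_nonneg [simp]: "0 \<le> trunc_quad r z"
  by (simp add: trunc_quad_def)

lemma trunc_quad_le_1 [simp]: "trunc_quad r z \<le> 1"
  by (simp add: trunc_quad_def)

lemma trunc_quad_eq_1: "0 < r \<Longrightarrow> r \<le> norm z \<Longrightarrow> trunc_quad r z = 1"
  by (simp add: trunc_quad_def field_simps)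

lemma frac_kernel_antimono:
  fixes z w :: "real ^ 'n"
  assumes "0 < s" "0 < norm w" "norm w \<le> norm z"
  shows "frac_kernel s z \<le> frac_kernel s w"
  unfolding frac_kernel_def using assms
  by (intro divide_left_mono mult_pos_pos powr_mono2) auto

lemma frac_kernel_scaleR:
  fixes z :: "real ^ 'n"
  assumes "0 < c"
  shows "frac_kernel s (c *\<^sub>R z) = c powr (- (real CARD('n) + 2 * s)) * frac_kernel s z"
  proof -
  have "c powr (- (real CARD('n) + 2 * s)) * c powr (real CARD('n) + 2 * s) = 1"
    using assms by (simp only: powr_add [symmetric]) simp
  then have "c powr (- (real CARD('n) + 2 * s)) = 1 / c powr (real CARD('n) + 2 * s)"
    using assms by (simp only: powr_minus_divide)
  then show ?thesis using assms by (simp add: frac_kernel_def powr_mult)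
qed

text \<open>Cut space into dyadic annuli. Outside the unit ball their contributions are bounded by a geometric
series with ratio \<open>2 powr (- 2 * s)\<close>, inside by one with ratio \<open>2 powr (2 * s - 2)\<close>; both converge
because \<open>0 < s < 1\<close>. Balls instead of annuli suffice for the upper bound.\<close>

lemma integrable_unit_trunc_quad_kernel:
  assumes s: "0 < s" "s < 1"
  shows "integrable lborel (\<lambda>z::real^'n. trunc_quad 1 z * frac_kernel s z)"
proof -
  let ?n = "real CARD('n)"
  let ?f = "\<lambda>z::real^'n. trunc_quad 1 z * frac_kernel s z"
  define \<omega> where "\<omega> = unit_ball_vol ?n"
  have \<omega>: "0 \<le> \<omega>" by (simp add: \<omega>_def)
  have meas: "emeasure lborel (cball (0::real^'n) r) = ennreal (\<omega> * r powr ?n)" if "0 < r" for r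
    using emeasure_cball[of r "0::real^'n"] that
    by (simp add: \<omega>_def powr_realpow)
  define a where "a = (\<lambda>k::nat. 2 powr (- real k * (?n + 2 * s)))"
  define b where "b = (\<lambda>k::nat. 2 powr (- 2 * real k + real (Suc k) * (?n + 2 * s)))"
  define A where "A = (\<lambda>k::nat. cball (0::real^'n) (2 powr real (Suc k)))"
  define B where "B = (\<lambda>k::nat. cball (0::real^'n) (2 powr (- real k)))"
  let ?g = "\<lambda>z. (\<Sum>k. ennreal (a k) * indicator (A k) z) + (\<Sum>k. ennreal (b k) * indicator (B k) z)"
  have bound: "ennreal (?f z) \<le> ?g z" for z
  proof (cases "z = 0")
    case True then show ?thesis by (simp add: trunc_quad_def)
  next
    case False
    then have z: "0 < norm z" by simp
    \<comment> \<open>The annulus containing \<open>z\<close>.\<close>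
    define j where "j = \<lfloor>log 2 (norm z)\<rfloor>"
    have j: "2 powr real_of_int j \<le> norm z" "norm z \<le> 2 powr (real_of_int j + 1)"
    proof -
      have l: "2 powr log 2 (norm z) = norm z" using z by simp
      have "2 powr real_of_int j \<le> 2 powr log 2 (norm z)"
        unfolding j_def by (intro powr_mono) auto
      then show "2 powr real_of_int j \<le> norm z" unfolding l .
      have "log 2 (norm z) \<le> real_of_int j + 1" unfolding j_def by linarith
      then have "2 powr log 2 (norm z) \<le> 2 powr (real_of_int j + 1)" by (intro powr_mono) auto
      then show "norm z \<le> 2 powr (real_of_int j + 1)" unfolding l .
    qed
    have K: "frac_kernel s z \<le> 2 powr (- real_of_int j * (?n + 2 * s))"
    proof -
      have "(2 powr real_of_int j) powr (?n + 2 * s) \<le> norm z powr (?n + 2 * s)"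
        using j s by (intro powr_mono2) auto
      then show ?thesis using z
        by (simp add: frac_kernel_def powr_powr powr_minus divide_simps)
    qed
    show ?thesis
    proof (cases "0 \<le> j")
      case True
      define k where "k = nat j"
      have "?f z \<le> 1 * a k" unfolding a_def
        using K True by (intro mult_mono) (auto simp: k_def)
      moreover have "z \<in> A k" using j(2) True by (simp add: A_def k_def add.commute)
      ultimately have "ennreal (?f z) \<le> ennreal (a k) * indicator (A k) z"
        by (simp add: ennreal_leI)
      also have "\<dots> \<le> (\<Sum>k. ennreal (a k) * indicator (A k) z)"
        using sum_le_suminf[of "\<lambda>k. ennreal (a k) * indicator (A k) z" "{k}"]
        by (simp del: sum_mult_indicator)
      also have "\<dots> \<le> ?g z" by simp
      finally show ?thesis .
    next
      case False
      define k where "k = nat (- j - 1)"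
      have jk: "real_of_int j = - real (Suc k)" using False by (simp add: k_def)
      have zk: "norm z \<le> 2 powr (- real k)" using j(2) jk by simp
      have "trunc_quad 1 z \<le> (norm z)\<^sup>2" by (simp add: trunc_quad_def)
      also have "\<dots> \<le> (2 powr (- real k))\<^sup>2" using zk by (intro power_mono) auto
      also have "\<dots> = 2 powr (- 2 * real k)" by (simp add: power2_eq_square powr_add [symmetric])
      finally have "?f z \<le> 2 powr (- 2 * real k) * 2 powr (real (Suc k) * (?n + 2 * s))"
        using K unfolding jk by (intro mult_mono) (auto simp: add.commute)
      also have "\<dots> = b k" unfolding b_def by (subst powr_add [symmetric]) simp
      finally have "ennreal (?f z) \<le> ennreal (b k) * indicator (B k) z"
        using zk by (simp add: B_def ennreal_leI)
      also have "\<dots> \<le> (\<Sum>k. ennreal (b k) * indicator (B k) z)"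
        using sum_le_suminf[of "\<lambda>k. ennreal (b k) * indicator (B k) z" "{k}"]
        by (simp del: sum_mult_indicator)
      also have "\<dots> \<le> ?g z" by simp
      finally show ?thesis .
    qed
  qed
  have sumA: "(\<Sum>k. ennreal (a k) * emeasure lborel (A k)) < \<infinity>"
  proof -
    have eq: "ennreal (a k) * emeasure lborel (A k) = ennreal (\<omega> * 2 powr ?n * (2 powr (- 2 * s)) ^ k)" for k
    proof -
      have "a k * (2 powr real (Suc k)) powr ?n = 2 powr ?n * 2 powr (- 2 * s * real k)"
        by (simp add: a_def powr_powr powr_add [symmetric] algebra_simps)
      also have "\<dots> = 2 powr ?n * (2 powr (- 2 * s)) ^ k"
        by (simp add: powr_powr powr_realpow [symmetric])
      finally show ?thesis using \<omega>
        by (simp add: A_def meas ennreal_mult' [symmetric] a_def algebra_simps)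
    qed
    have "summable (\<lambda>k. \<omega> * 2 powr ?n * (2 powr (- 2 * s)) ^ k)"
      using s by (intro summable_mult summable_geometric) (simp add: powr_less_one)
    then show ?thesis unfolding eq using \<omega>
      by (subst suminf_ennreal2) auto
  qed
  have sumB: "(\<Sum>k. ennreal (b k) * emeasure lborel (B k)) < \<infinity>"
  proof -
    have eq: "ennreal (b k) * emeasure lborel (B k) = ennreal (\<omega> * 2 powr (?n + 2 * s) * (2 powr (2 * s - 2)) ^ k)" for k
    proof -
      have "b k * (2 powr (- real k)) powr ?n = 2 powr (?n + 2 * s) * 2 powr ((2 * s - 2) * real k)"
        by (simp add: b_def powr_powr powr_add [symmetric] algebra_simps)
      also have "\<dots> = 2 powr (?n + 2 * s) * (2 powr (2 * s - 2)) ^ k"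
        by (simp add: powr_powr powr_realpow [symmetric])
      finally show ?thesis using \<omega>
        by (simp add: B_def meas ennreal_mult' [symmetric] b_def algebra_simps)
    qed
    have "summable (\<lambda>k. \<omega> * 2 powr (?n + 2 * s) * (2 powr (2 * s - 2)) ^ k)"
      using s by (intro summable_mult summable_geometric) (simp add: powr_less_one)
    then show ?thesis unfolding eq using \<omega>
      by (subst suminf_ennreal2) auto
  qed
  have "(\<integral>\<^sup>+ z. ennreal (?f z) \<partial>lborel) \<le> (\<integral>\<^sup>+ z. ?g z \<partial>lborel)"
    by (intro nn_integral_mono bound)
  also have "\<dots> = (\<Sum>k. ennreal (a k) * emeasure lborel (A k)) + (\<Sum>k. ennreal (b k) * emeasure lborel (B k))"
  proof -
    have [measurable]: "A k \<in> sets borel" "B k \<in> sets borel" for k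
      by (auto simp: A_def B_def)
    show ?thesis by (simp add: nn_integral_add nn_integral_suminf nn_integral_cmult_indicator)
  qed
  also have "\<dots> < \<infinity>" using sumA sumB by simp
  finally show ?thesis
    by (intro integrableI_bounded) (auto simp: abs_mult)
qed

lemma lborel_integral_scaleR:
  fixes f :: "real ^ 'n \<Rightarrow> real"
  assumes "0 < c" and f: "f \<in> borel_measurable borel"
  shows "integral\<^sup>L lborel f = c powr real CARD('n) * (LINT z|lborel. f (c *\<^sub>R z))"
    and "integrable lborel f \<longleftrightarrow> integrable lborel (\<lambda>z. f (c *\<^sub>R z))"
proof -
  have eq: "lborel = density (distr lborel borel (\<lambda>x::real^'n. 0 + c *\<^sub>R x)) (\<lambda>_. \<bar>c\<bar> ^ CARD('n))"
    using lborel_affine[of c "0::real^'n"] assms by simp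
  have c: "c powr real CARD('n) = c ^ CARD('n)" using assms by (simp add: powr_realpow)
  note [measurable] = f
  show "integral\<^sup>L lborel f = c powr real CARD('n) * (LINT z|lborel. f (c *\<^sub>R z))"
    unfolding c using assms(1)
    by (subst eq) (simp add: integral_density integral_distr)
  show "integrable lborel f \<longleftrightarrow> integrable lborel (\<lambda>z. f (c *\<^sub>R z))"
    using assms(1)
    by (subst eq) (simp add: integrable_density integrable_distr_eq)
qed

lemma lborel_integral_translation:
  fixes f :: "real ^ 'n \<Rightarrow> real"
  assumes f: "f \<in> borel_measurable borel"
  shows "(LINT z|lborel. f (a + z)) = integral\<^sup>L lborel f"
    and "integrable lborel (\<lambda>z. f (a + z)) \<longleftrightarrow> integrable lborel f"
proof -
  note [measurable] = f
  have eq: "lborel = distr lborel borel ((+) a)" by (simp add: lborel_distr_plus)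
  show "(LINT z|lborel. f (a + z)) = integral\<^sup>L lborel f"
    by (subst (2) eq) (simp add: integral_distr)
  show "integrable lborel (\<lambda>z. f (a + z)) \<longleftrightarrow> integrable lborel f"
    by (subst (2) eq) (simp add: integrable_distr_eq)
qed

lemma lborel_integral_uminus:
  fixes f :: "real ^ 'n \<Rightarrow> real"
  assumes f: "f \<in> borel_measurable borel"
  shows "(LINT z|lborel. f (- z)) = integral\<^sup>L lborel f"
    and "integrable lborel (\<lambda>z. f (- z)) \<longleftrightarrow> integrable lborel f"
proof -
  note [measurable] = f
  have eq: "lborel = distr lborel borel (uminus :: real^'n \<Rightarrow> _)"
    using lborel_affine[of "-1" "0::real^'n"] by (simp add: density_1)
  show "(LINT z|lborel. f (- z)) = integral\<^sup>L lborel f"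
    by (subst (2) eq) (simp add: integral_distr)
  show "integrable lborel (\<lambda>z. f (- z)) \<longleftrightarrow> integrable lborel f"
    by (subst (2) eq) (simp add: integrable_distr_eq)
qed

definition kernel_mass :: "'n::finite itself \<Rightarrow> real \<Rightarrow> real" where
  "kernel_mass _ s = (LINT z::real^'n|lborel. trunc_quad 1 z * frac_kernel s z)"

text \<open>The kernel is homogeneous of degree \<open>- n - 2 * s\<close> and the volume of degree \<open>n\<close>.\<close>

lemma trunc_quad_kernel:
  assumes s: "0 < s" "s < 1" and r: "0 < r"
  shows "integrable lborel (\<lambda>z::real^'n. trunc_quad r z * frac_kernel s z)"
    and "(LINT z::real^'n|lborel. trunc_quad r z * frac_kernel s z) = kernel_mass TYPE('n) s * r powr (- 2 * s)"
proof -
  let ?f = "\<lambda>z::real^'n. trunc_quad r z * frac_kernel s z"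
  have sc: "?f (r *\<^sub>R z) = r powr (- (real CARD('n) + 2 * s)) * (trunc_quad 1 z * frac_kernel s z)" for z
    using r by (simp add: frac_kernel_scaleR trunc_quad_def)
  have "integrable lborel (\<lambda>z. ?f (r *\<^sub>R z))"
    unfolding sc using integrable_unit_trunc_quad_kernel[OF s] by (rule integrable_mult_right)
  then show "integrable lborel ?f"
    using lborel_integral_scaleR(2)[OF r, of ?f] by simp
  have "integral\<^sup>L lborel ?f = r powr real CARD('n) * (LINT z|lborel. ?f (r *\<^sub>R z))"
    by (rule lborel_integral_scaleR(1)[OF r]) simp
  also have "\<dots> = (r powr real CARD('n) * r powr (- (real CARD('n) + 2 * s))) * kernel_mass TYPE('n) s"
    unfolding sc by (simp add: kernel_mass_def)
  also have "r powr real CARD('n) * r powr (- (real CARD('n) + 2 * s)) = r powr (- 2 * s)"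
    by (simp add: powr_add [symmetric])
  finally show "(LINT z::real^'n|lborel. trunc_quad r z * frac_kernel s z) = kernel_mass TYPE('n) s * r powr (- 2 * s)"
    by simp
qed

lemma kernel_mass_nonneg: "0 \<le> kernel_mass TYPE('n::finite) s"
  unfolding kernel_mass_def by (intro Bochner_Integration.integral_nonneg) simp

definition second_diff :: "(real ^ 'n \<Rightarrow> real) \<Rightarrow> real ^ 'n \<Rightarrow> real ^ 'n \<Rightarrow> real" where
  "second_diff v x z = 2 * v x - v (x + z) - v (x - z)"

text \<open>Pairing \<open>z\<close> with \<open>- z\<close> removes the principal value: for regular functions this absolutely convergent
integral is the fractional Laplacian up to a positive factor. Linearity and comparison then become
statements about Lebesgue integrals, as long as the integrand is integrable, which is
recorded by the predicate \<open>nonlocal_at\<close>.\<close>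

definition nonlocal_op :: "real \<Rightarrow> (real ^ 'n \<Rightarrow> real) \<Rightarrow> real ^ 'n \<Rightarrow> real" where
  "nonlocal_op s v x = (LINT z|lborel. second_diff v x z * frac_kernel s z)"

definition nonlocal_at :: "real \<Rightarrow> (real ^ 'n \<Rightarrow> real) \<Rightarrow> real ^ 'n \<Rightarrow> bool" where
  "nonlocal_at s v x \<longleftrightarrow> integrable lborel (\<lambda>z. second_diff v x z * frac_kernel s z)"

lemma second_diff_measurable [measurable]:
  assumes [measurable]: "v \<in> borel_measurable borel"
  shows "second_diff v x \<in> borel_measurable borel"
  unfolding second_diff_def by measurable

lemma second_diff_diff: "second_diff (\<lambda>y. v y - w y) x z = second_diff v x z - second_diff w x z"
  by (simp add: second_diff_def)

lemma second_diff_cmult: "second_diff (\<lambda>y. c * v y) x z = c * second_diff v x z"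
  by (simp add: second_diff_def algebra_simps)

lemma nonlocal_diff:
  assumes "nonlocal_at s v x" "nonlocal_at s w x"
  shows "nonlocal_at s (\<lambda>y. v y - w y) x"
    and "nonlocal_op s (\<lambda>y. v y - w y) x = nonlocal_op s v x - nonlocal_op s w x"
  using assms unfolding nonlocal_at_def nonlocal_op_def second_diff_diff left_diff_distrib by auto

lemma nonlocal_cmult:
  assumes "nonlocal_at s v x"
  shows "nonlocal_at s (\<lambda>y. c * v y) x"
    and "nonlocal_op s (\<lambda>y. c * v y) x = c * nonlocal_op s v x"
  using assms unfolding nonlocal_at_def nonlocal_op_def second_diff_cmult mult.assoc by auto

lemma nonlocal_mono:
  assumes "nonlocal_at s v x" "nonlocal_at s w x" "\<And>z. second_diff v x z \<le> second_diff w x z"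
  shows "nonlocal_op s v x \<le> nonlocal_op s w x"
  using assms unfolding nonlocal_at_def nonlocal_op_def
  by (intro integral_mono mult_right_mono) auto

lemma nonlocal_trunc_quad_bound:
  fixes v :: "real ^ 'n \<Rightarrow> real"
  assumes s: "0 < s" "s < 1" and r: "0 < r" and [measurable]: "v \<in> borel_measurable borel"
    and b: "\<And>z. \<bar>second_diff v x z\<bar> \<le> c * trunc_quad r z"
  shows "nonlocal_at s v x" and "\<bar>nonlocal_op s v x\<bar> \<le> c * kernel_mass TYPE('n) s * r powr (- 2 * s)"
proof -
  have i: "integrable lborel (\<lambda>z::real^'n. c * (trunc_quad r z * frac_kernel s z))"
    using trunc_quad_kernel(1)[OF s r] by (rule integrable_mult_right)
  have le: "\<bar>second_diff v x z * frac_kernel s z\<bar> \<le> c * (trunc_quad r z * frac_kernel s z)" for z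
    using mult_right_mono[OF b[of z], of "frac_kernel s z"] by (simp add: abs_mult mult.assoc)
  show *: "nonlocal_at s v x" unfolding nonlocal_at_def
    by (rule Bochner_Integration.integrable_bound[OF i]) (use le in \<open>auto intro!: order_trans[OF le abs_ge_self]\<close>)
  have "\<bar>nonlocal_op s v x\<bar> \<le> (LINT z::real^'n|lborel. c * (trunc_quad r z * frac_kernel s z))"
    unfolding nonlocal_op_def
    using * i le unfolding nonlocal_at_def
    by (intro integral_abs_bound_integral) auto
  then show "\<bar>nonlocal_op s v x\<bar> \<le> c * kernel_mass TYPE('n) s * r powr (- 2 * s)"
    using trunc_quad_kernel(2)[OF s r, where 'n='n] by simp
qed

lemma second_diff_trunc_quad:
  fixes v :: "real ^ 'n \<Rightarrow> real"
  assumes r: "0 < r" and B: "\<And>y. \<bar>v y\<bar> \<le> B"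
    and L: "\<And>z. norm z < r \<Longrightarrow> \<bar>second_diff v x z\<bar> \<le> L * (norm z)\<^sup>2" and "0 \<le> L"
  shows "\<bar>second_diff v x z\<bar> \<le> (4 * B + L * r\<^sup>2) * trunc_quad r z"
proof (cases "norm z < r")
  case True
  have "0 \<le> B" using B[of x] by linarith
  have eq: "trunc_quad r z = (norm z)\<^sup>2 / r\<^sup>2" using True r
    by (simp add: trunc_quad_def power_divide min_def abs_square_less_1 not_le power2_le_iff_abs_le)
  have "L * (norm z)\<^sup>2 = L * r\<^sup>2 * trunc_quad r z" unfolding eq using r by simp
  also have "\<dots> \<le> (4 * B + L * r\<^sup>2) * trunc_quad r z"
    using \<open>0 \<le> B\<close> by (intro mult_right_mono) auto
  finally show ?thesis using L[OF True] by linarith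
next
  case False
  then have "trunc_quad r z = 1" using r by (simp add: trunc_quad_eq_1)
  moreover have "\<bar>second_diff v x z\<bar> \<le> 4 * B"
    using B[of x] B[of "x + z"] B[of "x - z"] unfolding second_diff_def by linarith
  moreover have "0 \<le> L * r\<^sup>2" using \<open>0 \<le> L\<close> by simp
  ultimately show ?thesis by simp
qed

text \<open>A penalty: zero at the origin and at least one half outside the unit ball. Being rational in
\<open>norm x\<close>, it has second differences that can be written down exactly.\<close>

definition bump :: "real ^ 'n \<Rightarrow> real" where
  "bump x = (norm x)\<^sup>2 / (1 + (norm x)\<^sup>2)"

lemma bump_nonneg [simp]: "0 \<le> bump x" by (simp add: bump_def)
lemma bump_0 [simp]: "bump 0 = 0" by (simp add: bump_def)
lemma bump_le_1 [simp]: "bump x \<le> 1" by (simp add: bump_def add_pos_nonneg divide_le_eq)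
lemma bump_ge_half: "1 \<le> norm x \<Longrightarrow> 1 / 2 \<le> bump x"
  using power_mono[of 1 "norm x" 2] by (simp add: bump_def field_simps add_pos_nonneg)
lemma bump_continuous [continuous_intros]: "continuous_on A f \<Longrightarrow> continuous_on A (\<lambda>x. bump (f x))"
  unfolding bump_def by (intro continuous_intros) (simp_all, smt (verit) zero_le_power2)

lemma bump_measurable [measurable]: "bump \<in> borel_measurable borel"
  unfolding bump_def by measurable

text \<open>With \<open>a\<close>, \<open>b\<close>, \<open>q\<close> as in the proof, the second difference of \<open>1 / (1 + (norm x)\<^sup>2)\<close> is an explicit
fraction. Its numerator is controlled by the Cauchy-Schwarz inequality \<open>b\<^sup>2 \<le> 4 * (a - q) * q\<close> and its
denominator by \<open>a \<le> (a + b) * (a - b)\<close>.\<close>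

lemma second_diff_bump: "\<bar>second_diff bump x z\<bar> \<le> 10 * (norm z)\<^sup>2"
proof -
  define a where "a = 1 + (norm x)\<^sup>2 + (norm z)\<^sup>2"
  define b where "b = 2 * (x \<bullet> z)"
  define q where "q = (norm z)\<^sup>2"
  have p: "1 + (norm (x + z))\<^sup>2 = a + b" "1 + (norm (x - z))\<^sup>2 = a - b" "1 + (norm x)\<^sup>2 = a - q"
    by (simp_all add: a_def b_def q_def power2_norm_eq_inner inner_add inner_diff inner_commute)
  have q: "0 \<le> q" by (simp add: q_def)
  have aq: "1 \<le> a - q" unfolding p(3)[symmetric] by simp
  have ab: "1 \<le> a + b" "1 \<le> a - b" unfolding p(1,2)[symmetric] by simp_all
  have a1: "1 \<le> a" using aq q by linarith
  have prod: "a \<le> (a + b) * (a - b)"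
  proof (cases "0 \<le> b")
    case True then show ?thesis using mult_mono[of a "a+b" 1 "a-b"] ab a1 by simp
  next
    case False then show ?thesis using mult_mono[of 1 "a+b" a "a-b"] ab a1 by simp
  qed
  have b2: "b\<^sup>2 \<le> 4 * (a - q) * q"
  proof -
    have "(x \<bullet> z)\<^sup>2 \<le> (norm x)\<^sup>2 * (norm z)\<^sup>2"
      using Cauchy_Schwarz_ineq[of x z] by (simp add: power2_norm_eq_inner)
    also have "\<dots> \<le> (a - q) * q" unfolding p(3)[symmetric] q_def[symmetric] using q by (intro mult_right_mono) auto
    finally show ?thesis by (simp add: b_def power_mult_distrib algebra_simps)
  qed
  have one: "bump y = 1 - 1 / (1 + (norm y)\<^sup>2)" for y :: "real^'n"
    unfolding bump_def by (simp add: diff_divide_eq_iff add_pos_nonneg add_nonneg_eq_0_iff)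
  have "second_diff bump x z = 1 / (a + b) + 1 / (a - b) - 2 / (a - q)"
    unfolding second_diff_def one p by simp
  also have "\<dots> = 2 * (b\<^sup>2 - a * q) / ((a + b) * (a - b) * (a - q))"
    using ab aq by (simp add: divide_simps) (simp add: power2_eq_square algebra_simps)
  finally have eq: "second_diff bump x z = 2 * (b\<^sup>2 - a * q) / ((a + b) * (a - b) * (a - q))" .
  have D: "a * (a - q) \<le> (a + b) * (a - b) * (a - q)" using prod aq by (intro mult_right_mono) auto
  have Dpos: "0 < (a + b) * (a - b) * (a - q)" using ab aq by (intro mult_pos_pos) auto
  have "\<bar>b\<^sup>2 - a * q\<bar> \<le> 4 * (a - q) * q + a * q"
    using b2 a1 q aq by (smt (verit) mult_nonneg_nonneg zero_le_power2)
  also have "\<dots> \<le> 4 * (a * (a - q)) * q + (a * (a - q)) * q"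
  proof -
    have "a - q \<le> a * (a - q)" using a1 aq by (simp add: mult_le_cancel_right1)
    moreover have "a \<le> a * (a - q)" using a1 aq by (simp add: mult_le_cancel_left1)
    ultimately show ?thesis using q by (intro add_mono mult_right_mono) auto
  qed
  also have "\<dots> = 5 * q * (a * (a - q))" by simp
  also have "\<dots> \<le> 5 * (q * ((a + b) * (a - b) * (a - q)))" using D q by (simp add: mult_left_mono)
  finally have le: "\<bar>b\<^sup>2 - a * q\<bar> \<le> 5 * (q * ((a + b) * (a - b) * (a - q)))" .
  have "2 * \<bar>b\<^sup>2 - a * q\<bar> \<le> 10 * q * ((a + b) * (a - b) * (a - q))"
    using mult_left_mono[OF le, of 2] by simp
  then show ?thesis unfolding eq q_def[symmetric] using Dpos
    by (simp only: abs_divide abs_of_pos[OF Dpos] pos_divide_le_eq[OF Dpos] abs_mult[of 2] abs_numeral)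
qed

definition scaled_bump :: "real \<Rightarrow> real ^ 'n \<Rightarrow> real ^ 'n \<Rightarrow> real" where
  "scaled_bump r a x = bump ((1 / r) *\<^sub>R (x - a))"

lemma second_diff_scaled_bump:
  assumes "0 < r"
  shows "\<bar>second_diff (scaled_bump r a) x z\<bar> \<le> 10 * trunc_quad r z"
proof -
  have eq: "second_diff (scaled_bump r a) x z = second_diff bump ((1 / r) *\<^sub>R (x - a)) ((1 / r) *\<^sub>R z)"
    unfolding second_diff_def scaled_bump_def
    by (simp add: scaleR_add_right[symmetric] scaleR_diff_right[symmetric] add_diff_eq diff_diff_eq
        add_diff_add diff_add_eq add.commute)
  have 1: "\<bar>second_diff (scaled_bump r a) x z\<bar> \<le> 10 * (norm z / r)\<^sup>2"
    unfolding eq using second_diff_bump[of "(1 / r) *\<^sub>R (x - a)" "(1 / r) *\<^sub>R z"] assms by simp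
  have 2: "\<bar>second_diff (scaled_bump r a) x z\<bar> \<le> 10"
    using bump_nonneg[of "(1 / r) *\<^sub>R (x - a)"] bump_nonneg[of "(1 / r) *\<^sub>R (x + z - a)"]
      bump_nonneg[of "(1 / r) *\<^sub>R (x - z - a)"] bump_le_1[of "(1 / r) *\<^sub>R (x - a)"]
      bump_le_1[of "(1 / r) *\<^sub>R (x + z - a)"] bump_le_1[of "(1 / r) *\<^sub>R (x - z - a)"]
    unfolding second_diff_def scaled_bump_def by linarith
  show ?thesis using 1 2 by (simp add: trunc_quad_def)
qed

lemma scaled_bump_simps [simp]:
  "0 \<le> scaled_bump r a x" "scaled_bump r a x \<le> 1" "scaled_bump r a a = 0"
  by (simp_all add: scaled_bump_def)

lemma scaled_bump_ge_half: "0 < r \<Longrightarrow> r \<le> dist x a \<Longrightarrow> 1 / 2 \<le> scaled_bump r a x"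
  unfolding scaled_bump_def by (intro bump_ge_half) (simp add: dist_norm)

lemma scaled_bump_continuous [continuous_intros]:
  "continuous_on A f \<Longrightarrow> continuous_on A (\<lambda>x. scaled_bump r a (f x))"
  unfolding scaled_bump_def by (intro continuous_intros)

lemma scaled_bump_measurable [measurable]: "scaled_bump r a \<in> borel_measurable borel"
  unfolding scaled_bump_def by measurable

text \<open>The price of localising a minimum to a ball of radius \<open>r\<close>.\<close>

lemma nonlocal_scaled_bump:
  fixes a :: "real ^ 'n"
  assumes "0 < s" "s < 1" "0 < r"
  shows "nonlocal_at s (scaled_bump r a) x"
    and "\<bar>nonlocal_op s (scaled_bump r a) x\<bar> \<le> 10 * kernel_mass TYPE('n) s * r powr (- 2 * s)"
  using nonlocal_trunc_quad_bound[OF assms, of "scaled_bump r a" x 10] second_diff_scaled_bump[OF assms(3), of a x]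
  by auto

section \<open>The fractional Laplacian as an integral of second differences\<close>

lemma frac_laplacian_const_pos:
  assumes "0 < s" "s < 1"
  shows "0 < frac_laplacian_const n s"
proof -
  have "- s \<notin> \<int>\<^sub>\<le>\<^sub>0"
  proof
    assume "- s \<in> \<int>\<^sub>\<le>\<^sub>0"
    then obtain n where n: "- s = real_of_int n" by (auto elim!: nonpos_Ints_cases)
    then have "real_of_int (- 1) < real_of_int n" "real_of_int n < real_of_int 0" using assms by auto
    then show False unfolding of_int_less_iff by simp
  qed
  then have "Gamma (- s) \<noteq> 0" by (simp add: Gamma_eq_zero_iff)
  moreover have "0 < Gamma (real n / 2 + s)" using assms by (intro Gamma_real_pos) auto
  ultimately show ?thesis by (simp add: frac_laplacian_const_def)
qed

text \<open>The second difference is the increment over \<open>[0, 1]\<close> of \<open>\<tau> \<mapsto> v (x + \<tau> z) + v (x - \<tau> z)\<close>, up to sign,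
and the derivative of this function is \<open>z\<close> times a difference of gradients.\<close>

lemma C11_loc_regularity:
  assumes "v \<in> C11_loc"
  shows C11_loc_continuous: "continuous_on UNIV v"
    and C11_loc_second_diff:
      "\<exists>L\<ge>0. \<forall>x z. norm x \<le> R \<longrightarrow> norm z \<le> 1 \<longrightarrow> \<bar>second_diff v x z\<bar> \<le> L * (norm z)\<^sup>2"
proof -
  obtain g where g: "\<And>x. GDERIV v x :> g x" and L: "\<And>K. compact K \<Longrightarrow> \<exists>L. L-lipschitz_on K g"
    using assms unfolding C11_loc_def by blast
  have d: "(v has_derivative (\<lambda>h. h \<bullet> g x)) (at x within S)" for x S
    using g[of x] unfolding gderiv_def by (rule has_derivative_at_withinI)
  show "continuous_on UNIV v"
    using d by (meson continuous_on_eq_continuous_within has_derivative_continuous)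
  obtain L where L: "L-lipschitz_on (cball 0 (R + 1)) g" using L[OF compact_cball] by blast
  have "\<bar>second_diff v x z\<bar> \<le> (2 * L) * (norm z)\<^sup>2" if x: "norm x \<le> R" and z: "norm z \<le> 1" for x z
  proof -
    define f where "f = (\<lambda>\<tau>. v (x + \<tau> *\<^sub>R z) + v (x - \<tau> *\<^sub>R z))"
    have D: "(f has_real_derivative (z \<bullet> g (x + \<tau> *\<^sub>R z) - z \<bullet> g (x - \<tau> *\<^sub>R z))) (at \<tau>)" for \<tau>
    proof -
      have 1: "((\<lambda>\<tau>. v (x + \<tau> *\<^sub>R z)) has_derivative (\<lambda>h. (h *\<^sub>R z) \<bullet> g (x + \<tau> *\<^sub>R z))) (at \<tau>)"
        by (rule has_derivative_compose[OF _ d, of "\<lambda>\<tau>. x + \<tau> *\<^sub>R z"]) (auto intro!: derivative_eq_intros)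
      have 2: "((\<lambda>\<tau>. v (x - \<tau> *\<^sub>R z)) has_derivative (\<lambda>h. (- (h *\<^sub>R z)) \<bullet> g (x - \<tau> *\<^sub>R z))) (at \<tau>)"
        by (rule has_derivative_compose[OF _ d, of "\<lambda>\<tau>. x - \<tau> *\<^sub>R z"]) (auto intro!: derivative_eq_intros)
      show ?thesis unfolding f_def has_field_derivative_def
        by (rule has_derivative_eq_rhs[OF has_derivative_add[OF 1 2]]) (auto simp: fun_eq_iff algebra_simps)
    qed
    obtain \<xi> where \<xi>: "0 < \<xi>" "\<xi> < 1" and eq: "f 1 - f 0 = (1 - 0) * (z \<bullet> g (x + \<xi> *\<^sub>R z) - z \<bullet> g (x - \<xi> *\<^sub>R z))"
      using MVT2[of 0 1 f "\<lambda>\<tau>. z \<bullet> g (x + \<tau> *\<^sub>R z) - z \<bullet> g (x - \<tau> *\<^sub>R z)"] D by auto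
    have in_ball: "x + \<tau> *\<^sub>R z \<in> cball 0 (R + 1)" if "\<bar>\<tau>\<bar> \<le> 1" for \<tau>
    proof -
      have "norm (\<tau> *\<^sub>R z) \<le> 1 * 1" unfolding norm_scaleR using that z by (intro mult_mono) auto
      then show ?thesis using x norm_triangle_ineq[of x "\<tau> *\<^sub>R z"] by simp
    qed
    have "x + \<xi> *\<^sub>R z \<in> cball 0 (R + 1)" "x - \<xi> *\<^sub>R z \<in> cball 0 (R + 1)"
      using in_ball[of \<xi>] in_ball[of "- \<xi>"] \<xi> by auto
    then have "dist (g (x + \<xi> *\<^sub>R z)) (g (x - \<xi> *\<^sub>R z)) \<le> L * dist (x + \<xi> *\<^sub>R z) (x - \<xi> *\<^sub>R z)"
      using L by (simp add: lipschitz_on_def)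
    also have "dist (x + \<xi> *\<^sub>R z) (x - \<xi> *\<^sub>R z) = norm ((2 * \<xi>) *\<^sub>R z)"
      by (simp add: dist_norm scaleR_2 scaleR_scaleR[symmetric] del: scaleR_scaleR)
    also have "\<dots> \<le> 2 * norm z" using \<xi> by (simp add: mult_right_le_one_le mult_left_le_one_le)
    finally have gl: "norm (g (x + \<xi> *\<^sub>R z) - g (x - \<xi> *\<^sub>R z)) \<le> L * (2 * norm z)"
      using L by (simp add: dist_norm lipschitz_on_def mult_left_mono)
    have "\<bar>second_diff v x z\<bar> = \<bar>f 1 - f 0\<bar>" by (simp add: second_diff_def f_def)
    also have "\<dots> = \<bar>z \<bullet> (g (x + \<xi> *\<^sub>R z) - g (x - \<xi> *\<^sub>R z))\<bar>" by (simp add: eq inner_diff)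
    also have "\<dots> \<le> norm z * norm (g (x + \<xi> *\<^sub>R z) - g (x - \<xi> *\<^sub>R z))" by (rule Cauchy_Schwarz_ineq2)
    also have "\<dots> \<le> norm z * (L * (2 * norm z))" by (intro mult_left_mono gl) auto
    finally show ?thesis by (simp add: power2_eq_square algebra_simps)
  qed
  moreover have "0 \<le> 2 * L" using L by (simp add: lipschitz_on_def)
  ultimately show "\<exists>L\<ge>0. \<forall>x z. norm x \<le> R \<longrightarrow> norm z \<le> 1 \<longrightarrow> \<bar>second_diff v x z\<bar> \<le> L * (norm z)\<^sup>2"
    by blast
qed

lemma integrable_kernel_outside_ball:
  assumes s: "0 < s" "s < 1" and "0 < r"
  shows "integrable lborel (\<lambda>z::real^'n. indicator (- ball 0 r) z * frac_kernel s z)"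
proof (rule Bochner_Integration.integrable_bound[OF trunc_quad_kernel(1)[OF s \<open>0 < r\<close>]])
  show "AE z in lborel. norm (indicator (- ball 0 r) z * frac_kernel s z) \<le> norm (trunc_quad r z * frac_kernel s (z::real^'n))"
    using \<open>0 < r\<close> by (auto simp: indicator_def trunc_quad_eq_1)
qed measurable

lemma integrable_bounded_times_kernel:
  fixes w :: "real ^ 'n \<Rightarrow> real"
  assumes s: "0 < s" "s < 1" and "0 < r" and [measurable]: "w \<in> borel_measurable borel" and B: "\<And>z. \<bar>w z\<bar> \<le> B"
  shows "integrable lborel (\<lambda>z. w z * (indicator (- ball 0 r) z * frac_kernel s z))"
proof (rule Bochner_Integration.integrable_bound)
  show "integrable lborel (\<lambda>z::real^'n. B * (indicator (- ball 0 r) z * frac_kernel s z))"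
    by (intro integrable_mult_right integrable_kernel_outside_ball s \<open>0 < r\<close>)
  show "AE z in lborel. norm (w z * (indicator (- ball 0 r) z * frac_kernel s z)) \<le> norm (B * (indicator (- ball 0 r) z * frac_kernel s z))"
    using B by (intro AE_I2) (auto simp: abs_mult intro!: mult_right_mono order_trans[OF B abs_ge_self])
qed measurable

lemma dominated_convergence_within:
  fixes f :: "'b::first_countable_topology \<Rightarrow> 'a \<Rightarrow> real"
  assumes "\<And>t. t \<in> S \<Longrightarrow> f t \<in> borel_measurable M" "g \<in> borel_measurable M"
    and w: "integrable M w"
    and b: "\<And>t y. t \<in> S \<Longrightarrow> y \<in> space M \<Longrightarrow> \<bar>f t y\<bar> \<le> w y"
    and l: "\<And>y. y \<in> space M \<Longrightarrow> ((\<lambda>t. f t y) \<longlongrightarrow> g y) (at a within S)"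
  shows "((\<lambda>t. integral\<^sup>L M (f t)) \<longlongrightarrow> integral\<^sup>L M g) (at a within S)"
  unfolding tendsto_at_iff_sequentially comp_def
proof (intro allI impI)
  fix X assume X: "\<forall>i. X i \<in> S - {a}" "X \<longlonglongrightarrow> a"
  show "(\<lambda>i. integral\<^sup>L M (f (X i))) \<longlonglongrightarrow> integral\<^sup>L M g"
  proof (rule integral_dominated_convergence[where w = w])
    show "AE y in M. (\<lambda>i. f (X i) y) \<longlonglongrightarrow> g y"
      using l X unfolding tendsto_at_iff_sequentially comp_def by auto
  qed (use assms X in auto)
qed

text \<open>The truncated integral equals half the integral of second differences over the same symmetric
region, because it is invariant under \<open>z \<mapsto> - z\<close>; dominated convergence removes the truncation.\<close>

lemma frac_laplacian_eq_nonlocal_op: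
  fixes v :: "real ^ 'n \<Rightarrow> real"
  assumes s: "0 < s" "s < 1" and [measurable]: "v \<in> borel_measurable borel" and B: "\<And>y. \<bar>v y\<bar> \<le> B"
    and at: "nonlocal_at s v x"
  shows "frac_laplacian s v x = frac_laplacian_const CARD('n) s / 2 * nonlocal_op s v x"
proof -
  let ?K = "frac_kernel s :: real^'n \<Rightarrow> real"
  let ?I = "\<lambda>\<epsilon>. LINT y:(UNIV - ball x \<epsilon>)|lebesgue. (v x - v y) / norm (x - y) powr (real CARD('n) + 2 * s)"
  have trunc: "?I \<epsilon> = (LINT z|lborel. indicator (- ball 0 \<epsilon>) z * (second_diff v x z * ?K z)) / 2" if "0 < \<epsilon>" for \<epsilon>
  proof -
    define w where "w = (\<lambda>z. (v x - v (x + z)) * (indicator (- ball 0 \<epsilon>) z * ?K z))"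
    have [measurable]: "w \<in> borel_measurable borel" unfolding w_def by measurable
    have bd: "\<bar>v x - v (x + z)\<bar> \<le> 2 * B" for z using B[of x] B[of "x + z"] by linarith
    have iw: "integrable lborel w" unfolding w_def
      by (rule integrable_bounded_times_kernel[OF s that _ bd]) measurable
    have iw': "integrable lborel (\<lambda>z. w (- z))" using iw lborel_integral_uminus(2)[of w] by simp
    have m: "(\<lambda>y. indicator (UNIV - ball x \<epsilon>) y * ((v x - v y) / norm (x - y) powr (real CARD('n) + 2 * s)))
        \<in> borel_measurable borel"
      by (intro borel_measurable_times borel_measurable_indicator borel_measurable_divide
          borel_measurable_diff borel_measurable_const assms) measurable
    have "?I \<epsilon> = (LINT y|lborel. indicator (UNIV - ball x \<epsilon>) y * ((v x - v y) / norm (x - y) powr (real CARD('n) + 2 * s)))"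
      unfolding set_lebesgue_integral_def
      unfolding real_scaleR_def by (rule integral_completion) (use m in simp)
    also have "\<dots> = (LINT z|lborel. indicator (UNIV - ball x \<epsilon>) (x + z) * ((v x - v (x + z)) / norm (x - (x + z)) powr (real CARD('n) + 2 * s)))"
      by (rule lborel_integral_translation(1)[OF m, symmetric])
    also have "\<dots> = integral\<^sup>L lborel w"
      by (rule Bochner_Integration.integral_cong) (auto simp: w_def frac_kernel_def indicator_def dist_norm)
    finally have 1: "?I \<epsilon> = integral\<^sup>L lborel w" .
    have "integral\<^sup>L lborel w + integral\<^sup>L lborel w = integral\<^sup>L lborel w + (LINT z|lborel. w (- z))"
      using lborel_integral_uminus(1)[of w] by simp
    also have "\<dots> = (LINT z|lborel. w z + w (- z))" using iw iw' by simp
    also have "\<dots> = (LINT z|lborel. indicator (- ball 0 \<epsilon>) z * (second_diff v x z * ?K z))"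
      by (rule Bochner_Integration.integral_cong) (auto simp: w_def second_diff_def indicator_def algebra_simps)
    finally show ?thesis unfolding 1 by simp
  qed
  have lim: "((\<lambda>\<epsilon>. LINT z|lborel. indicator (- ball 0 \<epsilon>) z * (second_diff v x z * ?K z)) \<longlongrightarrow> nonlocal_op s v x) (at_right 0)"
    unfolding nonlocal_op_def
  proof (rule dominated_convergence_within)
    show "integrable lborel (\<lambda>z. \<bar>second_diff v x z * ?K z\<bar>)"
      using at unfolding nonlocal_at_def by (rule integrable_abs)
    show "((\<lambda>\<epsilon>. indicator (- ball 0 \<epsilon>) z * (second_diff v x z * ?K z)) \<longlongrightarrow> second_diff v x z * ?K z) (at_right 0)" for z
    proof (cases "z = 0")
      case True then show ?thesis by (simp add: second_diff_def)
    next
      case False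
      have "\<forall>\<^sub>F \<epsilon> in at_right 0. \<epsilon> < norm z"
        using False by (intro eventually_at_right_less[THEN eventually_mono] order_tendstoD(2)[OF tendsto_ident_at]) auto
      then have "\<forall>\<^sub>F \<epsilon> in at_right 0. second_diff v x z * ?K z = indicator (- ball 0 \<epsilon>) z * (second_diff v x z * ?K z)"
        by eventually_elim (auto simp: indicator_def)
      then show ?thesis by (rule Lim_transform_eventually[OF tendsto_const])
    qed
  qed (auto simp: indicator_def)
  have "(?I \<longlongrightarrow> nonlocal_op s v x / 2) (at_right 0)"
    by (rule Lim_transform_eventually[OF tendsto_divide[OF lim tendsto_const]])
       (auto simp: eventually_at_right_field trunc intro!: exI[of _ 1])
  then have "Lim (at_right 0) ?I = nonlocal_op s v x / 2" by (intro tendsto_Lim) auto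
  then show ?thesis by (simp add: frac_laplacian_def)
qed

section \<open>Mollification in space\<close>

text \<open>Compact support matters, since rates of change will be controlled on a fixed ball only. The
square of a positive part is \<open>C^{1,1}\<close>, just enough for quadratic bounds on second differences.\<close>

definition mollifier_profile :: "real ^ 'n \<Rightarrow> real" where
  "mollifier_profile y = (max 0 (1 - (norm y)\<^sup>2))\<^sup>2"

definition mollifier :: "real ^ 'n \<Rightarrow> real" where
  "mollifier y = mollifier_profile y / integral\<^sup>L lborel (mollifier_profile :: real ^ 'n \<Rightarrow> real)"

lemma mollifier_profile_bounds: "0 \<le> mollifier_profile y" "mollifier_profile y \<le> indicator (cball 0 1) y"
proof -
  show "0 \<le> mollifier_profile y" by (simp add: mollifier_profile_def)
  show "mollifier_profile y \<le> indicator (cball 0 1) y"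
  proof (cases "norm y \<le> 1")
    case True
    have "max 0 (1 - (norm y)\<^sup>2) \<le> 1" by simp
    then have "(max 0 (1 - (norm y)\<^sup>2))\<^sup>2 \<le> 1" by (intro power_le_one) auto
    then show ?thesis using True by (simp add: mollifier_profile_def)
  next
    case False
    then have "1 \<le> (norm y)\<^sup>2" by (intro one_le_power) auto
    then have "max 0 (1 - (norm y)\<^sup>2) = 0" by (intro max_absorb1) simp
    then show ?thesis using False by (simp add: mollifier_profile_def)
  qed
qed

lemma mollifier_profile_measurable [measurable]: "mollifier_profile \<in> borel_measurable borel"
  unfolding mollifier_profile_def by measurable

lemma mollifier_profile_eq_0: "1 \<le> norm y \<Longrightarrow> mollifier_profile y = 0"
  using mollifier_profile_bounds[of y] one_le_power[of "norm y" 2] by (simp add: mollifier_profile_def)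

lemma integrable_indicator_cball: "integrable lborel (indicator (cball (a::real^'n) r) :: _ \<Rightarrow> real)"
  using emeasure_bounded_finite[of "cball a r"] by (intro integrable_real_indicator) auto

lemma mollifier_profile_integrable: "integrable lborel (mollifier_profile :: real^'n \<Rightarrow> real)"
  by (rule Bochner_Integration.integrable_bound[OF integrable_indicator_cball[of 0 1]])
     (auto simp: mollifier_profile_bounds)

lemma mollifier_profile_integral_pos: "0 < integral\<^sup>L lborel (mollifier_profile :: real^'n \<Rightarrow> real)"
proof -
  have le: "1 / 2 * indicator (cball 0 (1 / 2)) y \<le> mollifier_profile y" for y :: "real^'n"
  proof (cases "norm y \<le> 1 / 2")
    case True
    then have "(norm y)\<^sup>2 \<le> (1 / 2)\<^sup>2" by (intro power_mono) auto
    then have h: "3 / 4 \<le> max 0 (1 - (norm y)\<^sup>2)" unfolding le_max_iff_disj by (simp add: power2_eq_square)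
    have "(3 / 4)\<^sup>2 \<le> mollifier_profile y"
      unfolding mollifier_profile_def by (rule power_mono[OF h]) simp
    moreover have "1 / 2 \<le> (3 / 4 :: real)\<^sup>2" by (simp add: power2_eq_square)
    ultimately have "1 / 2 \<le> mollifier_profile y" by linarith
    then show ?thesis using True by simp
  qed (simp add: mollifier_profile_bounds)
  have "0 < 1 / 2 * measure lborel (cball (0::real^'n) (1 / 2))"
    by (simp add: content_cball_pos)
  also have "\<dots> = (LINT y|lborel. 1 / 2 * indicator (cball (0::real^'n) (1 / 2)) y)" by simp
  also have "\<dots> \<le> integral\<^sup>L lborel (mollifier_profile :: real^'n \<Rightarrow> real)"
    by (intro integral_mono le mollifier_profile_integrable integrable_mult_right integrable_indicator_cball)
  finally show ?thesis .
qed

lemma mollifier_measurable [measurable]: "mollifier \<in> borel_measurable borel"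
  unfolding mollifier_def by measurable

lemma mollifier_nonneg [simp]: "0 \<le> mollifier (y :: real^'n)"
  using mollifier_profile_integral_pos[where 'n='n] by (simp add: mollifier_def mollifier_profile_bounds)

lemma mollifier_eq_0: "1 \<le> norm y \<Longrightarrow> mollifier y = 0"
  by (simp add: mollifier_def mollifier_profile_eq_0)

lemma mollifier_integrable: "integrable lborel (mollifier :: real^'n \<Rightarrow> real)"
  unfolding mollifier_def by (intro integrable_divide mollifier_profile_integrable)

lemma mollifier_integral [simp]: "integral\<^sup>L lborel (mollifier :: real^'n \<Rightarrow> real) = 1"
  unfolding mollifier_def using mollifier_profile_integral_pos[where 'n='n] by simp

text \<open>Write the profile as \<open>q (1 - (norm y)\<^sup>2)\<close> with \<open>q \<sigma> = (max 0 \<sigma>)\<^sup>2\<close>. The function \<open>q\<close> is Lipschitz on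
\<open>{..1}\<close> and differs from its tangents by at most the square of the distance.\<close>

lemma mollifier_profile_diff:
  fixes y z :: "real^'n"
  assumes z: "norm z \<le> 1"
  shows "\<bar>mollifier_profile (y + z) - mollifier_profile y\<bar> \<le> 10 * norm z * indicator (cball 0 2) y"
    and "\<bar>second_diff mollifier_profile y z\<bar> \<le> 54 * (norm z)\<^sup>2 * indicator (cball 0 2) y"
proof -
  define q where "q = (\<lambda>\<sigma>::real. (max 0 \<sigma>)\<^sup>2)"
  define a where "a = 1 - (norm y)\<^sup>2"
  define b where "b = (\<lambda>w. 1 - (norm (y + w))\<^sup>2)"
  have prof: "mollifier_profile y = q a" "mollifier_profile (y + w) = q (b w)" for w
    by (simp_all add: mollifier_profile_def q_def a_def b_def)
  have far: "mollifier_profile y = 0" "mollifier_profile (y + z) = 0" "mollifier_profile (y - z) = 0"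
    if "\<not> norm y \<le> 2"
    using that z norm_triangle_ineq2[of y "- z"] norm_triangle_ineq2[of y z]
    by (auto intro!: mollifier_profile_eq_0)
  have a1: "a \<le> 1" and b1: "b w \<le> 1" for w by (simp_all add: a_def b_def)
  have ba: "b w - a = - 2 * (y \<bullet> w) - (norm w)\<^sup>2" for w
    by (simp add: a_def b_def power2_norm_eq_inner inner_add inner_commute)
  have dist: "\<bar>b w - a\<bar> \<le> 5 * norm z" if "norm y \<le> 2" "norm w = norm z" for w
  proof -
    have "\<bar>y \<bullet> w\<bar> \<le> 2 * norm z"
      using Cauchy_Schwarz_ineq2[of y w] mult_right_mono[OF that(1), of "norm w"] that(2) by simp
    moreover have "(norm w)\<^sup>2 \<le> norm z"
      using z that(2) mult_left_le[of "norm z" "norm z"] by (simp add: power2_eq_square)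
    moreover have "0 \<le> (norm w)\<^sup>2" by simp
    ultimately show ?thesis unfolding ba by linarith
  qed
  have q1: "\<bar>q t - q r\<bar> \<le> 2 * \<bar>t - r\<bar>" if "t \<le> 1" "r \<le> 1" for t r
  proof -
    have "q t - q r = (max 0 t - max 0 r) * (max 0 t + max 0 r)"
      by (simp add: q_def power2_eq_square algebra_simps)
    then have "\<bar>q t - q r\<bar> = \<bar>max 0 t - max 0 r\<bar> * (max 0 t + max 0 r)" by (simp add: abs_mult)
    also have "\<dots> \<le> \<bar>t - r\<bar> * 2" using that by (intro mult_mono) auto
    finally show ?thesis by simp
  qed
  have q2: "\<bar>q t - q r - 2 * max 0 r * (t - r)\<bar> \<le> (t - r)\<^sup>2" for t r
  proof -
    consider "0 \<le> t" "0 \<le> r" | "t < 0" "0 \<le> r" | "0 \<le> t" "r < 0" | "t < 0" "r < 0" by linarith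
    then show ?thesis
    proof cases
      case 1
      have "q t - q r - 2 * max 0 r * (t - r) = (t - r)\<^sup>2"
        using 1 by (simp add: q_def power2_eq_square algebra_simps)
      then show ?thesis by simp
    next
      case 2
      have "q t - q r - 2 * max 0 r * (t - r) = r\<^sup>2 - 2 * (r * t)"
        using 2 by (simp add: q_def power2_eq_square algebra_simps)
      moreover have "r * t \<le> 0" using 2 by (simp add: mult_nonneg_nonpos)
      moreover have "(t - r)\<^sup>2 = t\<^sup>2 + r\<^sup>2 - 2 * (r * t)" by (simp add: power2_diff)
      moreover have "0 \<le> t\<^sup>2" "0 \<le> r\<^sup>2" by auto
      ultimately show ?thesis by linarith
    next
      case 3
      have "q t - q r - 2 * max 0 r * (t - r) = t\<^sup>2" using 3 by (simp add: q_def)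
      moreover have "\<bar>t\<bar> \<le> \<bar>t - r\<bar>" using 3 by linarith
      ultimately show ?thesis by (simp add: abs_le_square_iff)
    next
      case 4 then show ?thesis by (simp add: q_def)
    qed
  qed
  show "\<bar>mollifier_profile (y + z) - mollifier_profile y\<bar> \<le> 10 * norm z * indicator (cball 0 2) y"
  proof (cases "norm y \<le> 2")
    case True
    then show ?thesis using q1[OF b1[of z] a1] dist[of z] unfolding prof by simp
  qed (use far in simp)
  show "\<bar>second_diff mollifier_profile y z\<bar> \<le> 54 * (norm z)\<^sup>2 * indicator (cball 0 2) y"
  proof (cases "norm y \<le> 2")
    case True
    have e: "(b w - a)\<^sup>2 \<le> 25 * (norm z)\<^sup>2" if "norm w = norm z" for w
      using dist[OF True that] abs_le_square_iff[of "b w - a" "5 * norm z"] by (simp add: power_mult_distrib)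
    have sum: "(b z - a) + (b (- z) - a) = - 2 * (norm z)\<^sup>2" unfolding ba by simp
    have sd: "second_diff mollifier_profile y z = 2 * q a - q (b z) - q (b (- z))"
      using prof(2)[of "- z"] by (simp add: second_diff_def prof)
    define X P Q where "X = max 0 a * (norm z)\<^sup>2" and "P = 2 * max 0 a * (b z - a)"
      and "Q = 2 * max 0 a * (b (- z) - a)"
    have "P + Q = - 4 * X"
      using arg_cong[OF sum, of "\<lambda>t. 2 * max 0 a * t"] by (simp add: X_def P_def Q_def algebra_simps)
    moreover have "0 \<le> X" "X \<le> 1 * (norm z)\<^sup>2"
      unfolding X_def using a1 by (simp, intro mult_right_mono) auto
    moreover note q2[of "b z" a, folded P_def] q2[of "b (- z)" a, folded Q_def] e[of z] e[of "- z"]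
    ultimately have "\<bar>second_diff mollifier_profile y z\<bar> \<le> 54 * (norm z)\<^sup>2"
      unfolding sd by simp
    then show ?thesis using True by simp
  qed (use far in \<open>simp add: second_diff_def\<close>)
qed

definition moll_avg :: "real \<Rightarrow> (real ^ 'n \<Rightarrow> real) \<Rightarrow> real ^ 'n \<Rightarrow> real" where
  "moll_avg \<epsilon> v x = (LINT y|lborel. mollifier y * v (x - \<epsilon> *\<^sub>R y))"

lemma moll_avg_integrable:
  fixes v :: "real^'n \<Rightarrow> real"
  assumes [measurable]: "v \<in> borel_measurable borel" and B: "\<And>y. norm y \<le> 1 \<Longrightarrow> \<bar>v (x - \<epsilon> *\<^sub>R y)\<bar> \<le> B"
  shows "integrable lborel (\<lambda>y. mollifier y * v (x - \<epsilon> *\<^sub>R y))"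
    and "\<bar>moll_avg \<epsilon> v x\<bar> \<le> B"
proof -
  have i: "integrable lborel (\<lambda>y::real^'n. mollifier y * B)" by (intro integrable_mult_left mollifier_integrable)
  have le: "\<bar>mollifier y * v (x - \<epsilon> *\<^sub>R y)\<bar> \<le> mollifier y * B" for y
    using B[of y] mollifier_eq_0[of y] by (cases "norm y \<le> 1") (auto simp: abs_mult mult_left_mono)
  show 1: "integrable lborel (\<lambda>y. mollifier y * v (x - \<epsilon> *\<^sub>R y))"
    by (rule Bochner_Integration.integrable_bound[OF i]) (use le in \<open>auto intro!: order_trans[OF le abs_ge_self]\<close>)
  have "\<bar>moll_avg \<epsilon> v x\<bar> \<le> (LINT y::real^'n|lborel. mollifier y * B)"
    unfolding moll_avg_def using 1 i le by (intro integral_abs_bound_integral) auto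
  then show "\<bar>moll_avg \<epsilon> v x\<bar> \<le> B" by simp
qed

lemma moll_avg_shift:
  fixes v :: "real^'n \<Rightarrow> real"
  assumes [measurable]: "v \<in> borel_measurable borel" and B: "\<And>y. \<bar>v y\<bar> \<le> B" and "0 < \<epsilon>"
  shows "moll_avg \<epsilon> v (x + z) = (LINT y|lborel. mollifier (y + (1 / \<epsilon>) *\<^sub>R z) * v (x - \<epsilon> *\<^sub>R y))"
    and "integrable lborel (\<lambda>y. mollifier (y + (1 / \<epsilon>) *\<^sub>R z) * v (x - \<epsilon> *\<^sub>R y))"
proof -
  let ?f = "\<lambda>y. mollifier y * v (x + z - \<epsilon> *\<^sub>R y)"
  have m: "?f \<in> borel_measurable borel" by measurable
  have eq: "?f ((1 / \<epsilon>) *\<^sub>R z + y) = mollifier (y + (1 / \<epsilon>) *\<^sub>R z) * v (x - \<epsilon> *\<^sub>R y)" for y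
    using \<open>0 < \<epsilon>\<close> by (simp add: scaleR_add_right add.commute)
  show "moll_avg \<epsilon> v (x + z) = (LINT y|lborel. mollifier (y + (1 / \<epsilon>) *\<^sub>R z) * v (x - \<epsilon> *\<^sub>R y))"
    unfolding moll_avg_def eq[symmetric] by (rule lborel_integral_translation(1)[OF m, symmetric])
  show "integrable lborel (\<lambda>y. mollifier (y + (1 / \<epsilon>) *\<^sub>R z) * v (x - \<epsilon> *\<^sub>R y))"
    unfolding eq[symmetric] lborel_integral_translation(2)[OF m]
    by (rule moll_avg_integrable(1)) (use B in auto)
qed

text \<open>A bound for the \<open>L\<^sup>1\<close> norms of first and second differences of the mollifier.\<close>

definition moll_const :: "'n::finite itself \<Rightarrow> real" where
  "moll_const _ = 54 * measure lborel (cball (0::real^'n) 2) / integral\<^sup>L lborel (mollifier_profile :: real^'n \<Rightarrow> real)"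

lemma moll_const_nonneg: "0 \<le> moll_const TYPE('n::finite)"
  unfolding moll_const_def using mollifier_profile_integral_pos[where 'n='n] by simp

text \<open>All differences fall on the mollifier, so the bounds see only the supremum of \<open>v\<close>. For a
function that also depends on time they are therefore uniform in time, whatever its own spatial
regularity.\<close>

lemma moll_avg_regular:
  fixes v :: "real^'n \<Rightarrow> real"
  assumes [measurable]: "v \<in> borel_measurable borel" and B: "\<And>y. \<bar>v y\<bar> \<le> B" and "0 < \<epsilon>" and z: "norm z \<le> \<epsilon>"
  shows "\<bar>moll_avg \<epsilon> v (x + z) - moll_avg \<epsilon> v x\<bar> \<le> moll_const TYPE('n) * B / \<epsilon> * norm z"
    and "\<bar>second_diff (moll_avg \<epsilon> v) x z\<bar> \<le> moll_const TYPE('n) * B / \<epsilon>\<^sup>2 * (norm z)\<^sup>2"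
proof -
  let ?w = "(1 / \<epsilon>) *\<^sub>R z"
  let ?m = "integral\<^sup>L lborel (mollifier_profile :: real^'n \<Rightarrow> real)"
  note m = mollifier_profile_integral_pos[where 'n='n]
  have w: "norm ?w \<le> 1" "norm ?w = norm z / \<epsilon>" using z \<open>0 < \<epsilon>\<close> by auto
  have B0: "0 \<le> B" using B[of 0] by linarith
  note sh = moll_avg_shift[OF assms(1) B \<open>0 < \<epsilon>\<close>, where x = x]
  have i0: "integrable lborel (\<lambda>y. mollifier y * v (x - \<epsilon> *\<^sub>R y))" using sh(2)[where z = 0] by simp
  have bound: "\<bar>LINT y|lborel. p y * v (x - \<epsilon> *\<^sub>R y)\<bar> \<le> C * measure lborel (cball (0::real^'n) 2) / ?m * B"
    if i: "integrable lborel (\<lambda>y. p y * v (x - \<epsilon> *\<^sub>R y))"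
      and p: "\<And>y. \<bar>p y\<bar> \<le> C * indicator (cball 0 2) y / ?m" for p :: "real^'n \<Rightarrow> real" and C
  proof -
    have "\<bar>LINT y|lborel. p y * v (x - \<epsilon> *\<^sub>R y)\<bar> \<le> (LINT y|lborel. C * indicator (cball (0::real^'n) 2) y / ?m * B)"
    proof (intro integral_abs_bound_integral i)
      show "integrable lborel (\<lambda>y::real^'n. C * indicator (cball 0 2) y / ?m * B)"
        by (intro integrable_mult_left integrable_divide integrable_mult_right integrable_indicator_cball)
      show "\<bar>p y * v (x - \<epsilon> *\<^sub>R y)\<bar> \<le> C * indicator (cball 0 2) y / ?m * B" for y
        unfolding abs_mult using p[of y] B order_trans[OF abs_ge_zero p[of y]] by (intro mult_mono) auto
    qed
    then show ?thesis by simp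
  qed
  have "moll_avg \<epsilon> v (x + z) - moll_avg \<epsilon> v x = (LINT y|lborel. (mollifier (y + ?w) - mollifier y) * v (x - \<epsilon> *\<^sub>R y))"
    unfolding sh(1)[where z = z] left_diff_distrib using sh(2)[where z = z] i0
    by (subst Bochner_Integration.integral_diff) (auto simp: moll_avg_def)
  also have "\<bar>\<dots>\<bar> \<le> (10 * norm ?w) * measure lborel (cball (0::real^'n) 2) / ?m * B"
  proof (rule bound)
    show "integrable lborel (\<lambda>y. (mollifier (y + ?w) - mollifier y) * v (x - \<epsilon> *\<^sub>R y))"
      unfolding left_diff_distrib using sh(2)[where z = z] i0 by simp
    show "\<bar>mollifier (y + ?w) - mollifier y\<bar> \<le> 10 * norm ?w * indicator (cball 0 2) y / ?m" for y
      using divide_right_mono[OF mollifier_profile_diff(1)[OF w(1), of y], of ?m] m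
      by (simp add: mollifier_def diff_divide_distrib[symmetric])
  qed
  also have "\<dots> \<le> (54 * norm ?w) * measure lborel (cball (0::real^'n) 2) / ?m * B"
    using m B0 by (intro mult_right_mono divide_right_mono) auto
  finally show "\<bar>moll_avg \<epsilon> v (x + z) - moll_avg \<epsilon> v x\<bar> \<le> moll_const TYPE('n) * B / \<epsilon> * norm z"
    unfolding w(2) moll_const_def by (simp add: mult_ac)
  have w2: "norm (- ?w) \<le> 1" using w by simp
  have shm: "moll_avg \<epsilon> v (x - z) = (LINT y|lborel. mollifier (y - ?w) * v (x - \<epsilon> *\<^sub>R y))"
    "integrable lborel (\<lambda>y. mollifier (y - ?w) * v (x - \<epsilon> *\<^sub>R y))"
    using sh[where z = "- z"] by simp_all
  have expand: "(2 * mollifier y - mollifier (y + ?w) - mollifier (y - ?w)) * v (x - \<epsilon> *\<^sub>R y)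
    = 2 * (mollifier y * v (x - \<epsilon> *\<^sub>R y)) - mollifier (y + ?w) * v (x - \<epsilon> *\<^sub>R y) - mollifier (y - ?w) * v (x - \<epsilon> *\<^sub>R y)" for y
    by (simp add: algebra_simps)
  have int2: "integrable lborel (\<lambda>y. second_diff mollifier y ?w * v (x - \<epsilon> *\<^sub>R y))"
    unfolding second_diff_def expand using sh(2)[where z = z] i0 shm(2) by (intro Bochner_Integration.integrable_diff integrable_mult_right)
  have "second_diff (moll_avg \<epsilon> v) x z = (LINT y|lborel. second_diff mollifier y ?w * v (x - \<epsilon> *\<^sub>R y))"
    unfolding second_diff_def expand using sh(2)[where z = z] i0 shm(2)
    by (simp add: sh(1)[where z = z] shm(1)) (simp add: moll_avg_def)
  also have "\<bar>\<dots>\<bar> \<le> (54 * (norm ?w)\<^sup>2) * measure lborel (cball (0::real^'n) 2) / ?m * B"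
  proof (rule bound[OF int2])
    have "second_diff mollifier y ?w = second_diff mollifier_profile y ?w / ?m" for y
      by (simp add: second_diff_def mollifier_def diff_divide_distrib)
    then show "\<bar>second_diff mollifier y ?w\<bar> \<le> 54 * (norm ?w)\<^sup>2 * indicator (cball 0 2) y / ?m" for y
      using divide_right_mono[OF mollifier_profile_diff(2)[OF w(1), of y], of ?m] m by simp
  qed
  finally show "\<bar>second_diff (moll_avg \<epsilon> v) x z\<bar> \<le> moll_const TYPE('n) * B / \<epsilon>\<^sup>2 * (norm z)\<^sup>2"
    unfolding w(2) moll_const_def by (simp add: mult_ac power_divide)
qed

lemma moll_avg_tendsto:
  fixes v :: "real^'n \<Rightarrow> real"
  assumes c: "continuous_on UNIV v" and B: "\<And>y. \<bar>v y\<bar> \<le> B"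
  shows "((\<lambda>\<epsilon>. moll_avg \<epsilon> v x) \<longlongrightarrow> v x) (at_right 0)"
proof -
  have [measurable]: "v \<in> borel_measurable borel" using c by (rule borel_measurable_continuous_onI)
  have "((\<lambda>\<epsilon>. moll_avg \<epsilon> v x) \<longlongrightarrow> (LINT y::real^'n|lborel. mollifier y * v x)) (at_right 0)"
    unfolding moll_avg_def
  proof (rule dominated_convergence_within)
    show "integrable lborel (\<lambda>y::real^'n. mollifier y * B)" by (intro integrable_mult_left mollifier_integrable)
    show "\<bar>mollifier y * v (x - \<epsilon> *\<^sub>R y)\<bar> \<le> mollifier y * B" for \<epsilon> y
      using B by (simp add: abs_mult mult_left_mono)
    have "continuous_on UNIV (\<lambda>\<epsilon>. mollifier y * v (x - \<epsilon> *\<^sub>R y))" for y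
      by (intro continuous_intros continuous_on_compose2[OF c]) auto
    then have "((\<lambda>\<epsilon>. mollifier y * v (x - \<epsilon> *\<^sub>R y)) \<longlongrightarrow> mollifier y * v (x - 0 *\<^sub>R y)) (at 0)" for y
      by (metis UNIV_I continuous_on_def)
    then show "((\<lambda>\<epsilon>. mollifier y * v (x - \<epsilon> *\<^sub>R y)) \<longlongrightarrow> mollifier y * v x) (at_right 0)" for y
      by (auto intro: tendsto_within_subset)
  qed measurable
  then show ?thesis by simp
qed

lemma nonlocal_op_measurable:
  fixes v :: "real^'n \<Rightarrow> real"
  assumes [measurable]: "v \<in> borel_measurable borel"
  shows "nonlocal_op s v \<in> borel_measurable borel"
  unfolding nonlocal_op_def second_diff_def
  by (rule lborel.borel_measurable_lebesgue_integral) measurable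

text \<open>Translations commute with the operator; the quadratic bound near \<open>x\<close> makes Fubini's theorem applicable.\<close>

lemma nonlocal_op_moll_avg:
  fixes v :: "real^'n \<Rightarrow> real"
  assumes s: "0 < s" "s < 1" and [measurable]: "v \<in> borel_measurable borel" and B: "\<And>y. \<bar>v y\<bar> \<le> B"
    and sd: "\<And>y z. norm y \<le> 1 \<Longrightarrow> \<bar>second_diff v (x - \<epsilon> *\<^sub>R y) z\<bar> \<le> L * trunc_quad 1 z"
  shows "nonlocal_op s (moll_avg \<epsilon> v) x = moll_avg \<epsilon> (nonlocal_op s v) x"
proof -
  let ?K = "frac_kernel s :: real^'n \<Rightarrow> real"
  define f where "f = (\<lambda>y z. mollifier y * (second_diff v (x - \<epsilon> *\<^sub>R y) z * ?K z))"
  have fm: "case_prod f \<in> borel_measurable (lborel \<Otimes>\<^sub>M lborel)"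
    unfolding f_def second_diff_def by measurable
  have iz: "integrable lborel (\<lambda>z::real^'n. trunc_quad 1 z * ?K z)" by (rule trunc_quad_kernel(1)) (use s in auto)
  have fb: "norm (f y z) \<le> mollifier y * (L * (trunc_quad 1 z * ?K z))" for y z
  proof (cases "norm y \<le> 1")
    case True
    then show ?thesis using mult_left_mono[OF mult_right_mono[OF sd[OF True, of z], of "?K z"], of "mollifier y"]
      by (simp add: f_def abs_mult mult_ac)
  qed (simp add: f_def mollifier_eq_0)
  have ifz: "integrable lborel (f y)" for y
  proof (rule Bochner_Integration.integrable_bound)
    show "integrable lborel (\<lambda>z. mollifier y * (L * (trunc_quad 1 z * ?K z)))"
      by (intro integrable_mult_right iz)
    show "f y \<in> borel_measurable lborel" unfolding f_def second_diff_def by measurable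
  qed (use fb in \<open>auto intro!: order_trans[OF fb[unfolded real_norm_def] abs_ge_self]\<close>)
  have prod: "integrable (lborel \<Otimes>\<^sub>M lborel) (case_prod f)"
  proof (rule lborel_pair.Fubini_integrable[OF fm])
    show "AE y in lborel. integrable lborel (\<lambda>z. case_prod f (y, z))" using ifz by simp
    have "integrable lborel (\<lambda>y. LINT z|lborel. norm (f y z))"
    proof (rule Bochner_Integration.integrable_bound)
      show "integrable lborel (\<lambda>y::real^'n. mollifier y * (L * (LINT z::real^'n|lborel. trunc_quad 1 z * ?K z)))"
        by (intro integrable_mult_left mollifier_integrable)
      show "(\<lambda>y. LINT z|lborel. norm (f y z)) \<in> borel_measurable lborel"
        by (rule lborel.borel_measurable_lebesgue_integral) (use fm in measurable)
      have "(LINT z|lborel. norm (f y z)) \<le> (LINT z|lborel. mollifier y * (L * (trunc_quad 1 z * ?K z)))" for y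
        by (rule integral_mono) (use ifz iz fb in auto)
      then show "AE y in lborel. norm (LINT z|lborel. norm (f y z)) \<le> norm (mollifier y * (L * (LINT z::real^'n|lborel. trunc_quad 1 z * ?K z)))"
        by (intro AE_I2) (auto intro!: order_trans[OF _ abs_ge_self])
    qed
    then show "integrable lborel (\<lambda>y. LINT z|lborel. norm (case_prod f (y, z)))" by simp
  qed
  have im: "integrable lborel (\<lambda>y. mollifier y * v (w - \<epsilon> *\<^sub>R y))" for w
    by (rule moll_avg_integrable(1)) (use B in auto)
  have "second_diff (moll_avg \<epsilon> v) x z * ?K z = (LINT y|lborel. f y z)" for z
  proof -
    have "(LINT y|lborel. f y z) = (LINT y|lborel. (2 * (mollifier y * v (x - \<epsilon> *\<^sub>R y))
        - mollifier y * v (x + z - \<epsilon> *\<^sub>R y) - mollifier y * v (x - z - \<epsilon> *\<^sub>R y)) * ?K z)"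
      unfolding f_def second_diff_def by (intro Bochner_Integration.integral_cong) (auto simp: algebra_simps)
    then show ?thesis using im by (simp add: second_diff_def moll_avg_def)
  qed
  then have "nonlocal_op s (moll_avg \<epsilon> v) x = (LINT z|lborel. LINT y|lborel. f y z)"
    by (simp add: nonlocal_op_def)
  also have "\<dots> = (LINT y|lborel. LINT z|lborel. f y z)"
    by (rule lborel_pair.Fubini_integral[OF prod])
  also have "\<dots> = moll_avg \<epsilon> (nonlocal_op s v) x"
    by (simp add: f_def moll_avg_def nonlocal_op_def)
  finally show ?thesis .
qed

section \<open>Continuity forward in time\<close>

text \<open>Induction along an interval: the property survives limits from the left and can always be
continued a little to the right.\<close>

lemma real_induction [consumes 2, case_names start left right]:
  fixes a b t :: real
  assumes "a \<le> t" "t \<le> b" and start: "P a"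
    and left: "\<And>t. a < t \<Longrightarrow> t \<le> b \<Longrightarrow> (\<And>\<tau>. a \<le> \<tau> \<Longrightarrow> \<tau> < t \<Longrightarrow> P \<tau>) \<Longrightarrow> P t"
    and right: "\<And>t. a \<le> t \<Longrightarrow> t < b \<Longrightarrow> (\<And>\<tau>. a \<le> \<tau> \<Longrightarrow> \<tau> \<le> t \<Longrightarrow> P \<tau>) \<Longrightarrow> \<exists>\<delta>>0. \<forall>\<tau>. t < \<tau> \<and> \<tau> < t + \<delta> \<longrightarrow> P \<tau>"
  shows "P t"
proof (rule ccontr)
  assume neg: "\<not> P t"
  define S where "S = {\<tau>. a \<le> \<tau> \<and> \<tau> \<le> b \<and> \<not> P \<tau>}"
  have S: "t \<in> S" "bdd_below S" using assms(1,2) neg by (auto simp: S_def bdd_below_def)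
  define \<sigma> where "\<sigma> = Inf S"
  have \<sigma>: "a \<le> \<sigma>" "\<sigma> \<le> b"
    unfolding \<sigma>_def using S assms(2) cInf_lower[OF S] by (auto intro!: cInf_greatest simp: S_def)
  have below: "P \<tau>" if "a \<le> \<tau>" "\<tau> < \<sigma>" for \<tau>
    using that \<sigma> cInf_lower[of \<tau> S] S(2) by (fastforce simp: \<sigma>_def S_def)
  have P\<sigma>: "P \<sigma>" using below left[of \<sigma>] start \<sigma> by (cases "\<sigma> = a") auto
  then have "\<sigma> \<noteq> b" using S cInf_lower[OF S] assms(2) neg
    by (metis \<sigma>_def order_antisym)
  then obtain \<delta> where \<delta>: "0 < \<delta>" "\<And>\<tau>. \<sigma> < \<tau> \<Longrightarrow> \<tau> < \<sigma> + \<delta> \<Longrightarrow> P \<tau>"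
    using right[of \<sigma>] below P\<sigma> \<sigma> by (metis order_le_less)
  have "\<sigma> + \<delta> \<le> Inf S"
  proof (rule cInf_greatest)
    fix \<tau> assume "\<tau> \<in> S"
    then have "\<sigma> \<le> \<tau>" "\<not> P \<tau>" using cInf_lower[of \<tau> S] S(2) by (auto simp: \<sigma>_def S_def)
    then show "\<sigma> + \<delta> \<le> \<tau>" using \<delta>(2)[of \<tau>] P\<sigma> by (cases "\<tau> = \<sigma>") (auto simp: not_less[symmetric])
  qed (use S in auto)
  then show False using \<delta> by (simp add: \<sigma>_def)
qed

text \<open>For each \<open>e > 0\<close> the bound \<open>\<bar>D t - D a\<bar> \<le> e * (t - a)\<close> propagates by real induction.\<close>

lemma zero_right_derivative_imp_const:
  fixes D :: "real \<Rightarrow> real"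
  assumes "a \<le> b" and c: "continuous_on {a..b} D"
    and r: "\<And>t e. a \<le> t \<Longrightarrow> t < b \<Longrightarrow> 0 < e \<Longrightarrow> \<exists>\<delta>>0. \<forall>\<tau>. t < \<tau> \<and> \<tau> < t + \<delta> \<longrightarrow> \<bar>D \<tau> - D t\<bar> \<le> e * (\<tau> - t)"
  shows "D b = D a"
proof -
  have *: "\<bar>D b - D a\<bar> \<le> e * (b - a)" if "0 < e" for e
    using \<open>a \<le> b\<close> order_refl
  proof (induction rule: real_induction)
    case start show ?case by simp
  next
    case (left t)
    have "((\<lambda>\<tau>. e * (\<tau> - a) - \<bar>D \<tau> - D a\<bar>) \<longlongrightarrow> e * (t - a) - \<bar>D t - D a\<bar>) (at t within {a..t})"
      using continuous_on_subset[OF c, of "{a..t}"] left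
      by (auto simp: continuous_on_def intro!: tendsto_intros)
    then have "((\<lambda>\<tau>. e * (\<tau> - a) - \<bar>D \<tau> - D a\<bar>) \<longlongrightarrow> e * (t - a) - \<bar>D t - D a\<bar>) (at_left t)"
      using left by (simp add: at_within_Icc_at_left)
    moreover have "\<forall>\<^sub>F \<tau> in at_left t. 0 \<le> e * (\<tau> - a) - \<bar>D \<tau> - D a\<bar>"
      using left by (auto simp: eventually_at_left intro!: exI[of _ a])
    ultimately have "0 \<le> e * (t - a) - \<bar>D t - D a\<bar>" by (rule tendsto_lowerbound) simp
    then show ?case by simp
  next
    case (right t)
    obtain \<delta> where "0 < \<delta>" "\<forall>\<tau>. t < \<tau> \<and> \<tau> < t + \<delta> \<longrightarrow> \<bar>D \<tau> - D t\<bar> \<le> e * (\<tau> - t)"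
      using r[of t e] right \<open>0 < e\<close> by auto
    moreover have "\<bar>D t - D a\<bar> \<le> e * (t - a)" using right by auto
    ultimately show ?case by (intro exI[of _ \<delta>]) (fastforce simp: algebra_simps)
  qed
  show ?thesis
  proof (rule ccontr)
    assume ne: "D b \<noteq> D a"
    then have "0 < b - a" using \<open>a \<le> b\<close> by (cases "a = b") auto
    then have "\<bar>D b - D a\<bar> / (2 * (b - a)) * (b - a) = \<bar>D b - D a\<bar> / 2"
    proof -
      have "y / (2 * L) * L = y / 2" if "0 < L" for L y :: real using that by simp
      then show ?thesis using \<open>0 < b - a\<close> by blast
    qed
    moreover have "0 < \<bar>D b - D a\<bar> / (2 * (b - a))" using ne \<open>0 < b - a\<close> by simp
    ultimately have "\<bar>D b - D a\<bar> \<le> \<bar>D b - D a\<bar> / 2" using * by metis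
    then show False using ne by simp
  qed
qed

text \<open>Inside the gaps of \<open>E\<close> no bound on the derivative is available, only a bound on the increment
counted from the left end of the gap. Real induction glues the two kinds of information: at points
of \<open>E\<close> the derivative continues the estimate, and at other points one restarts from the left
end of the gap, where the estimate is already known.\<close>

lemma growth_across_closed_set:
  fixes \<phi> :: "real \<Rightarrow> real"
  assumes "closed E" and cont: "continuous_on UNIV \<phi>" and "0 \<le> C"
    and E: "\<And>e. e \<in> E \<Longrightarrow> a \<le> e \<Longrightarrow> e < b \<Longrightarrow> (\<phi> has_real_derivative \<phi>' e) (at e) \<and> \<bar>\<phi>' e\<bar> < C"
    and gap: "\<And>e t. e \<in> E \<Longrightarrow> a \<le> e \<Longrightarrow> e < t \<Longrightarrow> t < b \<Longrightarrow> {e<..<t} \<inter> E = {} \<Longrightarrow> \<bar>\<phi> t - \<phi> e\<bar> \<le> C * (t - e)"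
    and "a \<in> E" "a \<le> t" "t \<le> b"
  shows "\<bar>\<phi> t - \<phi> a\<bar> \<le> C * (t - a)"
  using \<open>a \<le> t\<close> \<open>t \<le> b\<close>
proof (induction rule: real_induction)
  case start show ?case by simp
next
  case (left t)
  have "((\<lambda>\<tau>. C * (\<tau> - a) - \<bar>\<phi> \<tau> - \<phi> a\<bar>) \<longlongrightarrow> C * (t - a) - \<bar>\<phi> t - \<phi> a\<bar>) (at_left t)"
    using continuous_on_subset[OF cont, of "{..<t} \<union> {t}"]
    by (intro tendsto_intros) (auto simp: continuous_on_def intro: tendsto_within_subset[of \<phi> _ t UNIV] cont[unfolded continuous_on_def, rule_format])
  moreover have "\<forall>\<^sub>F \<tau> in at_left t. 0 \<le> C * (\<tau> - a) - \<bar>\<phi> \<tau> - \<phi> a\<bar>"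
    using left by (auto simp: eventually_at_left intro!: exI[of _ a])
  ultimately have "0 \<le> C * (t - a) - \<bar>\<phi> t - \<phi> a\<bar>" by (rule tendsto_lowerbound) simp
  then show ?case by simp
next
  case (right t)
  note IH = right(3)
  show ?case
  proof (cases "t \<in> E")
    case True
    have d: "((\<lambda>\<tau>. (\<phi> \<tau> - \<phi> t) / (\<tau> - t)) \<longlongrightarrow> \<phi>' t) (at t)" "\<bar>\<phi>' t\<bar> < C"
      using E[OF True] right by (auto simp: has_field_derivative_iff)
    have "\<forall>\<^sub>F \<tau> in at t. \<bar>(\<phi> \<tau> - \<phi> t) / (\<tau> - t)\<bar> < C"
      using order_tendstoD(2)[OF tendsto_rabs[OF d(1)] d(2)] .
    then obtain \<delta> where \<delta>: "0 < \<delta>" "\<And>\<tau>. \<tau> \<noteq> t \<Longrightarrow> dist \<tau> t < \<delta> \<Longrightarrow> \<bar>(\<phi> \<tau> - \<phi> t) / (\<tau> - t)\<bar> < C"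
      by (auto simp: eventually_at)
    have "\<bar>\<phi> \<tau> - \<phi> a\<bar> \<le> C * (\<tau> - a)" if "t < \<tau>" "\<tau> < t + \<delta>" for \<tau>
    proof -
      have "\<bar>\<phi> \<tau> - \<phi> t\<bar> \<le> C * (\<tau> - t)"
        using \<delta>(2)[of \<tau>] that by (simp add: abs_divide divide_less_eq dist_real_def)
      then show ?thesis using IH[of t] right by (simp add: algebra_simps)
    qed
    then show ?thesis using \<open>0 < \<delta>\<close> by blast
  next
    case False
    then obtain \<delta> where \<delta>: "0 < \<delta>" "ball t \<delta> \<inter> E = {}"
      using \<open>closed E\<close> open_contains_ball[of "- E"] unfolding closed_def by (metis ComplI disjoint_eq_subset_Compl)
    define e where "e = Sup (E \<inter> {a..t})"
    have ne: "E \<inter> {a..t} \<noteq> {}" "bdd_above (E \<inter> {a..t})" using \<open>a \<in> E\<close> right by auto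
    have "closed (E \<inter> {a..t})" using \<open>closed E\<close> by auto
    then have "e \<in> E \<inter> {a..t}" unfolding e_def using ne by (intro closed_contains_Sup)
    then have e: "e \<in> E" "a \<le> e" "e < t" using False by (auto simp: order_le_less)
    have "\<bar>\<phi> \<tau> - \<phi> a\<bar> \<le> C * (\<tau> - a)" if \<tau>: "t < \<tau>" "\<tau> < t + min \<delta> (b - t)" for \<tau>
    proof -
      have "{e<..<\<tau>} \<inter> E = {}"
      proof (rule ccontr)
        assume "{e<..<\<tau>} \<inter> E \<noteq> {}"
        then obtain x where x: "e < x" "x < \<tau>" "x \<in> E" by auto
        show False
        proof (cases "x \<le> t")
          case True
          then have "x \<le> e" unfolding e_def using x e ne by (intro cSup_upper) auto
          then show False using x by simp
        next
          case False
          then have "x \<in> ball t \<delta>" using x \<tau> by (simp add: dist_real_def)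
          then show False using x \<delta> by auto
        qed
      qed
      then have "\<bar>\<phi> \<tau> - \<phi> e\<bar> \<le> C * (\<tau> - e)" using gap[of e \<tau>] e \<tau> by auto
      then show ?thesis using IH[of e] e by (simp add: algebra_simps)
    qed
    then show ?thesis using \<delta> right by (intro exI[of _ "min \<delta> (b - t)"]) auto
  qed
qed

lemma norm_shift_le:
  fixes x y :: "'a::real_normed_vector"
  assumes "0 < \<epsilon>" "norm y \<le> 1"
  shows "norm (x - \<epsilon> *\<^sub>R y) \<le> norm x + \<epsilon>"
proof -
  have "\<epsilon> * norm y \<le> \<epsilon>" using assms by (simp add: mult_left_le)
  then show ?thesis using norm_triangle_ineq4[of x "\<epsilon> *\<^sub>R y"] assms(1)
    unfolding norm_scaleR by linarith
qed

text \<open>A bounded solution of \<open>u_t + (-\<Delta>)^s u = f\<close> with separate regularity in space and time: \<open>h\<close> is the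
time derivative, \<open>c\<close> is half the normalising constant, and \<open>F R\<close> bounds the right-hand side
on the ball of radius \<open>R\<close>. Nothing is assumed about the dependence of the spatial regularity
on time.\<close>

locale frac_heat =
  fixes s M c :: real and F :: "real \<Rightarrow> real" and u h f :: "real ^ 'n \<Rightarrow> real \<Rightarrow> real"
  assumes s: "0 < s" "s < 1" and c: "0 < c"
    and bdd: "\<bar>u x t\<bar> \<le> M"
    and C11: "(\<lambda>x. u x t) \<in> C11_loc"
    and deriv: "(u x has_real_derivative h x t) (at t)"
    and h_cont: "continuous_on UNIV (h x)"
    and f_meas: "(\<lambda>x. f x t) \<in> borel_measurable borel"
    and f_cont: "continuous_on UNIV (f x)"
    and f_bdd: "norm x \<le> R \<Longrightarrow> \<bar>f x t\<bar> \<le> F R"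
    and eq: "h x t = f x t - c * nonlocal_op s (\<lambda>y. u y t) x"
begin

text \<open>The spatial averages of the solution and of its time derivative. Formally the second is
the time derivative of the first, but differentiation under the integral sign is not justified by
the separate regularity of \<open>u\<close>.\<close>

definition U where "U \<epsilon> x t = moll_avg \<epsilon> (\<lambda>y. u y t) x"
definition G where "G \<epsilon> x t = moll_avg \<epsilon> (\<lambda>y. h y t) x"

lemma M_nonneg: "0 \<le> M" using bdd[of undefined undefined] by linarith

lemma u_cont_x: "continuous_on UNIV (\<lambda>x. u x t)"
  using C11 by (rule C11_loc_continuous)

lemma u_meas [measurable]: "(\<lambda>x. u x t) \<in> borel_measurable borel"
  using u_cont_x by (rule borel_measurable_continuous_onI)

lemma u_cont_t: "continuous_on UNIV (u x)"
  using deriv by (meson DERIV_isCont continuous_at_imp_continuous_on)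

lemma h_meas [measurable]: "(\<lambda>x. h x t) \<in> borel_measurable borel"
  unfolding eq by (intro borel_measurable_diff f_meas borel_measurable_times borel_measurable_const
      nonlocal_op_measurable u_meas)

lemma second_diff_u: "\<exists>L\<ge>0. \<forall>x z. norm x \<le> R \<longrightarrow> \<bar>second_diff (\<lambda>y. u y t) x z\<bar> \<le> L * trunc_quad 1 z"
proof -
  obtain L where L: "L \<ge> 0" "\<And>x z. norm x \<le> R \<Longrightarrow> norm z \<le> 1 \<Longrightarrow> \<bar>second_diff (\<lambda>y. u y t) x z\<bar> \<le> L * (norm z)\<^sup>2"
    using C11_loc_second_diff[OF C11[of t], of R] by blast
  have "\<bar>second_diff (\<lambda>y. u y t) x z\<bar> \<le> (4 * M + L * 1\<^sup>2) * trunc_quad 1 z" if "norm x \<le> R" for x z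
    by (rule second_diff_trunc_quad) (use bdd L that in auto)
  then show ?thesis using L M_nonneg by (intro exI[of _ "4 * M + L * 1\<^sup>2"]) auto
qed

lemma nonlocal_at_u: "nonlocal_at s (\<lambda>y. u y t) x"
proof -
  obtain L where "\<forall>z. \<bar>second_diff (\<lambda>y. u y t) x z\<bar> \<le> L * trunc_quad 1 z"
    using second_diff_u[of "norm x" t] by blast
  then show ?thesis using nonlocal_trunc_quad_bound(1)[OF s, of 1 "\<lambda>y. u y t" x L] by simp
qed

lemma h_locally_bounded: "\<exists>N. \<forall>x. norm x \<le> R \<longrightarrow> \<bar>h x t\<bar> \<le> N"
proof -
  obtain L where L: "\<And>x z. norm x \<le> R \<Longrightarrow> \<bar>second_diff (\<lambda>y. u y t) x z\<bar> \<le> L * trunc_quad 1 z"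
    using second_diff_u[of R t] by blast
  have "\<bar>h x t\<bar> \<le> F R + c * (L * kernel_mass TYPE('n) s)" if "norm x \<le> R" for x
  proof -
    have "\<bar>nonlocal_op s (\<lambda>y. u y t) x\<bar> \<le> L * kernel_mass TYPE('n) s"
      using nonlocal_trunc_quad_bound(2)[OF s, of 1 "\<lambda>y. u y t" x L] L[OF that] by simp
    then have "c * \<bar>nonlocal_op s (\<lambda>y. u y t) x\<bar> \<le> c * (L * kernel_mass TYPE('n) s)" using c by simp
    then have "\<bar>c * nonlocal_op s (\<lambda>y. u y t) x\<bar> \<le> c * (L * kernel_mass TYPE('n) s)"
      using c by (simp add: abs_mult)
    then show ?thesis using f_bdd[OF that, of t] unfolding eq by linarith
  qed
  then show ?thesis by blast
qed

lemma U_bdd: "\<bar>U \<epsilon> x t\<bar> \<le> M"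
  unfolding U_def by (rule moll_avg_integrable(2)) (use bdd in auto)

lemma moll_avg_cont_t:
  assumes [measurable]: "\<And>t. (\<lambda>y. v y t) \<in> borel_measurable borel" and ct: "\<And>y. continuous_on UNIV (v y)"
    and B: "\<And>y t. norm y \<le> 1 \<Longrightarrow> \<bar>v (x - \<epsilon> *\<^sub>R y) t\<bar> \<le> B"
  shows "continuous_on UNIV (\<lambda>t::real. moll_avg \<epsilon> (\<lambda>y. v y t) (x::real^'n))"
  unfolding continuous_on_def moll_avg_def
proof (intro ballI dominated_convergence_within)
  show "integrable lborel (\<lambda>y::real^'n. mollifier y * B)" by (intro integrable_mult_left mollifier_integrable)
  show "\<bar>mollifier y * v (x - \<epsilon> *\<^sub>R y) t\<bar> \<le> mollifier y * B" for t and y :: "real^'n"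
    using B[of y] mollifier_eq_0[of y] by (cases "norm y \<le> 1") (auto simp: abs_mult mult_left_mono)
  show "((\<lambda>t. mollifier y * v (x - \<epsilon> *\<^sub>R y) t) \<longlongrightarrow> mollifier y * v (x - \<epsilon> *\<^sub>R y) t) (at t)" for t and y :: "real^'n"
    using ct by (intro tendsto_intros) (simp add: continuous_on_def)
qed measurable

lemma U_cont_t: "continuous_on UNIV (U \<epsilon> x)"
  unfolding U_def by (rule moll_avg_cont_t) (use u_cont_t bdd in auto)

lemma U_lipschitz:
  assumes "0 < \<epsilon>" "norm z \<le> \<epsilon>"
  shows "\<bar>U \<epsilon> (x + z) t - U \<epsilon> x t\<bar> \<le> moll_const TYPE('n) * M / \<epsilon> * norm z"
  unfolding U_def by (rule moll_avg_regular(1)) (use assms bdd in auto)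

lemma U_second_diff:
  assumes "0 < \<epsilon>"
  shows "\<bar>second_diff (\<lambda>y. U \<epsilon> y t) x z\<bar> \<le> (4 * M + moll_const TYPE('n) * M) * trunc_quad \<epsilon> z"
proof -
  have "\<bar>second_diff (\<lambda>y. U \<epsilon> y t) x z\<bar> \<le> (4 * M + moll_const TYPE('n) * M / \<epsilon>\<^sup>2 * \<epsilon>\<^sup>2) * trunc_quad \<epsilon> z"
  proof (rule second_diff_trunc_quad)
    show "\<bar>second_diff (\<lambda>y. U \<epsilon> y t) x z\<bar> \<le> moll_const TYPE('n) * M / \<epsilon>\<^sup>2 * (norm z)\<^sup>2" if "norm z < \<epsilon>" for z
      unfolding U_def by (rule moll_avg_regular(2)) (use assms bdd that in auto)
  qed (use assms U_bdd M_nonneg moll_const_nonneg[where 'n='n] in auto)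
  then show ?thesis using assms by simp
qed

lemma U_jointly_continuous:
  assumes "0 < \<epsilon>"
  shows "continuous_on UNIV (\<lambda>p. U \<epsilon> (fst p) (snd p))"
proof -
  let ?C = "moll_const TYPE('n) * M / \<epsilon>"
  have C: "0 \<le> ?C" using assms M_nonneg moll_const_nonneg[where 'n='n] by simp
  have "((\<lambda>p. U \<epsilon> (fst p) (snd p)) \<longlongrightarrow> U \<epsilon> x t) (at (x, t))" for x t
  proof -
    let ?b = "\<lambda>p. ?C * norm (fst p - x) + \<bar>U \<epsilon> x (snd p) - U \<epsilon> x t\<bar>"
    have "((\<lambda>\<tau>. U \<epsilon> x \<tau>) \<longlongrightarrow> U \<epsilon> x t) (nhds t)"
      using U_cont_t[of \<epsilon> x] by (simp add: continuous_on_eq_continuous_at isCont_def tendsto_at_iff_tendsto_nhds)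
    moreover have "filterlim snd (nhds t) (at (x, t))"
      using tendsto_snd[OF tendsto_ident_at, of "(x, t)" UNIV] by simp
    ultimately have "((\<lambda>p. U \<epsilon> x (snd p)) \<longlongrightarrow> U \<epsilon> x t) (at (x, t))"
      by (rule filterlim_compose)
    moreover have "(fst \<longlongrightarrow> x) (at (x, t))"
      using tendsto_fst[OF tendsto_ident_at, of "(x, t)" UNIV] by simp
    ultimately have "(?b \<longlongrightarrow> ?C * norm (x - x) + \<bar>U \<epsilon> x t - U \<epsilon> x t\<bar>) (at (x, t))"
      by (intro tendsto_intros)
    then have lim: "(?b \<longlongrightarrow> 0) (at (x, t))" by simp
    have "\<forall>\<^sub>F p in at (x, t). norm (U \<epsilon> (fst p) (snd p) - U \<epsilon> x t) \<le> ?b p"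
    proof -
      have "\<forall>\<^sub>F p in at (x, t). dist (fst p) x < \<epsilon>"
        using \<open>(fst \<longlongrightarrow> x) (at (x, t))\<close> assms by (rule tendstoD)
      then show ?thesis
      proof eventually_elim
        case (elim p)
        have "\<bar>U \<epsilon> (fst p) (snd p) - U \<epsilon> x (snd p)\<bar> \<le> ?C * norm (fst p - x)"
          using U_lipschitz[OF assms, of "fst p - x" x "snd p"] elim by (simp add: dist_norm)
        then show ?case by simp
      qed
    qed
    then show ?thesis using lim by (subst Lim_null) (rule Lim_null_comparison)
  qed
  then show ?thesis by (auto simp: continuous_on_def)
qed

lemma U_cont_x: "0 < \<epsilon> \<Longrightarrow> continuous_on UNIV (\<lambda>x. U \<epsilon> x t)"
  by (rule continuous_on_compose2[OF U_jointly_continuous, of \<epsilon> UNIV "\<lambda>x. (x, t)", simplified])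
     (auto intro!: continuous_intros)

lemma U_meas: "0 < \<epsilon> \<Longrightarrow> (\<lambda>x. U \<epsilon> x t) \<in> borel_measurable borel"
  by (rule borel_measurable_continuous_onI[OF U_cont_x])

lemma nonlocal_at_U: "0 < \<epsilon> \<Longrightarrow> nonlocal_at s (\<lambda>y. U \<epsilon> y t) x"
  by (rule nonlocal_trunc_quad_bound(1)[OF s _ U_meas U_second_diff])

lemma G_eq:
  assumes "0 < \<epsilon>"
  shows "G \<epsilon> x t = moll_avg \<epsilon> (\<lambda>y. f y t) x - c * nonlocal_op s (\<lambda>y. U \<epsilon> y t) x"
proof -
  have in_ball: "norm (x - \<epsilon> *\<^sub>R y) \<le> norm x + \<epsilon>" if "norm y \<le> 1" for y
    using norm_shift_le[OF assms that] .
  obtain L where L: "\<And>w z. norm w \<le> norm x + \<epsilon> \<Longrightarrow> \<bar>second_diff (\<lambda>y. u y t) w z\<bar> \<le> L * trunc_quad 1 z"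
    using second_diff_u[of "norm x + \<epsilon>" t] by blast
  have nb: "\<bar>nonlocal_op s (\<lambda>y. u y t) (x - \<epsilon> *\<^sub>R y)\<bar> \<le> L * kernel_mass TYPE('n) s" if "norm y \<le> 1" for y
    using nonlocal_trunc_quad_bound(2)[OF s, of 1 "\<lambda>y. u y t" _ L] L[OF in_ball[OF that]] by simp
  have i1: "integrable lborel (\<lambda>y. mollifier y * f (x - \<epsilon> *\<^sub>R y) t)"
    by (rule moll_avg_integrable(1)[OF f_meas, where x = x and \<epsilon> = \<epsilon> and B = "F (norm x + \<epsilon>)"]) (use f_bdd in_ball in auto)
  have i2: "integrable lborel (\<lambda>y. mollifier y * nonlocal_op s (\<lambda>y. u y t) (x - \<epsilon> *\<^sub>R y))"
    by (rule moll_avg_integrable(1)[OF nonlocal_op_measurable[OF u_meas], where x = x and \<epsilon> = \<epsilon> and B = "L * kernel_mass TYPE('n) s"]) (use nb in auto)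
  have "G \<epsilon> x t = (LINT y|lborel. mollifier y * f (x - \<epsilon> *\<^sub>R y) t
      - c * (mollifier y * nonlocal_op s (\<lambda>y. u y t) (x - \<epsilon> *\<^sub>R y)))"
    unfolding G_def moll_avg_def eq by (intro Bochner_Integration.integral_cong) (auto simp: algebra_simps)
  also have "\<dots> = moll_avg \<epsilon> (\<lambda>y. f y t) x - c * moll_avg \<epsilon> (nonlocal_op s (\<lambda>y. u y t)) x"
    using i1 i2 by (simp add: moll_avg_def)
  also have "moll_avg \<epsilon> (nonlocal_op s (\<lambda>y. u y t)) x = nonlocal_op s (\<lambda>y. U \<epsilon> y t) x"
    unfolding U_def
    by (rule nonlocal_op_moll_avg[OF s u_meas bdd L[OF in_ball], symmetric])
  finally show ?thesis .
qed

text \<open>Although \<open>h\<close> need not be locally bounded in space and time, its average is continuous in time: by the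
equation it is an average of \<open>f\<close> minus the operator applied to \<open>U\<close>, and the latter has second
differences bounded uniformly in time.\<close>

lemma G_cont_t:
  assumes "0 < \<epsilon>"
  shows "continuous_on UNIV (G \<epsilon> x)"
proof -
  have in_ball: "norm (x - \<epsilon> *\<^sub>R y) \<le> norm x + \<epsilon>" if "norm y \<le> 1" for y
    using norm_shift_le[OF assms that] .
  have 1: "continuous_on UNIV (\<lambda>t. moll_avg \<epsilon> (\<lambda>y. f y t) x)"
    by (rule moll_avg_cont_t[OF f_meas f_cont, where x = x and \<epsilon> = \<epsilon> and B = "F (norm x + \<epsilon>)"]) (use f_bdd in_ball in auto)
  have 2: "continuous_on UNIV (\<lambda>t. nonlocal_op s (\<lambda>y. U \<epsilon> y t) x)"
    unfolding continuous_on_def nonlocal_op_def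
  proof (intro ballI dominated_convergence_within)
    let ?C = "4 * M + moll_const TYPE('n) * M"
    show "integrable lborel (\<lambda>z::real^'n. ?C * (trunc_quad \<epsilon> z * frac_kernel s z))"
      by (intro integrable_mult_right trunc_quad_kernel(1) s assms)
    show "\<bar>second_diff (\<lambda>y. U \<epsilon> y t) x z * frac_kernel s z\<bar> \<le> ?C * (trunc_quad \<epsilon> z * frac_kernel s z)" for t z
      using mult_right_mono[OF U_second_diff[OF assms, of t x z], of "frac_kernel s z"]
      by (simp add: abs_mult mult.assoc)
    show "((\<lambda>t. second_diff (\<lambda>y. U \<epsilon> y t) x z * frac_kernel s z) \<longlongrightarrow> second_diff (\<lambda>y. U \<epsilon> y t) x z * frac_kernel s z) (at t)" for t z
      unfolding second_diff_def using U_cont_t[of \<epsilon>]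
      by (intro tendsto_intros) (auto simp: continuous_on_def)
    show "(\<lambda>z. second_diff (\<lambda>y. U \<epsilon> y t) x z * frac_kernel s z) \<in> borel_measurable lborel" for t
      using second_diff_measurable[OF U_meas[OF assms]] by measurable
    then show "(\<lambda>z. second_diff (\<lambda>y. U \<epsilon> y t) x z * frac_kernel s z) \<in> borel_measurable lborel" for t .
  qed
  show ?thesis unfolding G_eq[OF assms, abs_def] by (intro continuous_intros 1 2)
qed

text \<open>Differentiation under the integral sign is legitimate at time \<open>t\<close> for all averages over
balls inside the ball of radius \<open>R\<close>.\<close>

definition mollified_equation_at :: "real \<Rightarrow> real \<Rightarrow> bool" where
  "mollified_equation_at R t \<longleftrightarrow> (\<forall>\<epsilon> x. 0 < \<epsilon> \<longrightarrow> norm x + \<epsilon> < R \<longrightarrow> (U \<epsilon> x has_real_derivative G \<epsilon> x t) (at t))"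

text \<open>\<open>N\<close> bounds the initial rate of change; the last two terms pay for a penalty of
height \<open>4 * M\<close> at scale \<open>r\<close> and for strictness.\<close>

definition drift_bound :: "real \<Rightarrow> real \<Rightarrow> real \<Rightarrow> real" where
  "drift_bound R r N = N + 2 * F R + 40 * c * M * kernel_mass TYPE('n) s * r powr (- 2 * s) + 1"

text \<open>A maximum principle with a barrier that grows linearly in time and penalises the distance from \<open>x0\<close>.
The average is jointly continuous up to the initial time \<open>a\<close>, so a positive maximum of
\<open>P\<close> is attained at a time after \<open>a\<close> and within distance \<open>r\<close> of \<open>x0\<close>. There the equation bounds
the time derivative by less than the slope of the barrier. The factor \<open>\<sigma>\<close> treats upper and
lower bounds at once.\<close>

lemma mollified_gap_estimate:
  assumes \<epsilon>: "0 < \<epsilon>" and r: "0 < r" "norm x0 + r + \<epsilon> < R"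
    and N: "\<And>x. norm x < R \<Longrightarrow> \<bar>h x a\<bar> \<le> N"
    and good: "\<And>t. a < t \<Longrightarrow> t < b \<Longrightarrow> mollified_equation_at R t"
    and t: "a < t" "t < b" and \<sigma>: "\<bar>\<sigma>\<bar> = (1::real)"
  shows "\<sigma> * (U \<epsilon> x0 t - U \<epsilon> x0 a) \<le> drift_bound R r N * (t - a)"
proof (rule ccontr)
  assume neg: "\<not> ?thesis"
  define C where "C = drift_bound R r N"
  define P where "P = (\<lambda>x \<tau>. \<sigma> * (U \<epsilon> x \<tau> - U \<epsilon> x a) - C * (\<tau> - a) - 4 * M * scaled_bump r x0 x)"
  have N0: "0 \<le> N" using N[of x0] r \<epsilon> by (smt (verit) norm_ge_zero)
  have F0: "0 \<le> F R" using f_bdd[of x0 R a] r \<epsilon> by (smt (verit) norm_ge_zero)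
  have C0: "0 < C"
    unfolding C_def drift_bound_def using N0 F0 c M_nonneg kernel_mass_nonneg[where 'n='n] by (smt (verit) mult_nonneg_nonneg powr_ge_zero)
  let ?Q = "cball x0 r \<times> {a..t}"
  have "continuous_on ?Q (\<lambda>p. P (fst p) (snd p))"
    unfolding P_def
    by (intro continuous_intros continuous_on_subset[OF U_jointly_continuous[OF \<epsilon>]]
        continuous_on_compose2[OF U_cont_x[OF \<epsilon>], of _ fst]) auto
  moreover have "compact ?Q" "?Q \<noteq> {}" using r t by (auto intro!: compact_Times)
  ultimately obtain p where p: "p \<in> ?Q" "\<And>q. q \<in> ?Q \<Longrightarrow> P (fst q) (snd q) \<le> P (fst p) (snd p)"
    using continuous_attains_sup[of ?Q "\<lambda>p. P (fst p) (snd p)"] by blast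
  obtain x1 t1 where p1: "p = (x1, t1)" by force
  have "0 < P x0 t" using neg by (simp add: P_def C_def)
  also have "P x0 t \<le> P x1 t1" using p(2)[of "(x0, t)"] r t by (simp add: p1)
  finally have pos: "0 < P x1 t1" .
  have P_out: "P x \<tau> \<le> 0" if "r \<le> dist x x0" "a \<le> \<tau>" for x \<tau>
  proof -
    have "\<sigma> * (U \<epsilon> x \<tau> - U \<epsilon> x a) \<le> 2 * M"
      using \<sigma> U_bdd[of \<epsilon> x \<tau>] U_bdd[of \<epsilon> x a] by (auto simp: abs_if split: if_splits)
    moreover have "4 * M * (1 / 2) \<le> 4 * M * scaled_bump r x0 x"
      using M_nonneg scaled_bump_ge_half[OF r(1) that(1)] by (intro mult_left_mono) auto
    moreover have "0 \<le> C * (\<tau> - a)" using C0 that by simp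
    ultimately show ?thesis by (simp add: P_def)
  qed
  have x1: "dist x1 x0 < r" using P_out[of x1 t1] pos p(1) by (auto simp: p1 not_less[symmetric])
  have "t1 \<noteq> a"
  proof
    assume "t1 = a"
    then have "P x1 t1 \<le> 0" using M_nonneg by (simp add: P_def)
    then show False using pos by simp
  qed
  then have t1: "a < t1" "t1 \<le> t" using p(1) by (auto simp: p1)
  have R1: "norm x1 + \<epsilon> < R" using x1 r norm_triangle_ineq2[of x1 x0] by (simp add: dist_norm)
  have dU: "(U \<epsilon> x1 has_real_derivative G \<epsilon> x1 t1) (at t1)"
    using good[of t1] t1 t R1 \<epsilon> unfolding mollified_equation_at_def by auto
  have dP: "(P x1 has_real_derivative (\<sigma> * G \<epsilon> x1 t1 - C)) (at t1)"
    unfolding P_def by (auto intro!: derivative_eq_intros dU)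
  have ge: "0 \<le> \<sigma> * G \<epsilon> x1 t1 - C"
  proof (rule ccontr)
    assume "\<not> ?thesis"
    then obtain d where d: "0 < d" "\<And>k. 0 < k \<Longrightarrow> k < d \<Longrightarrow> P x1 t1 < P x1 (t1 - k)"
      using DERIV_neg_dec_left[OF dP] by auto
    define k where "k = min (d / 2) (t1 - a)"
    have "0 < k" "k < d" "a \<le> t1 - k" using d t1 by (auto simp: k_def)
    then show False using d(2)[of k] p(2)[of "(x1, t1 - k)"] p(1) t1 by (simp add: p1)
  qed
  define V where "V = (\<lambda>x. \<sigma> * (U \<epsilon> x t1 - U \<epsilon> x a))"
  have max: "V y - 4 * M * scaled_bump r x0 y \<le> V x1 - 4 * M * scaled_bump r x0 x1" for y
  proof -
    have "P y t1 \<le> P x1 t1"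
      using P_out[of y t1] pos p(2)[of "(y, t1)"] t1 p(1)
      by (cases "r \<le> dist y x0") (auto simp: p1 dist_commute)
    then show ?thesis by (simp add: P_def V_def)
  qed
  have atV: "nonlocal_at s V x1" "nonlocal_op s V x1 = \<sigma> * (nonlocal_op s (\<lambda>y. U \<epsilon> y t1) x1 - nonlocal_op s (\<lambda>y. U \<epsilon> y a) x1)"
    using nonlocal_cmult[OF nonlocal_diff(1)[OF nonlocal_at_U[OF \<epsilon>, of t1 x1] nonlocal_at_U[OF \<epsilon>, of a x1]], of \<sigma>]
      nonlocal_diff(2)[OF nonlocal_at_U[OF \<epsilon>, of t1 x1] nonlocal_at_U[OF \<epsilon>, of a x1]]
    by (simp_all add: V_def)
  note bump = nonlocal_scaled_bump[OF s r(1), of x0 x1]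
  have "nonlocal_op s (\<lambda>y. 4 * M * scaled_bump r x0 y) x1 \<le> nonlocal_op s V x1"
  proof (rule nonlocal_mono[OF nonlocal_cmult(1)[OF bump(1)] atV(1)])
    show "second_diff (\<lambda>y. 4 * M * scaled_bump r x0 y) x1 z \<le> second_diff V x1 z" for z
      using max[of "x1 + z"] max[of "x1 - z"] by (simp add: second_diff_def)
  qed
  moreover have "nonlocal_op s (\<lambda>y. 4 * M * scaled_bump r x0 y) x1 \<ge> - (4 * M * (10 * kernel_mass TYPE('n) s * r powr (- 2 * s)))"
  proof -
    have "4 * M * \<bar>nonlocal_op s (scaled_bump r x0) x1\<bar> \<le> 4 * M * (10 * kernel_mass TYPE('n) s * r powr (- 2 * s))"
      using bump(2) M_nonneg by (intro mult_left_mono) auto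
    then have "\<bar>4 * M * nonlocal_op s (scaled_bump r x0) x1\<bar> \<le> 4 * M * (10 * kernel_mass TYPE('n) s * r powr (- 2 * s))"
      using M_nonneg by (simp add: abs_mult)
    then show ?thesis unfolding nonlocal_cmult(2)[OF bump(1)] by linarith
  qed
  ultimately have nl: "- (40 * M * kernel_mass TYPE('n) s * r powr (- 2 * s)) \<le> nonlocal_op s V x1" by simp
  have loc: "norm (x1 - \<epsilon> *\<^sub>R y) < R" if "norm y \<le> 1" for y
    using norm_shift_le[OF \<epsilon> that, of x1] R1 by simp
  have Ga: "\<bar>G \<epsilon> x1 a\<bar> \<le> N"
    unfolding G_def by (rule moll_avg_integrable(2)[OF h_meas]) (use N loc in auto)
  have fb: "\<bar>moll_avg \<epsilon> (\<lambda>y. f y \<tau>) x1\<bar> \<le> F R" for \<tau>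
    by (rule moll_avg_integrable(2)[OF f_meas]) (use f_bdd loc in \<open>auto simp: less_imp_le\<close>)
  have "\<sigma> * G \<epsilon> x1 t1 = \<sigma> * moll_avg \<epsilon> (\<lambda>y. f y t1) x1 + \<sigma> * (G \<epsilon> x1 a) - \<sigma> * moll_avg \<epsilon> (\<lambda>y. f y a) x1
      - c * nonlocal_op s V x1"
    unfolding G_eq[OF \<epsilon>] atV(2) by (simp add: algebra_simps)
  also have "\<dots> \<le> F R + N + F R + c * (40 * M * kernel_mass TYPE('n) s * r powr (- 2 * s))"
  proof -
    have "- c * nonlocal_op s V x1 \<le> c * (40 * M * kernel_mass TYPE('n) s * r powr (- 2 * s))"
      using mult_left_mono[OF nl, of c] c by simp
    moreover have "\<sigma> * q \<le> \<bar>q\<bar>" "- \<sigma> * q \<le> \<bar>q\<bar>" for q using \<sigma> by (auto simp: abs_if split: if_splits)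
    ultimately show ?thesis using fb[of t1] fb[of a] Ga
      by (smt (verit) minus_mult_left)
  qed
  also have "\<dots> < C" unfolding C_def drift_bound_def by (simp add: mult_ac)
  finally show False using ge by simp
qed

lemma gap_estimate:
  assumes r: "0 < r" "norm x0 + r < R"
    and N: "\<And>x. norm x < R \<Longrightarrow> \<bar>h x a\<bar> \<le> N"
    and good: "\<And>t. a < t \<Longrightarrow> t < b \<Longrightarrow> mollified_equation_at R t"
    and t: "a < t" "t < b"
  shows "\<bar>u x0 t - u x0 a\<bar> \<le> drift_bound R r N * (t - a)"
proof -
  have "\<sigma> * (u x0 t - u x0 a) \<le> drift_bound R r N * (t - a)" if \<sigma>: "\<bar>\<sigma>\<bar> = 1" for \<sigma>
  proof (rule tendsto_upperbound)
    show "((\<lambda>\<epsilon>. \<sigma> * (U \<epsilon> x0 t - U \<epsilon> x0 a)) \<longlongrightarrow> \<sigma> * (u x0 t - u x0 a)) (at_right 0)"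
      unfolding U_def by (intro tendsto_intros moll_avg_tendsto[OF u_cont_x bdd])
    show "\<forall>\<^sub>F \<epsilon> in at_right 0. \<sigma> * (U \<epsilon> x0 t - U \<epsilon> x0 a) \<le> drift_bound R r N * (t - a)"
      unfolding eventually_at_right_field
      using mollified_gap_estimate[OF _ r(1) _ N good t \<sigma>] r by (intro exI[of _ "R - (norm x0 + r)"]) auto
  qed simp
  from this[of 1] this[of "-1"] show ?thesis by (simp add: abs_le_iff)
qed

lemma closed_times_rate_bounded: "closed {t. \<forall>x. norm x < R \<longrightarrow> \<bar>h x t\<bar> \<le> N}"
proof -
  have "closed {t. \<bar>h x t\<bar> \<le> N}" for x
    by (intro closed_Collect_le continuous_intros h_cont)
  moreover have "{t. \<forall>x. norm x < R \<longrightarrow> \<bar>h x t\<bar> \<le> N} = (\<Inter>x\<in>{x. norm x < R}. {t. \<bar>h x t\<bar> \<le> N})"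
    by auto
  ultimately show ?thesis by (auto intro!: closed_INT)
qed

text \<open>At each single time the rate of change is bounded on the ball, so \<open>E\<close> is a countable union of
closed sets on which the bound is uniform. By Baire's theorem one of them contains a relatively
open portion of \<open>E\<close>.\<close>

lemma rate_bounded_on_portion:
  assumes "closed E" "E \<noteq> {}"
  obtains e0 \<rho> N where "e0 \<in> E" "0 < \<rho>" "\<And>t x. t \<in> E \<Longrightarrow> dist t e0 < \<rho> \<Longrightarrow> norm x < R \<Longrightarrow> \<bar>h x t\<bar> \<le> N"
proof -
  define A where "A = (\<lambda>N::nat. {t. \<forall>x. norm x < R \<longrightarrow> \<bar>h x t\<bar> \<le> real N})"
  have clA: "closed (A N)" for N unfolding A_def by (rule closed_times_rate_bounded)
  have "\<exists>N. \<not> E \<subseteq> closure (E - A N)"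
  proof (rule ccontr)
    assume "\<not> ?thesis"
    then have dense: "E \<subseteq> closure (E - A N)" for N by blast
    have "E \<subseteq> closure (\<Inter>(range (\<lambda>N. E - A N)))"
    proof (rule Baire[OF assms(1)])
      fix T assume "T \<in> range (\<lambda>N. E - A N)"
      then obtain N where T: "T = E - A N" by auto
      have "openin (top_of_set E) (E \<inter> - A N)" using clA by (intro openin_open_Int) auto
      then show "openin (top_of_set E) T \<and> E \<subseteq> closure T" using dense by (simp add: T Diff_eq)
    qed auto
    moreover have "\<Inter>(range (\<lambda>N. E - A N)) = {}"
    proof -
      have "\<exists>N. t \<in> A N" for t
      proof -
        obtain N where N: "\<forall>x. norm x \<le> R \<longrightarrow> \<bar>h x t\<bar> \<le> N" using h_locally_bounded by blast
        obtain n :: nat where "N \<le> real n" using real_arch_simple by blast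
        then have "\<bar>h x t\<bar> \<le> real n" if "norm x < R" for x using N that by (meson less_imp_le order_trans)
        then have "t \<in> A n" by (simp add: A_def)
        then show ?thesis by blast
      qed
      then show ?thesis by blast
    qed
    ultimately have "E \<subseteq> closure {}" by (simp only:)
    then show False using assms by simp
  qed
  then obtain N e0 where e0: "e0 \<in> E" "e0 \<notin> closure (E - A N)" by blast
  then obtain \<rho> where "0 < \<rho>" "\<And>t. t \<in> E - A N \<Longrightarrow> \<not> dist t e0 < \<rho>"
    unfolding closure_approachable by blast
  then show ?thesis using that[of e0 \<rho> "real N"] e0 unfolding A_def by blast
qed

text \<open>Let \<open>E\<close> be the closed set of times without a neighbourhood in which the claim holds, and take a portion
of \<open>E\<close> on which the rate \<open>h\<close> is bounded. In the gaps of \<open>E\<close> the claim holds, so each gap has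
a Lipschitz estimate from its left end, with the same constant for all gaps that start in the
portion. Across the portion these combine to a Lipschitz estimate to the right of every point of
\<open>E\<close>, uniform in space. This dominates the difference quotients, hence \<open>U\<close> has right derivative
\<open>G\<close> on the whole neighbourhood. As \<open>G\<close> is continuous, \<open>U\<close> minus a primitive of \<open>G\<close> is constant,
and the neighbourhood was not exceptional after all.\<close>

lemma mollified_equation_everywhere: "mollified_equation_at R t"
proof (rule ccontr)
  assume "\<not> mollified_equation_at R t"
  define E where "E = - interior {t. mollified_equation_at R t}"
  have "closed E" "t \<in> E"
    using \<open>\<not> mollified_equation_at R t\<close> interior_subset[of "{t. mollified_equation_at R t}"] by (auto simp: E_def)
  then have "E \<noteq> {}" by blast
  then obtain e0 \<rho> N where e0: "e0 \<in> E" and \<rho>: "0 < \<rho>"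
    and N: "\<And>t x. t \<in> E \<Longrightarrow> dist t e0 < \<rho> \<Longrightarrow> norm x < R \<Longrightarrow> \<bar>h x t\<bar> \<le> N"
    using rate_bounded_on_portion[OF \<open>closed E\<close>, where R = R] by blast
  have good_off: "mollified_equation_at R t" if "t \<notin> E" for t
    using that interior_subset[of "{t. mollified_equation_at R t}"] by (auto simp: E_def)
  have "mollified_equation_at R t1" if t1: "dist t1 e0 < \<rho>" for t1
    unfolding mollified_equation_at_def
  proof (intro allI impI)
    fix \<epsilon> and x :: "real^'n" assume \<epsilon>: "0 < \<epsilon>" and x: "norm x + \<epsilon> < R"
    define r where "r = (R - (norm x + \<epsilon>)) / 2"
    have r: "0 < r" using x by (simp add: r_def)
    have N0: "0 \<le> N"
    proof -
      have "norm x < R" using x \<epsilon> by linarith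
      then have "\<bar>h x e0\<bar> \<le> N" using N[OF e0, of x] \<rho> by auto
      then show ?thesis by linarith
    qed
    define K where "K = max (drift_bound R r N) (N + 1)"
    have K: "N < K" "drift_bound R r N \<le> K" "0 \<le> K" using N0 by (auto simp: K_def)
    have grow: "\<bar>u y \<tau> - u y e\<bar> \<le> K * (\<tau> - e)"
      if y: "norm y \<le> norm x + \<epsilon>" and e: "e \<in> E" "dist e e0 < \<rho>" and \<tau>: "e \<le> \<tau>" "\<tau> < e0 + \<rho>" for y e \<tau>
    proof (rule growth_across_closed_set[OF \<open>closed E\<close> u_cont_t K(3)])
      have y': "norm y < R" "norm y + r < R" using y x by (auto simp: r_def field_simps)
      fix e' assume e': "e' \<in> E" "e \<le> e'"
      have d: "dist e' e0 < \<rho>" if "e' < \<tau>" using that e' e \<tau> by (auto simp: dist_real_def)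
      show "(u y has_real_derivative h y e') (at e') \<and> \<bar>h y e'\<bar> < K" if "e' < \<tau>"
        using deriv N[OF e'(1) d[OF that] y'(1)] K(1) by auto
      fix t' assume t': "e' < t'" "t' < \<tau>" "{e'<..<t'} \<inter> E = {}"
      have e'lt: "e' < \<tau>" using t' by linarith
      show "\<bar>u y t' - u y e'\<bar> \<le> K * (t' - e')"
      proof (rule order_trans)
        have *: "\<bar>u y \<theta> - u y e'\<bar> \<le> drift_bound R r N * (\<theta> - e')" if "e' < \<theta>" "\<theta> < t'" for \<theta>
          by (rule gap_estimate[OF r y'(2) _ _ that]) (use N[OF e'(1) d[OF e'lt]] t'(3) that in \<open>auto intro!: good_off\<close>)
        have u_left: "(u y \<longlongrightarrow> u y t') (at_left t')"
          by (rule tendsto_within_subset[of _ _ _ UNIV]) (use u_cont_t[of y] in \<open>auto simp: continuous_on_def\<close>)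
        have "((\<lambda>\<theta>. drift_bound R r N * (\<theta> - e') - \<bar>u y \<theta> - u y e'\<bar>) \<longlongrightarrow> drift_bound R r N * (t' - e') - \<bar>u y t' - u y e'\<bar>) (at_left t')"
          by (intro tendsto_intros u_left)
        moreover have "\<forall>\<^sub>F \<theta> in at_left t'. 0 \<le> drift_bound R r N * (\<theta> - e') - \<bar>u y \<theta> - u y e'\<bar>"
          using * t' by (simp add: eventually_at_left) (rule exI[of _ e'], simp)
        ultimately have "0 \<le> drift_bound R r N * (t' - e') - \<bar>u y t' - u y e'\<bar>" by (rule tendsto_lowerbound) simp
        then show "\<bar>u y t' - u y e'\<bar> \<le> drift_bound R r N * (t' - e')" by simp
        show "drift_bound R r N * (t' - e') \<le> K * (t' - e')" using K t' by (intro mult_right_mono) auto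
      qed
    qed (use e \<tau> in auto)
    have right: "\<exists>\<delta>>0. \<forall>\<tau>. e < \<tau> \<and> \<tau> < e + \<delta> \<longrightarrow> \<bar>(U \<epsilon> x \<tau> - U \<epsilon> x e) / (\<tau> - e) - G \<epsilon> x e\<bar> < k"
      if e: "dist e e0 < \<rho>" and "0 < k" for e k
    proof -
      have "((\<lambda>\<tau>. (U \<epsilon> x \<tau> - U \<epsilon> x e) / (\<tau> - e)) \<longlongrightarrow> G \<epsilon> x e) (at e within {e<..<e0 + \<rho>})"
      proof (cases "e \<in> E")
        case False
        then have "(U \<epsilon> x has_real_derivative G \<epsilon> x e) (at e)"
          using good_off[of e] \<epsilon> x by (auto simp: mollified_equation_at_def)
        then show ?thesis by (auto simp: has_field_derivative_iff intro: tendsto_within_subset)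
      next
        case True
        \<comment> \<open>The difference quotients of \<open>u\<close> are dominated by the constant \<open>K\<close>, but only to the right of \<open>e\<close>.\<close>
        have eqU: "(U \<epsilon> x \<tau> - U \<epsilon> x e) / (\<tau> - e)
            = (LINT y|lborel. mollifier y * ((u (x - \<epsilon> *\<^sub>R y) \<tau> - u (x - \<epsilon> *\<^sub>R y) e) / (\<tau> - e)))" for \<tau>
        proof -
          have i: "integrable lborel (\<lambda>y. mollifier y * u (x - \<epsilon> *\<^sub>R y) \<theta>)" for \<theta>
            by (rule moll_avg_integrable(1)[OF u_meas]) (use bdd in auto)
          have "(U \<epsilon> x \<tau> - U \<epsilon> x e) / (\<tau> - e)
            = (LINT y|lborel. (mollifier y * u (x - \<epsilon> *\<^sub>R y) \<tau> - mollifier y * u (x - \<epsilon> *\<^sub>R y) e) / (\<tau> - e))"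
            using i[of \<tau>] i[of e] by (simp add: U_def moll_avg_def)
          then show ?thesis by (simp add: right_diff_distrib)
        qed
        show ?thesis unfolding eqU unfolding G_def moll_avg_def
        proof (rule dominated_convergence_within)
          show "integrable lborel (\<lambda>y::real^'n. mollifier y * K)" by (intro integrable_mult_left mollifier_integrable)
          show "\<bar>mollifier y * ((u (x - \<epsilon> *\<^sub>R y) \<tau> - u (x - \<epsilon> *\<^sub>R y) e) / (\<tau> - e))\<bar> \<le> mollifier y * K"
            if "\<tau> \<in> {e<..<e0 + \<rho>}" for \<tau> and y :: "real^'n"
          proof (cases "norm y \<le> 1")
            case True
            have "\<bar>u (x - \<epsilon> *\<^sub>R y) \<tau> - u (x - \<epsilon> *\<^sub>R y) e\<bar> \<le> K * (\<tau> - e)"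
              by (rule grow) (use norm_shift_le[OF \<epsilon> True] \<open>e \<in> E\<close> e that in auto)
            then have "\<bar>(u (x - \<epsilon> *\<^sub>R y) \<tau> - u (x - \<epsilon> *\<^sub>R y) e) / (\<tau> - e)\<bar> \<le> K"
              using that by (simp add: divide_le_eq)
            then show ?thesis by (simp only: abs_mult abs_of_nonneg[OF mollifier_nonneg]) (rule mult_left_mono, simp_all)
          qed (simp add: mollifier_eq_0)
          show "((\<lambda>\<tau>. mollifier y * ((u (x - \<epsilon> *\<^sub>R y) \<tau> - u (x - \<epsilon> *\<^sub>R y) e) / (\<tau> - e))) \<longlongrightarrow>
             mollifier y * h (x - \<epsilon> *\<^sub>R y) e) (at e within {e<..<e0 + \<rho>})" for y
            using deriv[of "x - \<epsilon> *\<^sub>R y" e]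
            by (intro tendsto_intros) (auto simp: has_field_derivative_iff intro: tendsto_within_subset)
        qed measurable
      qed
      then have "\<forall>\<^sub>F \<tau> in at e within {e<..<e0 + \<rho>}. dist ((U \<epsilon> x \<tau> - U \<epsilon> x e) / (\<tau> - e)) (G \<epsilon> x e) < k"
        using \<open>0 < k\<close> by (rule tendstoD)
      then obtain d where d: "0 < d" "\<And>\<tau>. e < \<tau> \<Longrightarrow> \<tau> < e0 + \<rho> \<Longrightarrow> dist \<tau> e < d \<Longrightarrow>
          \<bar>(U \<epsilon> x \<tau> - U \<epsilon> x e) / (\<tau> - e) - G \<epsilon> x e\<bar> < k"
        by (auto simp: eventually_at dist_real_def)
      have "e < e0 + \<rho>" using e by (auto simp: dist_real_def)
      then show ?thesis using d by (intro exI[of _ "min d (e0 + \<rho> - e)"]) (auto simp: dist_real_def)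
    qed
    obtain \<alpha> \<beta> where \<alpha>\<beta>: "e0 - \<rho> < \<alpha>" "\<alpha> < t1" "t1 < \<beta>" "\<beta> < e0 + \<rho>"
      using t1 dense[of "e0 - \<rho>" t1] dense[of t1 "e0 + \<rho>"] by (auto simp: dist_real_def abs_less_iff)
    \<comment> \<open>A primitive of the continuous function \<open>G\<close>.\<close>
    define \<Gamma> where "\<Gamma> = (\<lambda>t. integral {\<alpha>..t} (G \<epsilon> x))"
    have d\<Gamma>: "(\<Gamma> has_real_derivative G \<epsilon> x t) (at t within {\<alpha>..\<beta>})" if "t \<in> {\<alpha>..\<beta>}" for t
      unfolding \<Gamma>_def using that
      by (intro integral_has_real_derivative continuous_on_subset[OF G_cont_t[OF \<epsilon>]]) auto
    have const: "U \<epsilon> x t - \<Gamma> t = U \<epsilon> x \<alpha> - \<Gamma> \<alpha>" if t: "t \<in> {\<alpha>..\<beta>}" for t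
    proof (rule zero_right_derivative_imp_const[where D = "\<lambda>t. U \<epsilon> x t - \<Gamma> t"])
      show "\<alpha> \<le> t" using t by simp
      have "continuous_on {\<alpha>..\<beta>} \<Gamma>" using d\<Gamma> by (intro DERIV_continuous_on)
      then have "continuous_on {\<alpha>..t} \<Gamma>" by (rule continuous_on_subset) (use t in auto)
      then show "continuous_on {\<alpha>..t} (\<lambda>t. U \<epsilon> x t - \<Gamma> t)"
        by (intro continuous_intros continuous_on_subset[OF U_cont_t]) auto
      fix e k assume e: "\<alpha> \<le> e" "e < t" and k: "0 < (k::real)"
      have "dist e e0 < \<rho>" using e t \<alpha>\<beta> by (auto simp: dist_real_def)
      then obtain \<delta>1 where \<delta>1: "0 < \<delta>1" "\<And>\<tau>. e < \<tau> \<Longrightarrow> \<tau> < e + \<delta>1 \<Longrightarrow> \<bar>(U \<epsilon> x \<tau> - U \<epsilon> x e) / (\<tau> - e) - G \<epsilon> x e\<bar> < k / 2"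
        using right[of e "k / 2"] k by auto
      have "((\<lambda>\<tau>. (\<Gamma> \<tau> - \<Gamma> e) / (\<tau> - e)) \<longlongrightarrow> G \<epsilon> x e) (at e within {\<alpha>..\<beta>})"
        using d\<Gamma>[of e] e t by (simp add: has_field_derivative_iff)
      then have "\<forall>\<^sub>F \<tau> in at e within {\<alpha>..\<beta>}. dist ((\<Gamma> \<tau> - \<Gamma> e) / (\<tau> - e)) (G \<epsilon> x e) < k / 2"
        using k by (intro tendstoD) auto
      then obtain \<delta>2 where \<delta>2: "0 < \<delta>2" "\<And>\<tau>. e < \<tau> \<Longrightarrow> \<tau> \<le> \<beta> \<Longrightarrow> dist \<tau> e < \<delta>2 \<Longrightarrow> \<bar>(\<Gamma> \<tau> - \<Gamma> e) / (\<tau> - e) - G \<epsilon> x e\<bar> < k / 2"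
        using e by (fastforce simp: eventually_at dist_real_def)
      have "\<bar>(U \<epsilon> x \<tau> - \<Gamma> \<tau>) - (U \<epsilon> x e - \<Gamma> e)\<bar> \<le> k * (\<tau> - e)"
        if \<tau>: "e < \<tau>" "\<tau> < e + min (min \<delta>1 \<delta>2) (\<beta> - e)" for \<tau>
      proof -
        have "\<bar>(U \<epsilon> x \<tau> - U \<epsilon> x e) / (\<tau> - e) - (\<Gamma> \<tau> - \<Gamma> e) / (\<tau> - e)\<bar> \<le> k"
        proof -
          have "\<tau> < e + \<delta>1" "\<tau> < e + \<delta>2" "\<tau> \<le> \<beta>" using \<tau> by linarith+
          then have "\<bar>(U \<epsilon> x \<tau> - U \<epsilon> x e) / (\<tau> - e) - G \<epsilon> x e\<bar> < k / 2"
            "\<bar>(\<Gamma> \<tau> - \<Gamma> e) / (\<tau> - e) - G \<epsilon> x e\<bar> < k / 2"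
            using \<delta>1(2)[of \<tau>] \<delta>2(2)[of \<tau>] \<tau>(1) by (simp_all add: dist_real_def)
          then show ?thesis by linarith
        qed
        then have "\<bar>((U \<epsilon> x \<tau> - U \<epsilon> x e) - (\<Gamma> \<tau> - \<Gamma> e)) / (\<tau> - e)\<bar> \<le> k" by (simp add: diff_divide_distrib)
        then show ?thesis using \<tau> by (simp add: abs_divide divide_le_eq algebra_simps)
      qed
      then show "\<exists>\<delta>>0. \<forall>\<tau>. e < \<tau> \<and> \<tau> < e + \<delta> \<longrightarrow> \<bar>(U \<epsilon> x \<tau> - \<Gamma> \<tau>) - (U \<epsilon> x e - \<Gamma> e)\<bar> \<le> k * (\<tau> - e)"
        using \<delta>1(1) \<delta>2(1) e t by (intro exI[of _ "min (min \<delta>1 \<delta>2) (\<beta> - e)"]) auto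
    qed
    have "(\<Gamma> has_real_derivative G \<epsilon> x t1) (at t1)"
      using d\<Gamma>[of t1] \<alpha>\<beta> by (simp add: at_within_Icc_at)
    then have "((\<lambda>t. \<Gamma> t + (U \<epsilon> x \<alpha> - \<Gamma> \<alpha>)) has_real_derivative G \<epsilon> x t1) (at t1)"
      by (auto intro!: derivative_eq_intros)
    then show "(U \<epsilon> x has_real_derivative G \<epsilon> x t1) (at t1)"
    proof (rule has_field_derivative_transform_within_open[where S = "{\<alpha><..<\<beta>}"])
      show "\<Gamma> t + (U \<epsilon> x \<alpha> - \<Gamma> \<alpha>) = U \<epsilon> x t" if "t \<in> {\<alpha><..<\<beta>}" for t
        using const[of t] that by simp
    qed (use \<alpha>\<beta> in auto)
  qed
  then have "ball e0 \<rho> \<subseteq> {t. mollified_equation_at R t}" by (auto simp: dist_commute)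
  then have "e0 \<in> interior {t. mollified_equation_at R t}" using \<rho> by (auto simp: mem_interior)
  then show False using e0 by (simp add: E_def)
qed

text \<open>Every interval after \<open>a\<close> now qualifies for the gap estimate. The constant depends on \<open>a\<close>, through
the size of \<open>h\<close> at that time.\<close>

theorem right_lipschitz_in_time:
  "\<exists>C\<ge>0. \<forall>x t. norm x \<le> R \<longrightarrow> a \<le> t \<longrightarrow> \<bar>u x t - u x a\<bar> \<le> C * (t - a)"
proof -
  obtain N where N: "\<And>x. norm x \<le> R + 2 \<Longrightarrow> \<bar>h x a\<bar> \<le> N" using h_locally_bounded[of "R + 2" a] by blast
  have "\<bar>u x t - u x a\<bar> \<le> \<bar>drift_bound (R + 2) 1 N\<bar> * (t - a)" if x: "norm x \<le> R" and t: "a \<le> t" for x t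
  proof (cases "t = a")
    case False
    have "\<bar>u x t - u x a\<bar> \<le> drift_bound (R + 2) 1 N * (t - a)"
      by (rule gap_estimate[where b = "t + 1"]) (use x t False N mollified_equation_everywhere in auto)
    also have "\<dots> \<le> \<bar>drift_bound (R + 2) 1 N\<bar> * (t - a)" using t by (intro mult_right_mono) auto
    finally show ?thesis .
  qed simp
  then show ?thesis by (intro exI[of _ "\<bar>drift_bound (R + 2) 1 N\<bar>"]) auto
qed

end

section \<open>Reflections and antisymmetric functions\<close>

definition plane_refl :: "'n::finite \<Rightarrow> real \<Rightarrow> real ^ 'n \<Rightarrow> real ^ 'n" where
  "plane_refl i \<mu> y = y + (2 * (\<mu> - y $ i)) *\<^sub>R axis i 1"

lemma plane_refl_nth [simp]: "plane_refl i \<mu> y $ i = 2 * \<mu> - y $ i"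
  by (simp add: plane_refl_def axis_def)

lemma plane_refl_involution [simp]: "plane_refl i \<mu> (plane_refl i \<mu> y) = y"
  by (simp add: plane_refl_def vec_eq_iff axis_def)

lemma plane_refl_continuous [continuous_intros]:
  "continuous_on A f \<Longrightarrow> continuous_on A (\<lambda>x. plane_refl i \<mu> (f x))"
  unfolding plane_refl_def by (intro continuous_intros)

lemma plane_refl_measurable [measurable]: "plane_refl i \<mu> \<in> borel_measurable borel"
  by (intro borel_measurable_continuous_onI continuous_intros)

lemma plane_refl_eq_self: "y $ i = \<mu> \<Longrightarrow> plane_refl i \<mu> y = y"
  by (simp add: plane_refl_def)

text \<open>The excess is nonnegative when both points lie on the same side of the plane; this orders the
two kernel values in the pairing argument below.\<close>

lemma norm_plane_refl_diff:
  fixes x y :: "real ^ 'n"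
  shows
  "(norm (plane_refl i \<mu> y - x))\<^sup>2 = (norm (y - x))\<^sup>2 + 4 * (\<mu> - y $ i) * (\<mu> - x $ i)"
proof -
  have ax: "axis i (1::real) \<bullet> (axis i 1 :: real^'n) = 1" by (simp add: inner_axis_axis)
  have in1: "v \<bullet> (axis i 1 :: real^'n) = v $ i" for v by (simp add: inner_axis)
  have "plane_refl i \<mu> y - x = (y - x) + (2 * (\<mu> - y $ i)) *\<^sub>R axis i 1" by (simp add: plane_refl_def)
  then have "(norm (plane_refl i \<mu> y - x))\<^sup>2 = (norm (y - x))\<^sup>2 + 2 * (2 * (\<mu> - y $ i)) * ((y - x) $ i) + (2 * (\<mu> - y $ i))\<^sup>2"
    by (simp only: power2_norm_eq_inner inner_add_left inner_add_right inner_scaleR_left inner_scaleR_right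
        in1 ax inner_commute[of "axis i 1"]) (simp add: power2_eq_square algebra_simps)
  then show ?thesis by (simp add: power2_eq_square algebra_simps)
qed

lemma norm_le_plane_refl:
  assumes "y $ i \<le> \<mu>" "x $ i \<le> \<mu>"
  shows "norm (y - x) \<le> norm (plane_refl i \<mu> y - x)"
proof -
  have "0 \<le> 4 * (\<mu> - y $ i) * (\<mu> - x $ i)" using assms by simp
  then have "(norm (y - x))\<^sup>2 \<le> (norm (plane_refl i \<mu> y - x))\<^sup>2" unfolding norm_plane_refl_diff by linarith
  then show ?thesis by (rule power2_le_imp_le) simp
qed

lemma norm_plane_refl_0: "norm (plane_refl i 0 z) = norm z"
proof -
  have "(norm (plane_refl i 0 z))\<^sup>2 = (norm z)\<^sup>2" using norm_plane_refl_diff[of i 0 z 0] by simp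
  then show ?thesis by (simp add: power2_eq_iff_nonneg)
qed

text \<open>A reflection in a coordinate hyperplane is a diagonal affine map with entries \<open>1\<close> and \<open>- 1\<close>.\<close>

lemma lborel_integral_plane_refl:
  fixes f :: "real ^ 'n \<Rightarrow> real"
  assumes [measurable]: "f \<in> borel_measurable borel"
  shows "(LINT y|lborel. f (plane_refl i \<mu> y)) = integral\<^sup>L lborel f"
    and "integrable lborel (\<lambda>y. f (plane_refl i \<mu> y)) \<longleftrightarrow> integrable lborel f"
proof -
  define c where "c = (\<lambda>j::real^'n. if j = axis i 1 then - 1 else (1::real))"
  have ax: "axis i (1::real) \<in> (Basis :: (real^'n) set)" by (simp add: axis_in_Basis_iff)
  have T: "(2 * \<mu>) *\<^sub>R axis i 1 + (\<Sum>j\<in>Basis. (c j * (y \<bullet> j)) *\<^sub>R j) = plane_refl i \<mu> y" for y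
  proof -
    have "(\<Sum>j\<in>Basis. (c j * (y \<bullet> j)) *\<^sub>R j) = (\<Sum>j\<in>Basis. (y \<bullet> j) *\<^sub>R j - (if j = axis i 1 then (2 * (y \<bullet> j)) *\<^sub>R j else 0))"
      by (intro sum.cong) (auto simp: c_def scaleR_left_distrib[symmetric] algebra_simps)
    also have "\<dots> = y - (2 * (y $ i)) *\<^sub>R axis i 1"
      by (simp add: sum_subtractf euclidean_representation ax inner_axis)
    finally show ?thesis by (simp add: plane_refl_def algebra_simps)
  qed
  have "(\<Prod>j\<in>Basis. \<bar>c j\<bar>) = 1" by (intro prod.neutral) (auto simp: c_def)
  then have eq: "lborel = distr lborel borel (plane_refl i \<mu> :: real^'n \<Rightarrow> _)"
    using lborel_affine_euclidean[where c = c and t = "(2 * \<mu>) *\<^sub>R axis i 1"]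
    unfolding T by (auto simp: c_def density_1)
  show "(LINT y|lborel. f (plane_refl i \<mu> y)) = integral\<^sup>L lborel f"
    by (subst (2) eq) (simp add: integral_distr)
  show "integrable lborel (\<lambda>y. f (plane_refl i \<mu> y)) \<longleftrightarrow> integrable lborel f"
    by (subst (2) eq) (simp add: integrable_distr_eq)
qed

lemma nonlocal_plane_refl:
  fixes v :: "real ^ 'n \<Rightarrow> real"
  assumes [measurable]: "v \<in> borel_measurable borel" and at: "nonlocal_at s v (plane_refl i \<mu> x)"
  shows "nonlocal_at s (\<lambda>y. v (plane_refl i \<mu> y)) x"
    and "nonlocal_op s (\<lambda>y. v (plane_refl i \<mu> y)) x = nonlocal_op s v (plane_refl i \<mu> x)"
proof -
  let ?g = "\<lambda>z. second_diff v (plane_refl i \<mu> x) z * frac_kernel s z"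
  have sh: "plane_refl i \<mu> (x + z) = plane_refl i \<mu> x + plane_refl i 0 z" for z
    by (simp add: plane_refl_def vec_eq_iff axis_def)
  have shm: "plane_refl i \<mu> (x - z) = plane_refl i \<mu> x - plane_refl i 0 z" for z
    by (simp add: plane_refl_def vec_eq_iff axis_def)
  have eq: "second_diff (\<lambda>y. v (plane_refl i \<mu> y)) x z * frac_kernel s z = ?g (plane_refl i 0 z)" for z
    by (simp add: second_diff_def sh shm frac_kernel_def norm_plane_refl_0)
  have m: "?g \<in> borel_measurable borel" by measurable
  show "nonlocal_at s (\<lambda>y. v (plane_refl i \<mu> y)) x"
    unfolding nonlocal_at_def eq lborel_integral_plane_refl(2)[OF m] using at by (simp add: nonlocal_at_def)
  show "nonlocal_op s (\<lambda>y. v (plane_refl i \<mu> y)) x = nonlocal_op s v (plane_refl i \<mu> x)"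
    unfolding nonlocal_op_def eq by (rule lborel_integral_plane_refl(1)[OF m])
qed

text \<open>Heuristically the operator at \<open>x\<close> is \<open>- 2\<close> times the integral of \<open>G y * K (y - x)\<close>. Pairing \<open>y\<close>
with its mirror image leaves \<open>G y\<close> times a difference of kernel values that is nonnegative on the left.
To keep all integrals absolutely convergent, the kernel is first lowered, on the largest
ball around \<open>x\<close> inside the half space, to its value at the mirror image; there \<open>G \<ge> 0\<close>, so this only
decreases the integral, and what remains is bounded near \<open>x\<close>.\<close>

lemma nonlocal_op_antisym_nonpos:
  fixes G :: "real ^ 'n \<Rightarrow> real"
  assumes s: "0 < s" "s < 1" and [measurable]: "G \<in> borel_measurable borel" and B: "\<And>y. \<bar>G y\<bar> \<le> B"
    and anti: "\<And>y. G (plane_refl i \<mu> y) = - G y" and pos: "\<And>y. y $ i < \<mu> \<Longrightarrow> 0 \<le> G y"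
    and x: "x $ i < \<mu>" "G x = 0" and at: "nonlocal_at s G x"
  shows "nonlocal_op s G x \<le> 0"
proof -
  let ?R = "plane_refl i \<mu>" and ?K = "frac_kernel s :: real^'n \<Rightarrow> real"
  define d where "d = \<mu> - x $ i"
  have d: "0 < d" using x by (simp add: d_def)
  define k0 where "k0 = (\<lambda>y. indicator (- ball 0 d) (y - x) * ?K (y - x))"
  have [measurable]: "k0 \<in> borel_measurable borel" unfolding k0_def by measurable
  have k0_nonneg: "0 \<le> k0 y" for y by (simp add: k0_def)
  have ik0: "integrable lborel k0"
    using lborel_integral_translation(2)[of "\<lambda>z. indicator (- ball 0 d) z * ?K z" "- x"]
      integrable_kernel_outside_ball[OF s d] by (simp add: k0_def)
  \<comment> \<open>The lowered kernel: \<open>K (y - x)\<close> outside the ball and \<open>K\<close> at the mirror image of \<open>y\<close> inside.\<close>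
  define k where "k = (\<lambda>y. indicator (ball x d) y * k0 (?R y) + k0 y)"
  have [measurable]: "ball x d \<in> sets borel" by simp
  have [measurable]: "k \<in> borel_measurable borel" unfolding k_def by measurable
  have ball_left: "y $ i < \<mu>" if "y \<in> ball x d" for y
    using that component_le_norm_cart[of "y - x" i] by (simp add: d_def dist_norm norm_minus_commute)
  have R_out: "?R y \<notin> ball x d" if "y $ i \<le> \<mu>" for y
    using ball_left[of "?R y"] that by auto
  have k_in: "k y = ?K (?R y - x)" if "y \<in> ball x d" for y
    using that R_out[of y] ball_left[of y]
    by (auto simp: k_def k0_def indicator_def dist_norm norm_minus_commute)
  have k_out: "k y = ?K (y - x)" if "y \<notin> ball x d" for y
    using that by (auto simp: k_def k0_def indicator_def dist_norm norm_minus_commute)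
  have ik: "integrable lborel k"
  proof -
    have 1: "integrable lborel (\<lambda>y. k0 (?R y))" using ik0 lborel_integral_plane_refl(2)[of k0] by simp
    have "integrable lborel (\<lambda>y. indicator (ball x d) y * k0 (?R y))"
      by (rule Bochner_Integration.integrable_bound[OF 1]) (auto simp: indicator_def k0_nonneg)
    then show ?thesis unfolding k_def using ik0 by (rule Bochner_Integration.integrable_add)
  qed
  have iGk: "integrable lborel (\<lambda>y. G y * k y)"
  proof (rule Bochner_Integration.integrable_bound[OF integrable_mult_right[OF ik, of B]])
    show "AE y in lborel. norm (G y * k y) \<le> norm (B * k y)"
      using B by (intro AE_I2) (auto simp: abs_mult intro!: mult_right_mono order_trans[OF B abs_ge_self])
  qed measurable
  have k_sym: "k (?R y) \<le> k y" if "y $ i \<le> \<mu>" for y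
  proof -
    have kR: "k (?R y) = ?K (?R y - x)" by (rule k_out[OF R_out[OF that]])
    show ?thesis
    proof (cases "y \<in> ball x d")
      case True then show ?thesis by (simp add: kR k_in)
    next
      case False
      then have "0 < norm (y - x)" using d by auto
      then show ?thesis unfolding kR k_out[OF False]
        using s norm_le_plane_refl[OF that, of x] x by (intro frac_kernel_antimono) auto
    qed
  qed
  have point: "0 \<le> G y * (k y - k (?R y))" for y
  proof -
    consider "y $ i < \<mu>" | "y $ i = \<mu>" | "\<mu> < y $ i" by linarith
    then show ?thesis
    proof cases
      case 1 then show ?thesis using pos[of y] k_sym[of y] by simp
    next
      case 2 then show ?thesis by (simp add: plane_refl_eq_self)
    next
      case 3
      then have "G y \<le> 0" using pos[of "?R y"] anti[of y] by simp
      moreover have "k y \<le> k (?R y)" using k_sym[of "?R y"] 3 by simp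
      ultimately show ?thesis by (simp add: mult_nonpos_nonpos)
    qed
  qed
  have Gk: "0 \<le> (LINT y|lborel. G y * k y)"
  proof -
    have refl: "(LINT y|lborel. - (G y * k (?R y))) = (LINT y|lborel. G y * k y)"
      using lborel_integral_plane_refl(1)[of "\<lambda>y. G y * k y" i \<mu>] by (simp add: anti)
    have ir: "integrable lborel (\<lambda>y. - (G y * k (?R y)))"
      using iGk lborel_integral_plane_refl(2)[of "\<lambda>y. G y * k y" i \<mu>] by (simp add: anti)
    have "0 \<le> (LINT y|lborel. G y * k y + - (G y * k (?R y)))"
      by (intro Bochner_Integration.integral_nonneg) (use point in \<open>simp add: right_diff_distrib\<close>)
    also have "\<dots> = 2 * (LINT y|lborel. G y * k y)"
      using iGk ir refl by simp
    finally show ?thesis by simp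
  qed
  have le: "G y * k y \<le> G y * ?K (y - x)" for y
  proof (cases "y \<in> ball x d")
    case True
    show ?thesis
    proof (cases "y = x")
      case False
      have "k y \<le> ?K (y - x)" unfolding k_in[OF True]
        using s False norm_le_plane_refl[of y i \<mu> x] ball_left[OF True] x by (intro frac_kernel_antimono) auto
      then show ?thesis using pos[OF ball_left[OF True]] by (intro mult_left_mono)
    qed (simp add: x)
  qed (simp add: k_out)
  have i1: "integrable lborel (\<lambda>z. G (x + z) * k (x + z))"
    using lborel_integral_translation(2)[of "\<lambda>y. G y * k y" x] iGk by simp
  have i2: "integrable lborel (\<lambda>z. G (x - z) * k (x - z))"
    using lborel_integral_uminus(2)[of "\<lambda>z. G (x + z) * k (x + z)"] i1 by simp
  have e1: "(LINT z|lborel. G (x + z) * k (x + z)) = (LINT y|lborel. G y * k y)"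
    using lborel_integral_translation(1)[of "\<lambda>y. G y * k y" x] by simp
  have e2: "(LINT z|lborel. G (x - z) * k (x - z)) = (LINT y|lborel. G y * k y)"
    using lborel_integral_uminus(1)[of "\<lambda>z. G (x + z) * k (x + z)"] e1 by simp
  have "nonlocal_op s G x \<le> (LINT z|lborel. - (G (x + z) * k (x + z) + G (x - z) * k (x - z)))"
    unfolding nonlocal_op_def
  proof (rule integral_mono)
    show "second_diff G x z * ?K z \<le> - (G (x + z) * k (x + z) + G (x - z) * k (x - z))" for z
      using le[of "x + z"] le[of "x - z"] by (simp add: second_diff_def x algebra_simps)
  qed (use at i1 i2 in \<open>auto simp: nonlocal_at_def\<close>)
  also have "\<dots> = - 2 * (LINT y|lborel. G y * k y)" using i1 i2 e1 e2 by simp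
  finally show ?thesis using Gk by simp
qed

definition half_space_const :: "'n::finite itself \<Rightarrow> real \<Rightarrow> real" where
  "half_space_const _ s = unit_ball_vol (real CARD('n)) * 3 powr (- (real CARD('n) + 2 * s))"

lemma half_space_const_pos: "0 < half_space_const TYPE('n::finite) s"
  by (simp add: half_space_const_def)

text \<open>Seen from distance \<open>d\<close>, the half space contains a ball of radius \<open>d\<close> within distance \<open>3 * d\<close>.\<close>

lemma half_space_kernel:
  assumes s: "0 < s" "s < 1" and d: "0 < d"
  shows "integrable lborel (\<lambda>z::real^'n. indicator {z. d < z $ i} z * frac_kernel s z)"
    and "half_space_const TYPE('n) s * d powr (- 2 * s) \<le> (LINT z::real^'n|lborel. indicator {z. d < z $ i} z * frac_kernel s z)"
proof -
  let ?K = "frac_kernel s :: real^'n \<Rightarrow> real" and ?P = "{z::real^'n. d < z $ i}"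
  have [measurable]: "?P \<in> sets borel" by measurable
  have sub: "?P \<subseteq> - ball 0 d"
  proof
    fix z :: "real^'n" assume "z \<in> ?P"
    then show "z \<in> - ball 0 d" using component_le_norm_cart[of z i] by auto
  qed
  show i: "integrable lborel (\<lambda>z. indicator ?P z * ?K z)"
  proof (rule Bochner_Integration.integrable_bound[OF integrable_kernel_outside_ball[OF s d]])
    show "AE z in lborel. norm (indicator ?P z * ?K z) \<le> norm (indicator (- ball 0 d) z * ?K z)"
      using sub by (intro AE_I2) (auto simp: indicator_def)
  qed measurable
  \<comment> \<open>The centre of the ball of radius \<open>d\<close> that touches the plane from the other side.\<close>
  define a :: "real^'n" where "a = (2 * d) *\<^sub>R axis i 1"
  have low: "indicator (ball a d) z * (3 * d) powr (- (real CARD('n) + 2 * s)) \<le> indicator ?P z * ?K z" for z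
  proof (cases "z \<in> ball a d")
    case True
    have na: "norm (z - a) < d" using True by (simp add: dist_norm norm_minus_commute)
    have "\<bar>(z - a) $ i\<bar> < d" using component_le_norm_cart[of "z - a" i] na by linarith
    then have P: "z \<in> ?P" by (simp add: a_def axis_def)
    have "norm z \<le> norm a + norm (z - a)" using norm_triangle_ineq[of a "z - a"] by simp
    then have n3: "norm z \<le> 3 * d" using na d by (simp add: a_def)
    have n0: "0 < norm z" using sub P d by auto
    have "norm z powr (real CARD('n) + 2 * s) \<le> (3 * d) powr (real CARD('n) + 2 * s)"
      using n3 s by (intro powr_mono2) auto
    then have "(3 * d) powr (- (real CARD('n) + 2 * s)) \<le> ?K z"
      using n0 d unfolding frac_kernel_def powr_minus_divide
      by (intro divide_left_mono) auto
    then show ?thesis using True P by simp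
  qed simp
  have "half_space_const TYPE('n) s * d powr (- 2 * s) = (LINT z|lborel. indicator (ball a d) z * (3 * d) powr (- (real CARD('n) + 2 * s)))"
  proof -
    have "measure lborel (ball a d) = unit_ball_vol (real CARD('n)) * d powr real CARD('n)"
      using content_ball[of d a] d by (simp add: powr_realpow)
    moreover have "d powr real CARD('n) * (3 * d) powr (- (real CARD('n) + 2 * s)) = 3 powr (- (real CARD('n) + 2 * s)) * d powr (- 2 * s)"
    proof -
      have "(3 * d) powr (- (real CARD('n) + 2 * s)) = 3 powr (- (real CARD('n) + 2 * s)) * d powr (- (real CARD('n) + 2 * s))"
        using d by (simp add: powr_mult)
      moreover have "d powr real CARD('n) * d powr (- (real CARD('n) + 2 * s)) = d powr (- 2 * s)"
        by (simp only: powr_add[symmetric]) simp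
      ultimately show ?thesis by (simp add: mult_ac)
    qed
    ultimately show ?thesis by (simp add: half_space_const_def mult_ac)
  qed
  also have "\<dots> \<le> (LINT z|lborel. indicator ?P z * ?K z)"
  proof (rule integral_mono[OF _ i low])
    have "integrable lborel (indicator (ball a d) :: _ \<Rightarrow> real)"
      using emeasure_bounded_finite[of "ball a d"] by (intro integrable_real_indicator) auto
    then show "integrable lborel (\<lambda>z. indicator (ball a d) z * (3 * d) powr (- (real CARD('n) + 2 * s)))"
      by (rule integrable_mult_left)
  qed
  finally show "half_space_const TYPE('n) s * d powr (- 2 * s) \<le> (LINT z::real^'n|lborel. indicator {z. d < z $ i} z * frac_kernel s z)" .
qed

text \<open>Follow the set where \<open>\<Phi>\<close> is at most \<open>\<Phi> x0 t0\<close> backwards from \<open>t0\<close>. If \<open>\<Phi>'\<close> were positive at all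
minimisers, this set could always be continued to slightly earlier times, and the one-sided Lipschitz
bound lets it pass to limits; so it would survive until \<open>t0 - T\<close>, where it is empty. Joint
continuity of \<open>\<Phi>\<close> is replaced by that one-sided bound.\<close>

lemma backward_minimum:
  fixes \<Phi> \<Phi>' :: "'a::metric_space \<Rightarrow> real \<Rightarrow> real"
  assumes S: "compact S" "x0 \<in> S" and "0 < T"
    and cont: "\<And>t. continuous_on S (\<lambda>y. \<Phi> y t)"
    and rc: "\<And>t. \<exists>C\<ge>0. \<forall>y\<in>S. \<forall>t'. t \<le> t' \<longrightarrow> t' \<le> t0 \<longrightarrow> \<Phi> y t - \<Phi> y t' \<le> C * (t' - t)"
    and der: "\<And>y t. y \<in> S \<Longrightarrow> (\<Phi> y has_real_derivative \<Phi>' y t) (at t)"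
    and start: "\<And>y. y \<in> S \<Longrightarrow> \<Phi> x0 t0 < \<Phi> y (t0 - T)"
  shows "\<exists>y\<in>S. \<exists>t. t0 - T \<le> t \<and> t \<le> t0 \<and> (\<forall>y'\<in>S. \<Phi> y t \<le> \<Phi> y' t) \<and> \<Phi> y t \<le> \<Phi> x0 t0 \<and> \<Phi>' y t \<le> 0"
proof (rule ccontr)
  assume neg: "\<not> ?thesis"
  have minimizer: "\<exists>y\<in>S. \<forall>y'\<in>S. \<Phi> y t \<le> \<Phi> y' t" for t
    using continuous_attains_inf[OF S(1) _ cont[of t]] S(2) by blast
  have "\<exists>y\<in>S. \<Phi> y (t0 - \<tau>) \<le> \<Phi> x0 t0" if "0 \<le> \<tau>" "\<tau> \<le> T" for \<tau>
    using that
  proof (induction rule: real_induction)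
    case start
    then show ?case using S(2) by auto
  next
    case (left \<tau>)
    obtain y where y: "y \<in> S" "\<And>y'. y' \<in> S \<Longrightarrow> \<Phi> y (t0 - \<tau>) \<le> \<Phi> y' (t0 - \<tau>)"
      using minimizer[of "t0 - \<tau>"] by blast
    obtain C where C: "0 \<le> C" "\<And>y t'. y \<in> S \<Longrightarrow> t0 - \<tau> \<le> t' \<Longrightarrow> t' \<le> t0 \<Longrightarrow> \<Phi> y (t0 - \<tau>) - \<Phi> y t' \<le> C * (t' - (t0 - \<tau>))"
      using rc[of "t0 - \<tau>"] by blast
    have step: "\<Phi> y (t0 - \<tau>) \<le> \<Phi> x0 t0 + C * (\<tau> - \<theta>)" if \<theta>: "0 \<le> \<theta>" "\<theta> < \<tau>" for \<theta>
    proof -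
      obtain y' where y': "y' \<in> S" "\<Phi> y' (t0 - \<theta>) \<le> \<Phi> x0 t0" using left.IH[OF \<theta>] by blast
      have "\<Phi> y' (t0 - \<tau>) - \<Phi> y' (t0 - \<theta>) \<le> C * (t0 - \<theta> - (t0 - \<tau>))"
        by (rule C(2)) (use y' \<theta> in auto)
      then show ?thesis using y(2)[OF y'(1)] y'(2) by (simp add: algebra_simps)
    qed
    have "((\<lambda>\<theta>. \<Phi> x0 t0 + C * (\<tau> - \<theta>)) \<longlongrightarrow> \<Phi> x0 t0 + C * (\<tau> - \<tau>)) (at_left \<tau>)"
      by (intro tendsto_intros)
    moreover have "\<forall>\<^sub>F \<theta> in at_left \<tau>. \<Phi> y (t0 - \<tau>) \<le> \<Phi> x0 t0 + C * (\<tau> - \<theta>)"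
      unfolding eventually_at_left[OF left.hyps(1)] using step left.hyps by (intro exI[of _ 0]) auto
    ultimately have "\<Phi> y (t0 - \<tau>) \<le> \<Phi> x0 t0 + C * (\<tau> - \<tau>)"
      by (rule tendsto_lowerbound) simp
    then show ?case using y(1) by auto
  next
    case (right \<tau>)
    obtain y where y: "y \<in> S" "\<And>y'. y' \<in> S \<Longrightarrow> \<Phi> y (t0 - \<tau>) \<le> \<Phi> y' (t0 - \<tau>)"
      using minimizer[of "t0 - \<tau>"] by blast
    obtain y1 where "y1 \<in> S" "\<Phi> y1 (t0 - \<tau>) \<le> \<Phi> x0 t0" using right.IH[of \<tau>] right.hyps by auto
    then have le: "\<Phi> y (t0 - \<tau>) \<le> \<Phi> x0 t0" using y(2) by force
    then have "0 < \<Phi>' y (t0 - \<tau>)" using neg y right.hyps by (force simp: not_le[symmetric])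
    then obtain d where d: "0 < d" "\<And>k. 0 < k \<Longrightarrow> k < d \<Longrightarrow> \<Phi> y (t0 - \<tau> - k) < \<Phi> y (t0 - \<tau>)"
      using DERIV_pos_inc_left[OF der[OF y(1)]] by blast
    have "\<Phi> y (t0 - \<theta>) \<le> \<Phi> x0 t0" if "\<tau> < \<theta>" "\<theta> < \<tau> + d" for \<theta>
      using d(2)[of "\<theta> - \<tau>"] that le by auto
    then show ?case using d(1) y(1) by blast
  qed
  from this[of T] show False using \<open>0 < T\<close> start by force
qed

section \<open>Negative minima of antisymmetric functions\<close>

text \<open>How close to the infimum, in relative terms, a starting point must be: the cost of penalties of
this relative size is then at most half of what antisymmetry gains.\<close>

definition depth_tolerance :: "'n::finite itself \<Rightarrow> real \<Rightarrow> real \<Rightarrow> real" where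
  "depth_tolerance N s c = min (1 / 10) (c * half_space_const N s / (4 * (2 + 160 * c * kernel_mass N s)))"

lemma depth_tolerance:
  assumes "0 < c"
  shows "0 < depth_tolerance TYPE('n::finite) s c" "depth_tolerance TYPE('n) s c \<le> 1 / 10"
    and "depth_tolerance TYPE('n) s c * (2 + 160 * c * kernel_mass TYPE('n) s) \<le> c * half_space_const TYPE('n) s / 4"
proof -
  have D: "0 < 2 + 160 * c * kernel_mass TYPE('n) s"
    using assms kernel_mass_nonneg[where 'n='n] by (intro add_pos_nonneg) auto
  show "0 < depth_tolerance TYPE('n::finite) s c"
    unfolding depth_tolerance_def using assms D half_space_const_pos[where 'n='n] by simp
  show "depth_tolerance TYPE('n) s c \<le> 1 / 10" unfolding depth_tolerance_def by (rule min.cobounded1)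
  have "depth_tolerance TYPE('n) s c \<le> c * half_space_const TYPE('n) s / (4 * (2 + 160 * c * kernel_mass TYPE('n) s))"
    by (simp add: depth_tolerance_def)
  then have "depth_tolerance TYPE('n) s c \<le> (c * half_space_const TYPE('n) s / 4) / (2 + 160 * c * kernel_mass TYPE('n) s)" by simp
  then show "depth_tolerance TYPE('n) s c * (2 + 160 * c * kernel_mass TYPE('n) s) \<le> c * half_space_const TYPE('n) s / 4"
    unfolding pos_le_divide_eq[OF D] .
qed

text \<open>Subtract from \<open>W\<close> the antisymmetric function \<open>A\<close> that equals the perturbed minimum on the left. The
difference vanishes at \<open>x\<close> and is nonnegative on the left, so the preceding sign lemma applies, and it
remains to estimate \<open>A\<close>: the bump and the defect \<open>e\<close> cost the first two terms, while on the right half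
space \<open>A\<close> exceeds \<open>W x\<close> by at least \<open>2 * (- W x - \<theta>)\<close> apart from the bump, which gives the third,
negative term.\<close>

lemma nonlocal_op_at_perturbed_min:
  fixes W :: "real ^ 'n \<Rightarrow> real"
  assumes s: "0 < s" "s < 1" and W_cont: "continuous_on UNIV W" and B: "\<And>y. \<bar>W y\<bar> \<le> B"
    and anti: "\<And>y. W (plane_refl i \<mu> y) = - W y" and at: "nonlocal_at s W x"
    and \<theta>: "0 \<le> \<theta>" "0 < r" and e: "0 \<le> e" and \<eta>: "0 < \<eta>"
    and x: "x $ i < \<mu>" "\<mu> - x $ i \<le> \<eta> / 2" and neg: "W x + \<theta> \<le> 0"
    and min: "\<And>y. y $ i < \<mu> \<Longrightarrow>
      W x + \<theta> * scaled_bump r a x \<le> W y + \<theta> * scaled_bump r a y + (if \<eta> \<le> \<mu> - y $ i then e else 0)"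
  shows "nonlocal_op s W x \<le> 10 * \<theta> * kernel_mass TYPE('n) s * r powr (- 2 * s)
    + 2 * e * kernel_mass TYPE('n) s * (\<eta> / 2) powr (- 2 * s)
    + 4 * (W x + \<theta>) * half_space_const TYPE('n) s * (\<mu> - x $ i) powr (- 2 * s)"
proof -
  let ?R = "plane_refl i \<mu>" and ?K = "frac_kernel s :: real^'n \<Rightarrow> real" and ?Z = "scaled_bump r a"
  have [measurable]: "W \<in> borel_measurable borel" using W_cont by (rule borel_measurable_continuous_onI)
  define q where "q = (\<lambda>y::real^'n. \<theta> * (?Z y - ?Z x) + (if \<eta> \<le> \<mu> - y $ i then e else 0))"
  \<comment> \<open>Antisymmetry forces the value \<open>0\<close> on the plane.\<close>
  define A where "A = (\<lambda>y. if y $ i < \<mu> then W x - q y else if y $ i = \<mu> then 0 else - (W x - q (?R y)))"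
  define d where "d = \<mu> - x $ i"
  have d: "0 < d" "d \<le> \<eta> / 2" using x by (simp_all add: d_def)
  have qm [measurable]: "q \<in> borel_measurable borel" unfolding q_def by measurable
  have Am [measurable]: "A \<in> borel_measurable borel" unfolding A_def by measurable
  have Zd: "\<bar>\<theta> * (?Z y - ?Z x)\<bar> \<le> \<theta>" for y
  proof -
    have "\<bar>?Z y - ?Z x\<bar> \<le> 1"
      using scaled_bump_simps(1,2)[of r a y] scaled_bump_simps(1,2)[of r a x] by linarith
    then show ?thesis using \<theta> by (simp add: abs_mult mult_left_le)
  qed
  have qb: "\<bar>q y\<bar> \<le> \<theta> + e" for y using Zd[of y] e unfolding q_def by (auto split: if_splits)
  have q_low: "- \<theta> \<le> q y" for y using Zd[of y] e unfolding q_def by (auto split: if_splits)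
  have Ab: "\<bar>A y\<bar> \<le> \<bar>W x\<bar> + \<theta> + e" for y
    using qb[of y] qb[of "?R y"] \<theta> e unfolding A_def by auto
  have Ax: "A x = W x" using x \<eta> by (auto simp: A_def q_def)
  have A_anti: "A (?R y) = - A y" for y by (auto simp: A_def)
  \<comment> \<open>Near \<open>x\<close> the function \<open>A\<close> is a constant minus a multiple of the bump.\<close>
  have atA: "nonlocal_at s A x"
  proof -
    have "\<bar>second_diff A x z\<bar> \<le> (4 * (\<bar>W x\<bar> + \<theta> + e) + (10 * \<theta> / r\<^sup>2) * d\<^sup>2) * trunc_quad d z" for z
    proof (rule second_diff_trunc_quad[OF d(1) Ab])
      fix z :: "real^'n" assume z: "norm z < d"
      have zi: "\<bar>z $ i\<bar> < d" using component_le_norm_cart[of z i] z by linarith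
      have near: "A (x + w) = W x - \<theta> * (?Z (x + w) - ?Z x)" if "\<bar>w $ i\<bar> < d" for w
        using that d by (auto simp: A_def q_def d_def)
      have "second_diff A x z = - \<theta> * second_diff ?Z x z"
        using near[of z] near[of "- z"] zi by (simp add: second_diff_def Ax algebra_simps)
      also have "\<bar>\<dots>\<bar> \<le> \<theta> * (10 * trunc_quad r z)"
        using second_diff_scaled_bump[OF \<theta>(2), of a x z] \<theta> by (simp add: abs_mult mult_left_mono)
      also have "\<dots> \<le> \<theta> * (10 * (norm z / r)\<^sup>2)"
        using \<theta> by (intro mult_left_mono) (auto simp: trunc_quad_def)
      finally show "\<bar>second_diff A x z\<bar> \<le> 10 * \<theta> / r\<^sup>2 * (norm z)\<^sup>2"
        by (simp add: power_divide mult_ac)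
    qed (use \<theta> in auto)
    then show ?thesis by (rule nonlocal_trunc_quad_bound(1)[OF s d(1) Am])
  qed
  define G where "G = (\<lambda>y. W y - A y)"
  have "nonlocal_op s G x \<le> 0"
  proof (rule nonlocal_op_antisym_nonpos[OF s])
    show "\<bar>G y\<bar> \<le> B + (\<bar>W x\<bar> + \<theta> + e)" for y using B[of y] Ab[of y] unfolding G_def by linarith
    show "0 \<le> G y" if "y $ i < \<mu>" for y
      using min[OF that] that by (simp add: G_def A_def q_def algebra_simps split: if_splits)
    show "nonlocal_at s G x" unfolding G_def by (rule nonlocal_diff(1)[OF at atA])
  qed (use x in \<open>auto simp: G_def anti A_anti Ax\<close>)
  then have WA: "nonlocal_op s W x \<le> nonlocal_op s A x"
    unfolding G_def nonlocal_diff(2)[OF at atA] by simp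
  \<comment> \<open>The displacements that lead across the plane; on the plane itself \<open>A\<close> vanishes.\<close>
  define P where "P = {z::real^'n. d < z $ i}"
  have [measurable]: "P \<in> sets borel" unfolding P_def by measurable
  have low: "W x - \<theta> * (?Z (x + w) - ?Z x) - e * trunc_quad (\<eta> / 2) w + 2 * (- W x - \<theta>) * indicator P w \<le> A (x + w)" for w
  proof -
    consider "w $ i < d" | "w $ i = d" | "d < w $ i" by linarith
    then show ?thesis
    proof cases
      case 1
      have "(if \<eta> \<le> \<mu> - (x + w) $ i then e else 0) \<le> e * trunc_quad (\<eta> / 2) w"
      proof (cases "\<eta> \<le> \<mu> - (x + w) $ i")
        case True
        then have "\<eta> / 2 \<le> norm w" using component_le_norm_cart[of w i] d by (simp add: d_def)
        then show ?thesis using \<eta> e by (simp add: trunc_quad_eq_1)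
      qed (use e in simp)
      then show ?thesis using 1 by (simp add: A_def q_def P_def d_def)
    next
      case 2
      then have "A (x + w) = 0" by (simp add: A_def d_def)
      moreover have "0 \<le> e * trunc_quad (\<eta> / 2) w" using e by simp
      ultimately show ?thesis using 2 Zd[of "x + w"] neg by (simp add: P_def)
    next
      case 3
      then have "A (x + w) = - W x + q (?R (x + w))" by (simp add: A_def d_def)
      moreover have "0 \<le> e * trunc_quad (\<eta> / 2) w" using e by simp
      ultimately show ?thesis using 3 Zd[of "x + w"] q_low[of "?R (x + w)"] by (simp add: P_def)
    qed
  qed
  have iP: "integrable lborel (\<lambda>z. indicator P z * ?K z)"
    using half_space_kernel(1)[OF s d(1)] by (simp add: P_def)
  have iPm: "integrable lborel (\<lambda>z. indicator P (- z) * ?K z)"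
    using lborel_integral_uminus(2)[of "\<lambda>z. indicator P z * ?K z"] iP by simp
  have ePm: "(LINT z|lborel. indicator P (- z) * ?K z) = (LINT z|lborel. indicator P z * ?K z)"
    using lborel_integral_uminus(1)[of "\<lambda>z. indicator P z * ?K z"] by simp
  have hP: "half_space_const TYPE('n) s * d powr (- 2 * s) \<le> (LINT z|lborel. indicator P z * ?K z)"
    using half_space_kernel(2)[OF s d(1)] by (simp add: P_def)
  note bump = nonlocal_scaled_bump[OF s \<theta>(2), of a x]
  note tq = trunc_quad_kernel[OF s, of "\<eta> / 2", where 'n='n]
  let ?b = "\<lambda>z. - \<theta> * (second_diff ?Z x z * ?K z) + 2 * e * (trunc_quad (\<eta> / 2) z * ?K z)
      + 2 * (W x + \<theta>) * (indicator P z * ?K z + indicator P (- z) * ?K z)"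
  have tqm: "trunc_quad (\<eta> / 2) (- z) = trunc_quad (\<eta> / 2) z" for z :: "real^'n" by (simp add: trunc_quad_def)
  have "nonlocal_op s A x \<le> (LINT z|lborel. ?b z)"
    unfolding nonlocal_op_def
  proof (rule integral_mono)
    show "integrable lborel (\<lambda>z. second_diff A x z * ?K z)" using atA by (simp add: nonlocal_at_def)
    show "integrable lborel ?b"
      using bump(1) tq(1) iP iPm \<eta> unfolding nonlocal_at_def
      by (intro Bochner_Integration.integrable_add integrable_mult_right) auto
    show "second_diff A x z * ?K z \<le> ?b z" for z
    proof -
      have "second_diff A x z \<le> - \<theta> * second_diff ?Z x z + 2 * e * trunc_quad (\<eta> / 2) z
          + 2 * (W x + \<theta>) * (indicator P z + indicator P (- z))"
        using low[of z] low[of "- z"] by (simp add: second_diff_def Ax tqm algebra_simps)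
      from mult_right_mono[OF this, of "?K z"] show ?thesis by (simp add: algebra_simps)
    qed
  qed
  also have "\<dots> = - \<theta> * nonlocal_op s ?Z x + 2 * e * (kernel_mass TYPE('n) s * (\<eta> / 2) powr (- 2 * s))
      + 2 * (W x + \<theta>) * (2 * (LINT z|lborel. indicator P z * ?K z))"
  proof -
    have i1: "integrable lborel (\<lambda>z. - \<theta> * (second_diff ?Z x z * ?K z))"
      using bump(1) unfolding nonlocal_at_def by (rule integrable_mult_right)
    have i2: "integrable lborel (\<lambda>z::real^'n. 2 * e * (trunc_quad (\<eta> / 2) z * ?K z))"
      using tq(1) \<eta> by (intro integrable_mult_right) auto
    have i3: "integrable lborel (\<lambda>z. 2 * (W x + \<theta>) * (indicator P z * ?K z + indicator P (- z) * ?K z))"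
      using iP iPm by (intro integrable_mult_right Bochner_Integration.integrable_add)
    show ?thesis
      unfolding Bochner_Integration.integral_add[OF Bochner_Integration.integrable_add[OF i1 i2] i3]
        Bochner_Integration.integral_add[OF i1 i2] integral_mult_right_zero
        Bochner_Integration.integral_add[OF iP iPm] ePm
      using tq(2) \<eta> by (simp add: nonlocal_op_def)
  qed
  also have "\<dots> \<le> \<theta> * (10 * kernel_mass TYPE('n) s * r powr (- 2 * s)) + 2 * e * (kernel_mass TYPE('n) s * (\<eta> / 2) powr (- 2 * s))
      + 2 * (W x + \<theta>) * (2 * (half_space_const TYPE('n) s * d powr (- 2 * s)))"
  proof (intro add_mono order_refl)
    have "- nonlocal_op s ?Z x \<le> 10 * kernel_mass TYPE('n) s * r powr (- 2 * s)" using bump(2) by linarith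
    from mult_left_mono[OF this \<theta>(1)]
    show "- \<theta> * nonlocal_op s ?Z x \<le> \<theta> * (10 * kernel_mass TYPE('n) s * r powr (- 2 * s))" by simp
    show "2 * (W x + \<theta>) * (2 * (LINT z|lborel. indicator P z * ?K z)) \<le> 2 * (W x + \<theta>) * (2 * (half_space_const TYPE('n) s * d powr (- 2 * s)))"
      by (rule mult_left_mono_neg[OF mult_left_mono[OF hP]]) (use neg in auto)
  qed
  finally show ?thesis using WA by (simp add: d_def algebra_simps)
qed

text \<open>At a nearly deepest point at distance \<open>d0\<close> from the plane, localise in space at scale \<open>d0\<close> and
in time at scale \<open>d0 powr (2 * s)\<close>. All errors scale like \<open>m * d0 powr (- 2 * s)\<close>, as does the gain
from the mirror image, and the tolerance makes them smaller than it. The lower bound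
\<open>- m\<close> is only required up to distance \<open>\<eta>\<close>; a deficit \<open>e\<close> farther away enters at scale \<open>\<eta>\<close>.\<close>

lemma antisym_negative_minimum:
  fixes W W' :: "real ^ 'n \<Rightarrow> real \<Rightarrow> real"
  assumes s: "0 < s" "s < 1" and c: "0 < c"
    and cont: "\<And>t. continuous_on UNIV (\<lambda>y. W y t)" and B: "\<And>y t. \<bar>W y t\<bar> \<le> B"
    and rc: "\<And>R a. \<exists>C\<ge>0. \<forall>y t. norm y \<le> R \<longrightarrow> a \<le> t \<longrightarrow> \<bar>W y t - W y a\<bar> \<le> C * (t - a)"
    and der: "\<And>y t. (W y has_real_derivative W' y t) (at t)"
    and at: "\<And>y t. nonlocal_at s (\<lambda>y. W y t) y"
    and anti: "\<And>y t. W (plane_refl i \<mu> y) t = - W y t"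
    and m: "0 < m" and e: "0 \<le> e" and d0: "0 < d0" "4 * d0 \<le> \<eta>" and x0: "x0 $ i = \<mu> - d0"
    and near: "\<And>y t. \<mu> - \<eta> < y $ i \<Longrightarrow> y $ i < \<mu> \<Longrightarrow> - m \<le> W y t"
    and far: "\<And>y t. y $ i < \<mu> \<Longrightarrow> - m - e \<le> W y t"
    and W0: "W x0 t0 < - (1 - depth_tolerance TYPE('n) s c) * m"
  shows "\<exists>x t. \<bar>x $ i - x0 $ i\<bar> \<le> d0 / 2 \<and> - m \<le> W x t \<and> W x t \<le> - (m / 2) \<and>
    W' x t + c * nonlocal_op s (\<lambda>y. W y t) x
      \<le> 8 * c * kernel_mass TYPE('n) s * e * \<eta> powr (- 2 * s) - c * half_space_const TYPE('n) s / 4 * m * d0 powr (- 2 * s)"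
proof -
  let ?\<epsilon> = "depth_tolerance TYPE('n) s c" and ?\<kappa> = "kernel_mass TYPE('n) s" and ?h = "half_space_const TYPE('n) s"
  note \<epsilon> = depth_tolerance[OF c, where 'n='n and s=s]
  define r where "r = d0 / 2"
  define T where "T = d0 powr (2 * s)"
  \<comment> \<open>The penalties add at least \<open>2 * tolerance * m\<close> off the ball and at time \<open>t0 - T\<close>, more than the margin at \<open>(x0, t0)\<close>.\<close>
  define \<theta> where "\<theta> = 4 * ?\<epsilon> * m"
  define k where "k = 2 * ?\<epsilon> * m / T"
  have r: "0 < r" and T: "0 < T" using d0 by (simp_all add: r_def T_def)
  have \<theta>: "0 \<le> \<theta>" and k: "0 \<le> k" using \<epsilon> m T by (simp_all add: \<theta>_def k_def)
  let ?Z = "scaled_bump r x0"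
  define \<Phi> where "\<Phi> = (\<lambda>y t. W y t + \<theta> * ?Z y + k * (t0 - t))"
  have comp: "\<bar>y $ i - x0 $ i\<bar> \<le> r" if "y \<in> cball x0 r" for y
    using component_le_norm_cart[of "y - x0" i] that by (simp add: dist_norm norm_minus_commute)
  have W_near: "- m \<le> W y t" if "y \<in> cball x0 r" for y t
  proof (rule near)
    have "\<bar>y $ i - (\<mu> - d0)\<bar> \<le> d0 / 2" using comp[OF that] x0 by (simp add: r_def)
    then show "\<mu> - \<eta> < y $ i" "y $ i < \<mu>" using d0 by linarith+
  qed
  have "\<exists>y\<in>cball x0 r. \<exists>t. t0 - T \<le> t \<and> t \<le> t0 \<and> (\<forall>y'\<in>cball x0 r. \<Phi> y t \<le> \<Phi> y' t) \<and> \<Phi> y t \<le> \<Phi> x0 t0 \<and> W' y t - k \<le> 0"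
  proof (rule backward_minimum[where \<Phi>' = "\<lambda>y t. W' y t - k"])
    show "continuous_on (cball x0 r) (\<lambda>y. \<Phi> y t)" for t
      unfolding \<Phi>_def by (intro continuous_intros continuous_on_subset[OF cont]) auto
    show "(\<Phi> y has_real_derivative W' y t - k) (at t)" for y t
      unfolding \<Phi>_def by (auto intro!: derivative_eq_intros der)
    show "\<exists>C\<ge>0. \<forall>y\<in>cball x0 r. \<forall>t'. t \<le> t' \<longrightarrow> t' \<le> t0 \<longrightarrow> \<Phi> y t - \<Phi> y t' \<le> C * (t' - t)" for t
    proof -
      obtain C where C: "C \<ge> 0" "\<And>y t'. norm y \<le> norm x0 + r \<Longrightarrow> t \<le> t' \<Longrightarrow> \<bar>W y t' - W y t\<bar> \<le> C * (t' - t)"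
        using rc[of "norm x0 + r" t] by blast
      have "\<Phi> y t - \<Phi> y t' \<le> (C + k) * (t' - t)" if "y \<in> cball x0 r" "t \<le> t'" for y t'
      proof -
        have "norm y \<le> norm x0 + r" using that(1) norm_triangle_ineq[of x0 "y - x0"]
          by (simp add: dist_norm norm_minus_commute)
        then show ?thesis using C(2)[of y t'] that(2) by (simp add: \<Phi>_def algebra_simps)
      qed
      then show ?thesis using C(1) k by (intro exI[of _ "C + k"]) auto
    qed
    show "\<Phi> x0 t0 < \<Phi> y (t0 - T)" if "y \<in> cball x0 r" for y
    proof -
      have "k * T = 2 * ?\<epsilon> * m" using T by (simp add: k_def)
      moreover have "0 \<le> \<theta> * ?Z y" using \<theta> by simp
      moreover have "0 < ?\<epsilon> * m" using \<epsilon> m by simp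
      ultimately show ?thesis using W_near[OF that, of "t0 - T"] W0 by (simp add: \<Phi>_def algebra_simps)
    qed
  qed (use r T in auto)
  then obtain x t where x: "x \<in> cball x0 r" and t: "t0 - T \<le> t" "t \<le> t0"
    and min: "\<And>y'. y' \<in> cball x0 r \<Longrightarrow> \<Phi> x t \<le> \<Phi> y' t" and le: "\<Phi> x t \<le> \<Phi> x0 t0" and W't: "W' x t \<le> k"
    by auto
  have kt: "0 \<le> k * (t0 - t)" using k t by simp
  have val: "W x t + \<theta> * ?Z x + k * (t0 - t) \<le> - (1 - ?\<epsilon>) * m" using le W0 by (simp add: \<Phi>_def)
  have Wx: "W x t \<le> - (1 - ?\<epsilon>) * m"
  proof -
    have "0 \<le> \<theta> * ?Z x" using \<theta> by simp
    then show ?thesis using val kt by linarith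
  qed
  have \<epsilon>m: "?\<epsilon> * m \<le> m / 10" using \<epsilon>(2) m by simp
  have Wx\<theta>: "W x t + \<theta> \<le> - (m / 2)"
    using Wx \<epsilon>m by (simp add: \<theta>_def algebra_simps)
  have xi: "x $ i < \<mu>" "\<mu> - x $ i \<le> \<eta> / 2" "\<mu> - x $ i \<le> 3 / 2 * d0"
  proof -
    have "\<bar>x $ i - (\<mu> - d0)\<bar> \<le> d0 / 2" using comp[OF x] x0 by (simp add: r_def)
    then show "x $ i < \<mu>" "\<mu> - x $ i \<le> \<eta> / 2" "\<mu> - x $ i \<le> 3 / 2 * d0" using d0 by linarith+
  qed
  have minall: "W x t + \<theta> * ?Z x \<le> W y t + \<theta> * ?Z y + (if \<eta> \<le> \<mu> - y $ i then e else 0)" if y: "y $ i < \<mu>" for y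
  proof (cases "y \<in> cball x0 r")
    case True
    then show ?thesis using min[OF True] e by (simp add: \<Phi>_def)
  next
    case False
    then have "1 / 2 \<le> ?Z y" using r by (intro scaled_bump_ge_half) (auto simp: dist_commute)
    then have "\<theta> * (1 / 2) \<le> \<theta> * ?Z y" using \<theta> by (intro mult_left_mono) auto
    moreover have "- m \<le> W y t + (if \<eta> \<le> \<mu> - y $ i then e else 0)"
      using near[of y t] far[of y t] y by auto
    moreover have "0 < ?\<epsilon> * m" using \<epsilon> m by simp
    ultimately show ?thesis using val kt by (simp add: \<theta>_def algebra_simps)
  qed
  have \<eta>: "0 < \<eta>" using d0 by linarith
  have N: "nonlocal_op s (\<lambda>y. W y t) x \<le> 10 * \<theta> * ?\<kappa> * r powr (- 2 * s)
    + 2 * e * ?\<kappa> * (\<eta> / 2) powr (- 2 * s) + 4 * (W x t + \<theta>) * ?h * (\<mu> - x $ i) powr (- 2 * s)"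
    by (rule nonlocal_op_at_perturbed_min[where W = "\<lambda>y. W y t" and a = x0 and \<mu> = \<mu> and i = i and B = B])
       (use s cont B anti at \<theta> r e \<eta> xi Wx\<theta> m minall in auto)
  let ?D = "d0 powr (- 2 * s)"
  have four: "(1 / 2) powr (- 2 * s) \<le> (4::real)"
  proof -
    have "(1 / 2) powr (- 2 * s) = (2::real) powr (2 * s)" by (simp add: powr_divide powr_minus_divide)
    also have "\<dots> \<le> 2 powr 2" using s by (intro powr_mono) auto
    finally show ?thesis by simp
  qed
  have rD: "r powr (- 2 * s) \<le> 4 * ?D"
  proof -
    have "r powr (- 2 * s) = (1 / 2) powr (- 2 * s) * ?D" using d0 powr_mult[of "1/2" d0 "- 2 * s"] by (simp add: r_def)
    then show ?thesis using four by (simp add: mult_right_mono)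
  qed
  have \<eta>D: "(\<eta> / 2) powr (- 2 * s) \<le> 4 * \<eta> powr (- 2 * s)"
  proof -
    have "(\<eta> / 2) powr (- 2 * s) = (1 / 2) powr (- 2 * s) * \<eta> powr (- 2 * s)" using \<eta> powr_mult[of "1/2" \<eta> "- 2 * s"] by simp
    then show ?thesis using four by (simp add: mult_right_mono)
  qed
  have dD: "?D / 4 \<le> (\<mu> - x $ i) powr (- 2 * s)"
  proof -
    have "?D / 4 \<le> (1 / 2) powr (2 * s) * ?D"
    proof -
      have "(1 / 2) powr 2 \<le> (1 / 2 :: real) powr (2 * s)" using s by (intro powr_mono') auto
      then have "1 / 4 \<le> (1 / 2 :: real) powr (2 * s)" by (simp add: power2_eq_square)
      from mult_right_mono[OF this, of ?D] show ?thesis by simp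
    qed
    also have "\<dots> = (2 * d0) powr (- 2 * s)" using d0 by (simp add: powr_mult powr_divide powr_minus_divide)
    also have "\<dots> \<le> (\<mu> - x $ i) powr (- 2 * s)" using xi d0 s by (intro powr_mono2') auto
    finally show ?thesis .
  qed
  have Tk: "k = 2 * ?\<epsilon> * m * ?D" unfolding k_def T_def by (simp add: powr_minus divide_inverse)
  have h: "0 < ?h" by (rule half_space_const_pos)
  have \<kappa>: "0 \<le> ?\<kappa>" by (rule kernel_mass_nonneg)
  have "10 * \<theta> * ?\<kappa> * r powr (- 2 * s) \<le> 10 * \<theta> * ?\<kappa> * (4 * ?D)"
    using rD \<theta> \<kappa> by (intro mult_left_mono) auto
  moreover have "2 * e * ?\<kappa> * (\<eta> / 2) powr (- 2 * s) \<le> 2 * e * ?\<kappa> * (4 * \<eta> powr (- 2 * s))"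
    using \<eta>D e \<kappa> by (intro mult_left_mono) auto
  moreover have "4 * (W x t + \<theta>) * ?h * (\<mu> - x $ i) powr (- 2 * s) \<le> 4 * (W x t + \<theta>) * ?h * (?D / 4)"
    using dD Wx\<theta> m h by (intro mult_left_mono_neg) (auto simp: mult_nonpos_nonneg)
  moreover have "4 * (W x t + \<theta>) * ?h * (?D / 4) \<le> 4 * (- (m / 2)) * ?h * (?D / 4)"
    using Wx\<theta> h by (intro mult_right_mono) auto
  ultimately have N2: "nonlocal_op s (\<lambda>y. W y t) x \<le> 10 * \<theta> * ?\<kappa> * (4 * ?D) + 2 * e * ?\<kappa> * (4 * \<eta> powr (- 2 * s)) + 4 * (- (m / 2)) * ?h * (?D / 4)"
    using N by linarith
  have "W' x t + c * nonlocal_op s (\<lambda>y. W y t) x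
     \<le> 2 * ?\<epsilon> * m * ?D + c * (10 * \<theta> * ?\<kappa> * (4 * ?D) + 2 * e * ?\<kappa> * (4 * \<eta> powr (- 2 * s)) + 4 * (- (m / 2)) * ?h * (?D / 4))"
    by (rule add_mono[OF W't[unfolded Tk] mult_left_mono[OF N2 less_imp_le[OF c]]])
  also have "\<dots> = (?\<epsilon> * (2 + 160 * c * ?\<kappa>)) * (m * ?D) - c * ?h / 2 * (m * ?D) + 8 * c * ?\<kappa> * e * \<eta> powr (- 2 * s)"
    by (simp add: \<theta>_def algebra_simps)
  also have "\<dots> \<le> (c * ?h / 4) * (m * ?D) - c * ?h / 2 * (m * ?D) + 8 * c * ?\<kappa> * e * \<eta> powr (- 2 * s)"
    using m by (intro add_mono diff_mono mult_right_mono[OF \<epsilon>(3)] order_refl) simp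
  finally have "W' x t + c * nonlocal_op s (\<lambda>y. W y t) x \<le> 8 * c * ?\<kappa> * e * \<eta> powr (- 2 * s) - c * ?h / 4 * m * ?D"
    by (simp add: algebra_simps)
  moreover have "W x t \<le> - (m / 2)" using Wx\<theta> \<theta> by linarith
  ultimately show ?thesis using comp[OF x] W_near[OF x] by (intro exI[of _ x] exI[of _ t]) (auto simp: r_def)
qed

section \<open>Moving planes\<close>

lemma powr_diff_le:
  fixes a b p :: real
  assumes "0 < b" "b \<le> a" "1 < p"
  shows "a powr p - b powr p \<le> p * a powr (p - 1) * (a - b)"
proof (cases "a = b")
  case False
  then have ab: "b < a" using assms by simp
  have "\<exists>z>b. z < a \<and> a powr p - b powr p = (a - b) * (p * z powr (p - 1))"
    by (rule MVT2[OF ab]) (use assms in \<open>auto intro!: derivative_eq_intros\<close>)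
  then obtain z where z: "b < z" "z < a" "a powr p - b powr p = (a - b) * (p * z powr (p - 1))" by blast
  have "z powr (p - 1) \<le> a powr (p - 1)" using z assms by (intro powr_mono2) auto
  then have "(a - b) * (p * z powr (p - 1)) \<le> (a - b) * (p * a powr (p - 1))"
    using ab assms by (intro mult_left_mono) auto
  then show ?thesis using z by (simp add: mult_ac)
qed simp

lemma half_distance:
  fixes a b q :: real
  assumes "\<bar>a - b\<bar> \<le> (q - b) / 2" "b < q"
  shows "(q - b) / 2 \<le> q - a" "a < q" "q - 2 * (q - b) < a"
proof -
  have "a - b \<le> (q - b) / 2" "- (a - b) \<le> (q - b) / 2"
    using assms(1) by (rule abs_le_D1, rule abs_le_D2)
  then have "2 * a \<le> q + b" "3 * b \<le> q + 2 * a" by (simp_all add: field_simps)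
  then show "(q - b) / 2 \<le> q - a" "a < q" "q - 2 * (q - b) < a"
    using assms(2) by (simp_all add: field_simps)
qed

lemma norm_plane_refl_le:
  fixes y :: "real ^ 'n"
  shows "norm (plane_refl i \<mu> y) \<le> 3 * norm y + 2 * \<bar>\<mu>\<bar>"
proof -
  have "norm (plane_refl i \<mu> y) \<le> norm y + \<bar>2 * (\<mu> - y $ i)\<bar>"
    unfolding plane_refl_def by (rule order_trans[OF norm_triangle_ineq]) simp
  also have "\<dots> \<le> norm y + 2 * (\<bar>\<mu>\<bar> + \<bar>y $ i\<bar>)"
    using abs_triangle_ineq4[of \<mu> "y $ i"] by (simp add: abs_mult)
  also have "\<dots> \<le> 3 * norm y + 2 * \<bar>\<mu>\<bar>" using component_le_norm_cart[of y i] by simp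
  finally show ?thesis .
qed

locale indefinite_solution =
  fixes s p M c :: real and i :: "'n::finite" and u h :: "real ^ 'n \<Rightarrow> real \<Rightarrow> real"
  assumes s: "0 < s" "s < 1" and p: "1 < p" and c: "0 < c"
    and pos: "0 < u x t" and le_M: "u x t \<le> M"
    and C11: "(\<lambda>x. u x t) \<in> C11_loc"
    and deriv: "(u x has_real_derivative h x t) (at t)"
    and h_cont: "continuous_on UNIV (h x)"
    and equation: "h x t = x $ i * u x t powr p - c * nonlocal_op s (\<lambda>y. u y t) x"

sublocale indefinite_solution \<subseteq> frac_heat s M c "\<lambda>R. R * M powr p" u h "\<lambda>x t. x $ i * u x t powr p"
proof
  have uc: "continuous_on UNIV (\<lambda>x. u x t)" for t using C11 by (rule C11_loc_continuous)
  show "\<bar>u x t\<bar> \<le> M" for x t using pos[of x t] le_M[of x t] by simp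
  show "(\<lambda>x. x $ i * u x t powr p) \<in> borel_measurable borel" for t
    by (intro borel_measurable_continuous_onI continuous_intros uc) (use pos in \<open>auto simp: less_le\<close>)
  have "continuous_on UNIV (u x)" for x using deriv by (meson DERIV_isCont continuous_at_imp_continuous_on)
  then show "continuous_on UNIV (\<lambda>t. x $ i * u x t powr p)" for x
    by (intro continuous_intros) (use pos in \<open>auto simp: less_le\<close>)
  show "\<bar>x $ i * u x t powr p\<bar> \<le> R * M powr p" if "norm x \<le> R" for x t R
  proof -
    have "\<bar>x $ i\<bar> \<le> R" using component_le_norm_cart[of x i] that by linarith
    moreover have "u x t powr p \<le> M powr p" using pos[of x t] le_M[of x t] p by (intro powr_mono2) auto
    ultimately show ?thesis by (simp add: abs_mult mult_mono)
  qed
qed (use s c C11 deriv h_cont equation in auto)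

context indefinite_solution
begin

text \<open>The reflected solution minus the solution; \<open>reaction\<close> below is the right-hand side of its equation.\<close>

definition w :: "real \<Rightarrow> real ^ 'n \<Rightarrow> real \<Rightarrow> real" where
  "w \<mu> x t = u (plane_refl i \<mu> x) t - u x t"

lemma w_bdd: "\<bar>w \<mu> x t\<bar> \<le> M"
  using pos[of x t] le_M[of x t] pos[of "plane_refl i \<mu> x" t] le_M[of "plane_refl i \<mu> x" t] by (simp add: w_def)

lemma M_pos: "0 < M" using pos le_M by (meson less_le_trans)

lemma powr_le_M: "u x t powr p \<le> M powr p"
  using pos[of x t] le_M[of x t] p by (intro powr_mono2) auto

lemma w_right_lipschitz: "\<exists>C\<ge>0. \<forall>y t. norm y \<le> R \<longrightarrow> a \<le> t \<longrightarrow> \<bar>w \<mu> y t - w \<mu> y a\<bar> \<le> C * (t - a)"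
proof -
  obtain C where C: "C \<ge> 0" "\<And>x t. norm x \<le> max R (3 * R + 2 * \<bar>\<mu>\<bar>) \<Longrightarrow> a \<le> t \<Longrightarrow> \<bar>u x t - u x a\<bar> \<le> C * (t - a)"
    using right_lipschitz_in_time[of "max R (3 * R + 2 * \<bar>\<mu>\<bar>)" a] by blast
  have "\<bar>w \<mu> y t - w \<mu> y a\<bar> \<le> (2 * C) * (t - a)" if y: "norm y \<le> R" "a \<le> t" for y t
  proof -
    have "norm (plane_refl i \<mu> y) \<le> max R (3 * R + 2 * \<bar>\<mu>\<bar>)"
      using norm_plane_refl_le[of i \<mu> y] y by linarith
    then have "\<bar>u (plane_refl i \<mu> y) t - u (plane_refl i \<mu> y) a\<bar> \<le> C * (t - a)" using y by (intro C(2))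
    moreover have "\<bar>u y t - u y a\<bar> \<le> C * (t - a)" using y by (intro C(2)) auto
    ultimately show ?thesis unfolding w_def by linarith
  qed
  then show ?thesis using C(1) by (intro exI[of _ "2 * C"]) auto
qed

lemma w_nonlocal:
  "nonlocal_at s (\<lambda>y. w \<mu> y t) x"
  "nonlocal_op s (\<lambda>y. w \<mu> y t) x = nonlocal_op s (\<lambda>y. u y t) (plane_refl i \<mu> x) - nonlocal_op s (\<lambda>y. u y t) x"
proof -
  note r = nonlocal_plane_refl[OF u_meas nonlocal_at_u, of i \<mu> t x]
  show "nonlocal_at s (\<lambda>y. w \<mu> y t) x"
    unfolding w_def by (rule nonlocal_diff(1)[OF r(1) nonlocal_at_u])
  show "nonlocal_op s (\<lambda>y. w \<mu> y t) x = nonlocal_op s (\<lambda>y. u y t) (plane_refl i \<mu> x) - nonlocal_op s (\<lambda>y. u y t) x"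
    unfolding w_def nonlocal_diff(2)[OF r(1) nonlocal_at_u] r(2) ..
qed

definition reaction :: "real \<Rightarrow> real ^ 'n \<Rightarrow> real \<Rightarrow> real" where
  "reaction \<mu> x t = (2 * \<mu> - x $ i) * u (plane_refl i \<mu> x) t powr p - x $ i * u x t powr p"

lemma w_equation:
  "h (plane_refl i \<mu> x) t - h x t + c * nonlocal_op s (\<lambda>y. w \<mu> y t) x = reaction \<mu> x t"
  unfolding w_nonlocal(2) equation reaction_def by (simp add: algebra_simps)

lemma w_negative_minimum:
  assumes \<sigma>: "\<bar>\<sigma>\<bar> = (1::real)" and m: "0 < m" and e: "0 \<le> e"
    and d0: "x0 $ i < \<mu>" "4 * (\<mu> - x0 $ i) \<le> \<eta>"
    and near: "\<And>y t. \<mu> - \<eta> < y $ i \<Longrightarrow> y $ i < \<mu> \<Longrightarrow> - m \<le> \<sigma> * w \<mu> y t"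
    and far: "\<And>y t. y $ i < \<mu> \<Longrightarrow> - m - e \<le> \<sigma> * w \<mu> y t"
    and W0: "\<sigma> * w \<mu> x0 t0 < - (1 - depth_tolerance TYPE('n) s c) * m"
  shows "\<exists>x t. \<bar>x $ i - x0 $ i\<bar> \<le> (\<mu> - x0 $ i) / 2 \<and> - m \<le> \<sigma> * w \<mu> x t \<and> \<sigma> * w \<mu> x t \<le> - (m / 2) \<and>
    \<sigma> * reaction \<mu> x t \<le> 8 * c * kernel_mass TYPE('n) s * e * \<eta> powr (- 2 * s)
        - c * half_space_const TYPE('n) s / 4 * m * (\<mu> - x0 $ i) powr (- 2 * s)"
proof -
  have uc: "continuous_on UNIV (\<lambda>y. u (plane_refl i \<mu> y) t)" for t
    by (rule continuous_on_compose2[OF u_cont_x, of UNIV "plane_refl i \<mu>"]) (auto intro!: continuous_intros)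
  have "\<exists>x t. \<bar>x $ i - x0 $ i\<bar> \<le> (\<mu> - x0 $ i) / 2 \<and> - m \<le> \<sigma> * w \<mu> x t \<and> \<sigma> * w \<mu> x t \<le> - (m / 2) \<and>
    \<sigma> * (h (plane_refl i \<mu> x) t - h x t) + c * nonlocal_op s (\<lambda>y. \<sigma> * w \<mu> y t) x
      \<le> 8 * c * kernel_mass TYPE('n) s * e * \<eta> powr (- 2 * s)
        - c * half_space_const TYPE('n) s / 4 * m * (\<mu> - x0 $ i) powr (- 2 * s)"
  proof (rule antisym_negative_minimum[where i = i and B = M and W = "\<lambda>x t. \<sigma> * w \<mu> x t"])
    show "continuous_on UNIV (\<lambda>y. \<sigma> * w \<mu> y t)" for t
      unfolding w_def by (intro continuous_intros uc u_cont_x)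
    show "\<bar>\<sigma> * w \<mu> y t\<bar> \<le> M" for y t using w_bdd \<sigma> by (simp add: abs_mult)
    show "\<exists>C\<ge>0. \<forall>y t. norm y \<le> R \<longrightarrow> a \<le> t \<longrightarrow> \<bar>\<sigma> * w \<mu> y t - \<sigma> * w \<mu> y a\<bar> \<le> C * (t - a)" for R a
      using w_right_lipschitz[of R a \<mu>] \<sigma> by (simp add: abs_mult right_diff_distrib[symmetric])
    show "((\<lambda>t. \<sigma> * w \<mu> y t) has_real_derivative \<sigma> * (h (plane_refl i \<mu> y) t - h y t)) (at t)" for y t
      unfolding w_def by (auto intro!: derivative_eq_intros deriv)
    show "nonlocal_at s (\<lambda>y. \<sigma> * w \<mu> y t) y" for y t by (rule nonlocal_cmult(1)[OF w_nonlocal(1)])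
    show "\<sigma> * w \<mu> (plane_refl i \<mu> y) t = - (\<sigma> * w \<mu> y t)" for y t by (simp add: w_def algebra_simps)
  qed (use s c m e d0 near far W0 in auto)
  then show ?thesis unfolding nonlocal_cmult(2)[OF w_nonlocal(1)] w_equation[symmetric]
    by (simp add: algebra_simps)
qed

text \<open>Otherwise \<open>\<bar>w\<bar>\<close> has a positive limiting supremum \<open>S0\<close> at distance zero from the planes. Choose \<open>\<eta>\<close> with
supremum within the tolerance of \<open>S0\<close>, and a nearly extremal point at a distance much
smaller than \<open>\<eta>\<close>. The gain \<open>m * d powr (- 2 * s)\<close> at that point then exceeds both the error at
scale \<open>\<eta>\<close> and the reaction term, which is bounded on strips.\<close>

lemma w_modulus:
  assumes \<epsilon>: "0 < \<epsilon>"
  shows "\<exists>\<delta>>0. \<forall>\<mu> x t. \<bar>\<mu>\<bar> \<le> L \<longrightarrow> x $ i < \<mu> \<longrightarrow> \<mu> - x $ i < \<delta> \<longrightarrow> \<bar>w \<mu> x t\<bar> \<le> \<epsilon>"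
proof (rule ccontr)
  assume "\<not> ?thesis"
  then have neg: "\<exists>\<mu> x t. \<bar>\<mu>\<bar> \<le> L \<and> x $ i < \<mu> \<and> \<mu> - x $ i < \<delta> \<and> \<epsilon> < \<bar>w \<mu> x t\<bar>" if "0 < \<delta>" for \<delta>
    using that by (meson not_le)
  let ?h = "half_space_const TYPE('n) s" and ?\<kappa> = "kernel_mass TYPE('n) s" and ?b = "depth_tolerance TYPE('n) s c"
  note b = depth_tolerance(1,2)[OF c, where 'n='n and s=s]
  define V where "V = (\<lambda>\<delta>. {\<bar>w \<mu> x t\<bar> |\<mu> x t. \<bar>\<mu>\<bar> \<le> L \<and> x $ i < \<mu> \<and> \<mu> - x $ i < \<delta>})"
  have V_bdd: "bdd_above (V \<delta>)" for \<delta> using w_bdd by (auto simp: V_def bdd_above_def)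
  have V_sup: "\<bar>w \<mu> x t\<bar> \<le> Sup (V \<delta>)" if "\<bar>\<mu>\<bar> \<le> L" "x $ i < \<mu>" "\<mu> - x $ i < \<delta>" for \<mu> x t \<delta>
    using that by (intro cSup_upper V_bdd) (auto simp: V_def)
  have V_ge: "\<epsilon> < Sup (V \<delta>)" if "0 < \<delta>" for \<delta> using neg[OF that] V_sup by (meson less_le_trans)
  have V_ne: "V \<delta> \<noteq> {}" if "0 < \<delta>" for \<delta> using neg[OF that] unfolding V_def by blast
  define S where "S = (\<lambda>\<delta>. Sup (V \<delta>)) ` {0<..1}"
  have S_bdd: "bdd_below S" using V_ge by (auto simp: S_def bdd_below_def intro!: exI[of _ \<epsilon>] less_imp_le)
  have S_ne: "S \<noteq> {}" by (auto simp: S_def)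
  define S0 where "S0 = Inf S"
  have S0: "\<epsilon> \<le> S0" unfolding S0_def using S_ne V_ge by (intro cInf_greatest) (auto simp: S_def less_imp_le)
  have "S0 < S0 / (1 - ?b)" using S0 \<epsilon> b by (simp add: field_simps)
  then obtain \<eta> where \<eta>: "0 < \<eta>" "\<eta> \<le> 1" "Sup (V \<eta>) < S0 / (1 - ?b)"
    using cInf_lessD[OF S_ne, of "S0 / (1 - ?b)"] unfolding S0_def S_def by auto
  define m where "m = Sup (V \<eta>)"
  have m: "0 < m" "(1 - ?b) * m < S0" using V_ge[OF \<eta>(1)] \<epsilon> \<eta>(3) b by (auto simp: m_def field_simps)
  define g where "g = c * ?h / 4 * m"
  have g: "0 < g" using c m half_space_const_pos[where 'n='n] by (simp add: g_def)
  define Q where "Q = 2 * (\<bar>L\<bar> + 2) * M powr p + 8 * c * ?\<kappa> * M * \<eta> powr (- 2 * s)"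
  have Q: "0 \<le> Q" unfolding Q_def using c M_pos kernel_mass_nonneg[where 'n='n] by (intro add_nonneg_nonneg) auto
  define Y where "Y = Q / g + 1"
  have Y: "0 < Y" using Q g by (simp add: Y_def add_nonneg_pos)
  \<comment> \<open>Points closer than \<open>\<delta>\<close> have \<open>d powr (- 2 * s) \<ge> Y\<close>, which is more than \<open>Q / g\<close>.\<close>
  define \<delta> where "\<delta> = min (\<eta> / 4) (Y powr (- 1 / (2 * s)))"
  have \<delta>: "0 < \<delta>" "\<delta> \<le> \<eta> / 4" "\<delta> \<le> 1" using \<eta> Y by (auto simp: \<delta>_def)
  have "S0 \<le> Sup (V \<delta>)" unfolding S0_def using \<delta> by (intro cInf_lower S_bdd) (auto simp: S_def)
  then have "(1 - ?b) * m < Sup (V \<delta>)" using m by linarith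
  then obtain \<mu> x0 t0 where x0: "\<bar>\<mu>\<bar> \<le> L" "x0 $ i < \<mu>" "\<mu> - x0 $ i < \<delta>" "(1 - ?b) * m < \<bar>w \<mu> x0 t0\<bar>"
    using less_cSupE[OF _ V_ne[OF \<delta>(1)]] by (force simp: V_def)
  define \<sigma> where "\<sigma> = (if w \<mu> x0 t0 < 0 then 1 else - 1 :: real)"
  have \<sigma>: "\<bar>\<sigma>\<bar> = 1" "\<sigma> * w \<mu> x0 t0 = - \<bar>w \<mu> x0 t0\<bar>" by (auto simp: \<sigma>_def)
  have \<sigma>w: "- \<bar>w \<mu> y t\<bar> \<le> \<sigma> * w \<mu> y t" for y t by (auto simp: \<sigma>_def)
  have "\<exists>x t. \<bar>x $ i - x0 $ i\<bar> \<le> (\<mu> - x0 $ i) / 2 \<and> - m \<le> \<sigma> * w \<mu> x t \<and> \<sigma> * w \<mu> x t \<le> - (m / 2) \<and>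
    \<sigma> * reaction \<mu> x t \<le> 8 * c * ?\<kappa> * M * \<eta> powr (- 2 * s) - c * ?h / 4 * m * (\<mu> - x0 $ i) powr (- 2 * s)"
  proof (rule w_negative_minimum[OF \<sigma>(1) m(1)])
    show "- m \<le> \<sigma> * w \<mu> y t" if "\<mu> - \<eta> < y $ i" "y $ i < \<mu>" for y t
      using V_sup[OF x0(1) that(2), of \<eta> t] that \<sigma>w[of y t] by (simp add: m_def)
    show "\<sigma> * w \<mu> x0 t0 < - (1 - ?b) * m" using x0(4) unfolding \<sigma>(2)
      by (simp only: mult_minus_left neg_less_iff_less)
    show "- m - M \<le> \<sigma> * w \<mu> y t" for y t using \<sigma>w[of y t] w_bdd[of \<mu> y t] m by linarith
  qed (use M_pos x0 \<delta> in auto)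
  then obtain x t where x: "\<bar>x $ i - x0 $ i\<bar> \<le> (\<mu> - x0 $ i) / 2"
    and r: "\<sigma> * reaction \<mu> x t \<le> 8 * c * ?\<kappa> * M * \<eta> powr (- 2 * s) - g * (\<mu> - x0 $ i) powr (- 2 * s)"
    unfolding g_def by blast
  have xi: "\<bar>x $ i\<bar> \<le> \<bar>L\<bar> + 2" "\<bar>2 * \<mu> - x $ i\<bar> \<le> \<bar>L\<bar> + 2"   proof -
    have "\<mu> - 2 < x $ i" "x $ i < \<mu>"
      using half_distance[OF x x0(2)] x0(3) \<delta>(3) by simp_all
    then show "\<bar>x $ i\<bar> \<le> \<bar>L\<bar> + 2" "\<bar>2 * \<mu> - x $ i\<bar> \<le> \<bar>L\<bar> + 2" using x0(1) by auto
  qed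
  have "\<bar>reaction \<mu> x t\<bar> \<le> \<bar>2 * \<mu> - x $ i\<bar> * u (plane_refl i \<mu> x) t powr p + \<bar>x $ i\<bar> * u x t powr p"
    unfolding reaction_def by (rule order_trans[OF abs_triangle_ineq4]) (simp add: abs_mult)
  also have "\<dots> \<le> (\<bar>L\<bar> + 2) * M powr p + (\<bar>L\<bar> + 2) * M powr p"
    using xi by (intro add_mono mult_mono powr_le_M) auto
  finally have "\<bar>reaction \<mu> x t\<bar> \<le> 2 * (\<bar>L\<bar> + 2) * M powr p" by (simp add: algebra_simps)
  moreover have "- \<bar>reaction \<mu> x t\<bar> \<le> \<sigma> * reaction \<mu> x t" by (auto simp: \<sigma>_def)
  ultimately have "g * (\<mu> - x0 $ i) powr (- 2 * s) \<le> Q" using r unfolding Q_def by linarith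
  moreover have "Y \<le> (\<mu> - x0 $ i) powr (- 2 * s)"
  proof -
    have "Y = (Y powr (- 1 / (2 * s))) powr (- 2 * s)" using Y s by (simp add: powr_powr)
    also have "\<dots> \<le> \<delta> powr (- 2 * s)" using \<delta>(1) s by (intro powr_mono2') (auto simp: \<delta>_def)
    also have "\<dots> \<le> (\<mu> - x0 $ i) powr (- 2 * s)" using x0 s by (intro powr_mono2') auto
    finally show ?thesis .
  qed
  ultimately have "g * Y \<le> Q" using g by (meson less_imp_le mult_left_mono order_trans)
  then show False using g by (simp add: Y_def distrib_left)
qed

definition reflected_above :: "real \<Rightarrow> bool" where
  "reflected_above \<mu> \<longleftrightarrow> (\<forall>x t. x $ i < \<mu> \<longrightarrow> 0 \<le> w \<mu> x t)"

text \<open>For the planes up to \<open>\<Lambda>\<close> a violation cannot be shallow in the strip \<open>0 < x $ i < \<mu>\<close>. The constants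
follow the three cases at a nearly deepest point: \<open>u0\<close> is the size of \<open>u\<close> and \<open>\<delta>0\<close> twice the
distance to the plane below which the reaction is too weak to compensate the nonlocal term, and
\<open>m0\<close> is so small that otherwise the source \<open>2 * (\<mu> - x $ i) * v powr p\<close> prevails.\<close>

lemma reflected_above_gap:
  assumes \<Lambda>: "0 < \<Lambda>"
  shows "\<exists>m0>0. \<forall>\<mu>\<le>\<Lambda>. (\<forall>x t. 0 < x $ i \<longrightarrow> x $ i < \<mu> \<longrightarrow> - m0 \<le> w \<mu> x t) \<longrightarrow> reflected_above \<mu>"
proof -
  define g where "g = c * half_space_const TYPE('n) s / 4"
  have g: "0 < g" using c half_space_const_pos[where 'n='n] by (simp add: g_def)
  define b where "b = g * (2 * \<Lambda>) powr (- 2 * s) / (\<Lambda> * p)"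
  define u0 where "u0 = b powr (1 / (p - 1))"
  define A where "A = \<Lambda> * p * M powr (p - 1)"
  define \<delta>0 where "\<delta>0 = (A / g) powr (- 1 / (2 * s))"
  have b: "0 < b" using g \<Lambda> p by (simp add: b_def)
  have u0: "0 < u0" using b by (simp add: u0_def)
  have A: "0 < A" using \<Lambda> p M_pos by (simp add: A_def)
  have \<delta>0: "0 < \<delta>0" using A g by (simp add: \<delta>0_def)
  define m0 where "m0 = min (u0 / 2) (\<delta>0 * (u0 / 2) powr p / A)"
  have m0: "0 < m0" "m0 \<le> u0 / 2" "A * m0 \<le> \<delta>0 * (u0 / 2) powr p"
  proof -
    show "0 < m0" using u0 \<delta>0 A by (simp add: m0_def)
    show "m0 \<le> u0 / 2" unfolding m0_def by (rule min.cobounded1)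
    have "m0 \<le> \<delta>0 * (u0 / 2) powr p / A" unfolding m0_def by (rule min.cobounded2)
    then show "A * m0 \<le> \<delta>0 * (u0 / 2) powr p" using A by (simp add: pos_le_divide_eq mult.commute)
  qed
  have "reflected_above \<mu>" if \<mu>: "\<mu> \<le> \<Lambda>" and low: "\<And>x t. 0 < x $ i \<Longrightarrow> x $ i < \<mu> \<Longrightarrow> - m0 \<le> w \<mu> x t" for \<mu>
  proof (rule ccontr)
    assume "\<not> reflected_above \<mu>"
    then obtain x1 t1 where x1: "x1 $ i < \<mu>" "w \<mu> x1 t1 < 0" by (auto simp: reflected_above_def not_le)
    define V where "V = {w \<mu> x t |x t. x $ i < \<mu>}"
    have "- M \<le> w \<mu> x t" for x t using w_bdd[of \<mu> x t] by linarith
    then have V_bdd: "bdd_below V" unfolding V_def by (intro bdd_belowI[of _ "- M"]) auto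
    have V_ne: "V \<noteq> {}" using x1 by (auto simp: V_def)
    define m where "m = - Inf V"
    have V_low: "- m \<le> w \<mu> x t" if "x $ i < \<mu>" for x t
      unfolding m_def using that V_bdd by (auto simp: V_def intro!: cInf_lower)
    have m: "0 < m" using V_low[OF x1(1), of t1] x1(2) by linarith
    have "Inf V < - (1 - depth_tolerance TYPE('n) s c) * m"
    proof -
      have "0 < depth_tolerance TYPE('n) s c * m" using depth_tolerance(1)[OF c, where 'n='n and s=s] m by simp
      then show ?thesis by (simp add: m_def algebra_simps)
    qed
    then obtain x0 t0 where x0: "x0 $ i < \<mu>" "w \<mu> x0 t0 < - (1 - depth_tolerance TYPE('n) s c) * m"
      using cInf_lessD[OF V_ne, of "- (1 - depth_tolerance TYPE('n) s c) * m"] by (auto simp: V_def)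
    define d0 where "d0 = \<mu> - x0 $ i"
    have d0: "0 < d0" using x0 by (simp add: d0_def)
    have "\<exists>x t. \<bar>x $ i - x0 $ i\<bar> \<le> (\<mu> - x0 $ i) / 2 \<and> - m \<le> 1 * w \<mu> x t \<and> 1 * w \<mu> x t \<le> - (m / 2) \<and>
      1 * reaction \<mu> x t \<le> 8 * c * kernel_mass TYPE('n) s * 0 * (4 * (\<mu> - x0 $ i)) powr (- 2 * s)
          - c * half_space_const TYPE('n) s / 4 * m * (\<mu> - x0 $ i) powr (- 2 * s)"
      by (rule w_negative_minimum) (use m x0 V_low in auto)
    then obtain x t where x: "\<bar>x $ i - x0 $ i\<bar> \<le> d0 / 2" and wx: "- m \<le> w \<mu> x t" "w \<mu> x t \<le> - (m / 2)"
      and r: "reaction \<mu> x t \<le> - (g * d0 powr (- 2 * s)) * m"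
      by (auto simp: d0_def g_def algebra_simps)
    define v where "v = u (plane_refl i \<mu> x) t"
    define a where "a = u x t"
    have va: "0 < v" "v \<le> a" "a \<le> M" "a - v \<le> m" "w \<mu> x t = v - a"
      using pos le_M wx m by (auto simp: v_def a_def w_def)
    have r_eq: "reaction \<mu> x t = 2 * (\<mu> - x $ i) * v powr p - x $ i * (a powr p - v powr p)"
      by (simp add: reaction_def v_def a_def algebra_simps)
    have xd: "d0 / 2 \<le> \<mu> - x $ i" using half_distance(1)[OF x[unfolded d0_def] x0(1)] by (simp add: d0_def)
    have r_neg: "reaction \<mu> x t < 0"
    proof -
      have "- (g * d0 powr (- 2 * s)) * m < 0" using g d0 m by simp
      with r show ?thesis by (rule le_less_trans)
    qed
    have mono: "v powr p \<le> a powr p" using va p by (intro powr_mono2) auto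
    have first: "0 \<le> 2 * (\<mu> - x $ i) * v powr p" using xd d0 by simp
    have xpos: "0 < x $ i"
    proof (rule ccontr)
      assume "\<not> ?thesis"
      then have "x $ i * (a powr p - v powr p) \<le> 0" using mono by (intro mult_nonpos_nonneg) auto
      then show False using r_neg first unfolding r_eq by linarith
    qed
    have xi: "x $ i < \<mu>" using xd d0 by linarith
    have d0\<Lambda>: "d0 \<le> 2 * \<Lambda>" using xd xpos \<mu> by linarith
    have second: "x $ i * (a powr p - v powr p) \<le> \<Lambda> * p * a powr (p - 1) * (a - v)"
    proof -
      have "x $ i * (a powr p - v powr p) \<le> \<Lambda> * (p * a powr (p - 1) * (a - v))"
        using powr_diff_le[OF va(1,2) p] xi xpos \<mu> mono by (intro mult_mono) auto
      then show ?thesis by (simp add: mult.assoc)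
    qed
    \<comment> \<open>Otherwise the reaction is too weak to compensate the nonlocal term.\<close>
    have coef: "g * d0 powr (- 2 * s) \<le> \<Lambda> * p * a powr (p - 1)"
    proof (rule ccontr)
      assume "\<not> ?thesis"
      then have "\<Lambda> * p * a powr (p - 1) * m < g * d0 powr (- 2 * s) * m" using m by simp
      moreover have "\<Lambda> * p * a powr (p - 1) * (a - v) \<le> \<Lambda> * p * a powr (p - 1) * m"
        using va \<Lambda> p by (intro mult_left_mono) auto
      ultimately show False using r first second unfolding r_eq mult_minus_left by linarith
    qed
    have a_ge: "u0 \<le> a"
    proof -
      have "(2 * \<Lambda>) powr (- 2 * s) \<le> d0 powr (- 2 * s)" using d0\<Lambda> d0 s by (intro powr_mono2') auto
      then have "g * (2 * \<Lambda>) powr (- 2 * s) \<le> \<Lambda> * p * a powr (p - 1)"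
        using coef g by (meson less_imp_le mult_left_mono order_trans)
      then have "b \<le> a powr (p - 1)" using \<Lambda> p by (simp add: b_def divide_le_eq mult.commute)
      then have "u0 \<le> (a powr (p - 1)) powr (1 / (p - 1))" unfolding u0_def using b p by (intro powr_mono2) auto
      also have "\<dots> = a" using va p by (simp add: powr_powr)
      finally show ?thesis .
    qed
    have d_ge: "\<delta>0 \<le> d0"
    proof -
      have "a powr (p - 1) \<le> M powr (p - 1)" using va p by (intro powr_mono2) auto
      then have "\<Lambda> * p * a powr (p - 1) \<le> A" unfolding A_def using \<Lambda> p by (intro mult_left_mono) auto
      then have le: "d0 powr (- 2 * s) \<le> A / g" using coef g by (simp add: pos_le_divide_eq mult.commute)
      have "\<delta>0 \<le> (d0 powr (- 2 * s)) powr (- 1 / (2 * s))"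
        unfolding \<delta>0_def using le d0 s by (intro powr_mono2') auto
      also have "\<dots> = d0" using d0 s by (simp add: powr_powr)
      finally show ?thesis .
    qed
    \<comment> \<open>The remaining case: \<open>a\<close> and the distance are bounded below, and the source wins.\<close>
    have small: "a - v \<le> m0" using low[OF xpos xi, of t] va by linarith
    have "\<Lambda> * p * a powr (p - 1) * (a - v) \<le> A * m0"
      unfolding A_def using va small \<Lambda> p m0 by (intro mult_mono powr_mono2) auto
    moreover have "\<delta>0 * (u0 / 2) powr p \<le> 2 * (\<mu> - x $ i) * v powr p"
    proof (intro mult_mono)
      show "(u0 / 2) powr p \<le> v powr p" using small m0 a_ge u0 p by (intro powr_mono2) auto
    qed (use d_ge xd d0 in auto)
    ultimately show False using r_neg second m0(3) unfolding r_eq by linarith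
  qed
  then show ?thesis using m0(1) by (intro exI[of _ m0]) auto
qed

text \<open>The strip \<open>0 < x $ i < \<mu>\<close> is empty, so the threshold condition holds vacuously.\<close>

lemma reflected_above_nonpos: "\<mu> \<le> 0 \<Longrightarrow> reflected_above \<mu>"
  using reflected_above_gap[of 1] by (smt (verit))

text \<open>The admissible step is uniform, because both the threshold and the modulus of continuity depend only on \<open>\<Lambda>\<close>.\<close>

lemma reflected_above_step:
  assumes \<Lambda>: "0 < \<Lambda>"
  shows "\<exists>\<delta>>0. \<forall>\<mu> \<nu>. 0 \<le> \<mu> \<longrightarrow> \<mu> \<le> \<nu> \<longrightarrow> \<nu> \<le> \<Lambda> \<longrightarrow> \<nu> - \<mu> < \<delta> \<longrightarrow> reflected_above \<mu> \<longrightarrow> reflected_above \<nu>"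
proof -
  obtain m0 where m0: "0 < m0"
    "\<And>\<mu>. \<mu> \<le> \<Lambda> \<Longrightarrow> (\<And>x t. 0 < x $ i \<Longrightarrow> x $ i < \<mu> \<Longrightarrow> - m0 \<le> w \<mu> x t) \<Longrightarrow> reflected_above \<mu>"
    using reflected_above_gap[OF \<Lambda>] by blast
  obtain \<delta> where \<delta>: "0 < \<delta>" "\<And>\<mu> x t. \<bar>\<mu>\<bar> \<le> 2 * \<Lambda> \<Longrightarrow> x $ i < \<mu> \<Longrightarrow> \<mu> - x $ i < \<delta> \<Longrightarrow> \<bar>w \<mu> x t\<bar> \<le> m0"
    using w_modulus[OF m0(1), of "2 * \<Lambda>"] by blast
  have "reflected_above \<nu>" if \<mu>\<nu>: "0 \<le> \<mu>" "\<mu> \<le> \<nu>" "\<nu> \<le> \<Lambda>" "\<nu> - \<mu> < \<delta>" and ok: "reflected_above \<mu>" for \<mu> \<nu>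
  proof (cases "\<mu> = \<nu>")
    case True then show ?thesis using ok by simp
  next
    case False
    then have lt: "\<mu> < \<nu>" using \<mu>\<nu> by simp
    show ?thesis
    proof (rule m0(2)[OF \<mu>\<nu>(3)])
      fix x :: "real ^ 'n" and t assume x: "0 < x $ i" "x $ i < \<nu>"
      show "- m0 \<le> w \<nu> x t"
      proof (cases "x $ i < \<mu>")
        case True
        \<comment> \<open>Reflecting in \<open>\<mu>\<close> and then in \<open>\<rho>\<close> amounts to reflecting in \<open>\<nu>\<close>, and the first image of \<open>x\<close> is at distance \<open>\<nu> - \<mu>\<close> from \<open>\<rho>\<close>.\<close>
        define \<rho> where "\<rho> = \<mu> + \<nu> - x $ i"
        have "plane_refl i \<rho> (plane_refl i \<mu> x) = plane_refl i \<nu> x"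
          by (simp add: plane_refl_def vec_eq_iff axis_def \<rho>_def)
        then have "w \<nu> x t = w \<rho> (plane_refl i \<mu> x) t + w \<mu> x t" by (simp add: w_def)
        moreover have "\<bar>w \<rho> (plane_refl i \<mu> x) t\<bar> \<le> m0"
          by (rule \<delta>(2)) (use x True \<mu>\<nu> lt in \<open>auto simp: \<rho>_def\<close>)
        moreover have "0 \<le> w \<mu> x t" using ok True by (simp add: reflected_above_def)
        ultimately show ?thesis by linarith
      next
        case False
        have "\<bar>w \<nu> x t\<bar> \<le> m0" by (rule \<delta>(2)) (use x False \<mu>\<nu> in auto)
        then show ?thesis by linarith
      qed
    qed
  qed
  then show ?thesis using \<delta>(1) by blast
qed

lemma reflected_above_all: "reflected_above \<nu>"
proof (cases "\<nu> \<le> 0")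
  case True then show ?thesis by (rule reflected_above_nonpos)
next
  case False
  then have \<nu>: "0 < \<nu>" by simp
  obtain \<delta> where \<delta>: "0 < \<delta>"
    "\<And>\<mu> \<mu>'. 0 \<le> \<mu> \<Longrightarrow> \<mu> \<le> \<mu>' \<Longrightarrow> \<mu>' \<le> \<nu> \<Longrightarrow> \<mu>' - \<mu> < \<delta> \<Longrightarrow> reflected_above \<mu> \<Longrightarrow> reflected_above \<mu>'"
    using reflected_above_step[OF \<nu>] by blast
  have steps: "\<mu> \<le> \<nu> \<Longrightarrow> \<mu> \<le> real n * (\<delta> / 2) \<Longrightarrow> reflected_above \<mu>" for n \<mu>
  proof (induction n arbitrary: \<mu>)
    case 0 then show ?case by (simp add: reflected_above_nonpos)
  next
    case (Suc n)
    show ?case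
    proof (cases "\<mu> \<le> 0")
      case True then show ?thesis by (rule reflected_above_nonpos)
    next
      case False
      define \<mu>' where "\<mu>' = max 0 (\<mu> - \<delta> / 2)"
      have "\<mu> - \<delta> / 2 \<le> real n * (\<delta> / 2)" using Suc.prems(2) by (simp add: algebra_simps)
      moreover have "0 \<le> real n * (\<delta> / 2)" using \<delta>(1) by simp
      ultimately have "\<mu>' \<le> real n * (\<delta> / 2)" unfolding \<mu>'_def by (rule max.boundedI[rotated])
      moreover have "\<mu>' \<le> \<nu>" using False Suc.prems(1) \<delta>(1) by (simp add: \<mu>'_def)
      ultimately have "reflected_above \<mu>'" by (intro Suc.IH)
      then show ?thesis using False Suc.prems(1) \<delta>(1) by (intro \<delta>(2)[of \<mu>' \<mu>]) (auto simp: \<mu>'_def)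
    qed
  qed
  obtain n :: nat where "\<nu> / (\<delta> / 2) \<le> real n" using real_arch_simple by blast
  then have "\<nu> \<le> real n * (\<delta> / 2)" using \<delta>(1) by (simp add: divide_le_eq)
  then show ?thesis by (intro steps) auto
qed

lemma mono_axis: "mono (\<lambda>k. u (x + k *\<^sub>R axis i 1) t)"
proof (rule monoI)
  fix k k' :: real assume "k \<le> k'"
  show "u (x + k *\<^sub>R axis i 1) t \<le> u (x + k' *\<^sub>R axis i 1) t"
  proof (cases "k = k'")
    case False
    define \<mu> where "\<mu> = x $ i + (k + k') / 2"
    have "plane_refl i \<mu> (x + k *\<^sub>R axis i 1) = x + k' *\<^sub>R axis i 1"
      by (simp add: plane_refl_def vec_eq_iff axis_def \<mu>_def field_simps)
    moreover have "(x + k *\<^sub>R axis i 1) $ i < \<mu>" using False \<open>k \<le> k'\<close> by (simp add: \<mu>_def axis_def)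
    ultimately show ?thesis using reflected_above_all[of \<mu>] unfolding reflected_above_def w_def
      by (metis diff_ge_0_iff_ge)
  qed simp
qed

end

theorem theorem1p1:
  fixes u :: "real ^ 'n \<Rightarrow> real \<Rightarrow> real" and i1 :: 'n and s p :: real
  assumes "0 < s" and "s < 1" and "1 < p"
    and "classical_solution s p i1 u"
    and "\<forall>x t. 0 < u x t"
    and "bounded (range (\<lambda>(x, t). u x t))"
  shows "\<forall>x t. mono (\<lambda>h. u (x + h *\<^sub>R axis i1 1) t)"
proof -
  obtain M where M: "\<And>x t. \<bar>u x t\<bar> \<le> M" using assms(6) unfolding bounded_iff by auto
  have C11: "(\<lambda>x. u x t) \<in> C11_loc" for t
    using assms(4) by (simp add: classical_solution_def solution_class_def)
  have "\<exists>D. (\<forall>t. (u x has_vector_derivative D t) (at t)) \<and> continuous_on UNIV D" for x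
    using assms(4) by (auto simp: classical_solution_def solution_class_def C1_differentiable_on_def)
  then obtain h where h: "\<And>x t. (u x has_real_derivative h x t) (at t)" "\<And>x. continuous_on UNIV (h x)"
    unfolding has_real_derivative_iff_has_vector_derivative by metis
  let ?c = "frac_laplacian_const CARD('n) s / 2"
  have eq: "h x t = x $ i1 * u x t powr p - ?c * nonlocal_op s (\<lambda>y. u y t) x" for x t
  proof -
    have m: "(\<lambda>y. u y t) \<in> borel_measurable borel"
      using C11_loc_continuous[OF C11] by (rule borel_measurable_continuous_onI)
    obtain L where L: "L \<ge> 0" "\<And>z. norm z \<le> 1 \<Longrightarrow> \<bar>second_diff (\<lambda>y. u y t) x z\<bar> \<le> L * (norm z)\<^sup>2"
      using C11_loc_second_diff[OF C11[of t], of "norm x"] by blast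
    have "\<bar>second_diff (\<lambda>y. u y t) x z\<bar> \<le> (4 * M + L * 1\<^sup>2) * trunc_quad 1 z" for z
      by (rule second_diff_trunc_quad) (use M L in auto)
    then have "nonlocal_at s (\<lambda>y. u y t) x"
      using nonlocal_trunc_quad_bound(1)[OF assms(1,2) zero_less_one m] by blast
    then have "frac_laplacian s (\<lambda>y. u y t) x = ?c * nonlocal_op s (\<lambda>y. u y t) x"
      by (rule frac_laplacian_eq_nonlocal_op[OF assms(1,2) m M])
    moreover have "deriv (\<lambda>\<tau>. u x \<tau>) t = h x t" using h(1) by (rule DERIV_imp_deriv)
    moreover have "deriv (\<lambda>\<tau>. u x \<tau>) t + frac_laplacian s (\<lambda>y. u y t) x = x $ i1 * u x t powr p"
      using assms(4) by (simp add: classical_solution_def)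
    ultimately show ?thesis by simp
  qed
  have "indefinite_solution s p M ?c i1 u h"
  proof
    show "u x t \<le> M" for x t using M[of x t] by simp
    show "0 < ?c" using frac_laplacian_const_pos[OF assms(1,2)] by simp
  qed (use assms C11 h eq in auto)
  then show ?thesis using indefinite_solution.mono_axis by blast
qed

end
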